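(* Let $Q$ be a finite quiver, let $M$ be a finite-dimensional rigid representation of $Q$ over an algebraically closed field $K$, and let $\mathbf{e}$ be a dimension vector such that $\mathrm{Gr}_{\mathbf{e}}(M)$ is non-empty. Let $M_{\mathbb{Z}}$ be the rigid $\mathbb{Z}$-form of $M$ and let $\mathcal{X}\to\mathrm{Spec}(\mathbb{Z})$ be the quiver Grassmannian scheme over $\mathbb{Z}$ attached to $M_{\mathbb{Z}}$ and $\mathbf{e}$. Then $\mathcal{X}$ has polynomial point count: there exists a polynomial $P\in\mathbb{Z}[t]$ such that $|\mathcal{X}(\mathbb{F}_q)|=P(q)$ for every prime power $q$.
   Context: A representation $M$ of $Q$ is rigid if $\mathrm{Ext}^1_Q(M,M)=0$. The quiver Grassmannian $\mathrm{Gr}_{\mathbf{e}}(M)$ parametrizes subrepresentations of $M$ of dimension vector $\mathbf{e}$. For a rigid representation $M$ over $K$ it is known (Crawley-Boevey) that there is a unique up to isomorphism rigid $\mathbb{Z}$-form $M_{\mathbb{Z}}$, i.e. a representation of $Q$ by finitely generated free $\mathbb{Z}$-modules and $\mathbb{Z}$-linear maps such that $M\cong M_{\mathbb{Z}}\otimes K$ and $M_F:=M_{\mathbb{Z}}\otimes F$ is a rigid representation of $Q$ over $F$ for every field $F$. Put $\mathbf{d}=\mathbf{dim}\,M$. The scheme $\mathcal{X}$ is the closed subscheme of the product $\prod_{i}\mathcal{G}r_{\mathbb{Z}}(e_i,d_i)$ of Grassmannians over $\mathbb{Z}$ defined by the conditions $M_{\mathbb{Z},\alpha}(U_i)\subseteq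 U_j$ for all arrows $\alpha:i\to j$. Its fibre over a field $F$ is $\mathrm{Gr}_{\mathbf{e}}(M_F)$; in particular $|\mathcal{X}(\mathbb{F}_q)|$ is the number of subrepresentations of $M_{\mathbb{F}_q}$ of dimension vector $\mathbf{e}$. *)

theory Defs
  imports
    "HOL-Algebra.Algebraic_Closure"
    "HOL-Algebra.IntRing"
    "HOL-Algebra.Free_Abelian_Groups"
    "HOL-Computational_Algebra.Polynomial"
    "HOL-Number_Theory.Prime_Powers"
    "Graph_Theory.Digraph"
begin

section \<open>Linear maps, bases and rank\<close>

definition linear_maps ::
  "'k ring \<Rightarrow> ('k, 'm) module \<Rightarrow> ('k, 'n) module \<Rightarrow> ('m \<Rightarrow> 'n) set"
where
  "linear_maps R V W =
    {f \<in> carrier V \<rightarrow> carrier W.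
      (\<forall>x\<in>carrier V. \<forall>y\<in>carrier V. f (x \<oplus>\<^bsub>V\<^esub> y) = f x \<oplus>\<^bsub>W\<^esub> f y) \<and>
      (\<forall>c\<in>carrier R. \<forall>x\<in>carrier V. f (c \<odot>\<^bsub>V\<^esub> x) = c \<odot>\<^bsub>W\<^esub> f x)}"

definition is_basis :: "'k ring \<Rightarrow> ('k, 'm) module \<Rightarrow> nat \<Rightarrow> (nat \<Rightarrow> 'm) \<Rightarrow> bool" where
  "is_basis R V n b \<longleftrightarrow>
    b \<in> {..<n} \<rightarrow> carrier V \<and>
    (\<forall>v\<in>carrier V. \<exists>!c. c \<in> {..<n} \<rightarrow>\<^sub>E carrier R \<and> v = (\<Oplus>\<^bsub>V\<^esub>i\<in>{..<n}. c i \<odot>\<^bsub>V\<^esub> b i))"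

text \<open>Over a field, \<open>has_rank R V n\<close> says that \<open>V\<close> has dimension \<open>n\<close>;
  over any commutative ring, that \<open>V\<close> is free of rank \<open>n\<close>.\<close>

definition has_rank :: "'k ring \<Rightarrow> ('k, 'm) module \<Rightarrow> nat \<Rightarrow> bool" where
  "has_rank R V n \<longleftrightarrow> (\<exists>b. is_basis R V n b)"


section \<open>Representations of quivers\<close>

text \<open>Quivers are the directed multigraphs of \<open>Graph_Theory\<close>, which may have loops and parallel
  arrows. The values of a representation outside \<open>verts Q\<close> and \<open>arcs Q\<close> are irrelevant.\<close>

record ('v, 'a, 'k, 'm) rep =
  space_at :: "'v \<Rightarrow> ('k, 'm) module"
  map_at :: "'a \<Rightarrow> 'm \<Rightarrow> 'm"

definition representation ::
  "('v, 'a) pre_digraph \<Rightarrow> 'k ring \<Rightarrow> ('v, 'a, 'k, 'm) rep \<Rightarrow> bool"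
where
  "representation Q R M \<longleftrightarrow>
    (\<forall>i\<in>verts Q. module R (space_at M i)) \<and>
    (\<forall>\<alpha>\<in>arcs Q. map_at M \<alpha> \<in>
      linear_maps R (space_at M (tail Q \<alpha>)) (space_at M (head Q \<alpha>)))"

text \<open>Finite-dimensional over a field, finitely generated free over the integers.\<close>

definition finite_free_representation ::
  "('v, 'a) pre_digraph \<Rightarrow> 'k ring \<Rightarrow> ('v, 'a, 'k, 'm) rep \<Rightarrow> bool"
where
  "finite_free_representation Q R M \<longleftrightarrow>
    representation Q R M \<and> (\<forall>i\<in>verts Q. \<exists>n. has_rank R (space_at M i) n)"

definition rep_homs ::
  "('v, 'a) pre_digraph \<Rightarrow> 'k ring \<Rightarrow> ('v, 'a, 'k, 'm) rep \<Rightarrow> ('v, 'a, 'k, 'n) rep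
    \<Rightarrow> ('v \<Rightarrow> 'm \<Rightarrow> 'n) set"
where
  "rep_homs Q R M N =
    {f. (\<forall>i\<in>verts Q. f i \<in> linear_maps R (space_at M i) (space_at N i)) \<and>
        (\<forall>\<alpha>\<in>arcs Q. \<forall>x\<in>carrier (space_at M (tail Q \<alpha>)).
          f (head Q \<alpha>) (map_at M \<alpha> x) = map_at N \<alpha> (f (tail Q \<alpha>) x))}"

definition rep_isos ::
  "('v, 'a) pre_digraph \<Rightarrow> 'k ring \<Rightarrow> ('v, 'a, 'k, 'm) rep \<Rightarrow> ('v, 'a, 'k, 'n) rep
    \<Rightarrow> ('v \<Rightarrow> 'm \<Rightarrow> 'n) set"
where
  "rep_isos Q R M N =
    {f \<in> rep_homs Q R M N.
      \<forall>i\<in>verts Q. bij_betw (f i) (carrier (space_at M i)) (carrier (space_at N i))}"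


section \<open>Yoneda extensions and rigidity\<close>

text \<open>Short exact sequences \<open>0 \<rightarrow> B \<rightarrow> E \<rightarrow> A \<rightarrow> 0\<close>. Each space of \<open>E\<close> is in bijection with the product
  of the corresponding spaces of \<open>B\<close> and \<open>A\<close>, so that every extension is equivalent to one with
  elements in the product type, which is therefore fixed here.\<close>

type_synonym ('v, 'a, 'k, 'm, 'n) extension =
  "('v, 'a, 'k, 'n \<times> 'm) rep \<times> ('v \<Rightarrow> 'n \<Rightarrow> 'n \<times> 'm) \<times> ('v \<Rightarrow> 'n \<times> 'm \<Rightarrow> 'm)"

definition extensions ::
  "('v, 'a) pre_digraph \<Rightarrow> 'k ring \<Rightarrow> ('v, 'a, 'k, 'm) rep \<Rightarrow> ('v, 'a, 'k, 'n) rep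
    \<Rightarrow> ('v, 'a, 'k, 'm, 'n) extension set"
where
  "extensions Q R A B =
    {(E, \<iota>, \<pi>). representation Q R E \<and> \<iota> \<in> rep_homs Q R B E \<and> \<pi> \<in> rep_homs Q R E A \<and>
      (\<forall>i\<in>verts Q.
        inj_on (\<iota> i) (carrier (space_at B i)) \<and>
        \<pi> i ` carrier (space_at E i) = carrier (space_at A i) \<and>
        \<iota> i ` carrier (space_at B i) = {x \<in> carrier (space_at E i). \<pi> i x = \<zero>\<^bsub>space_at A i\<^esub>})}"

definition extension_equiv ::
  "('v, 'a) pre_digraph \<Rightarrow> 'k ring \<Rightarrow> ('v, 'a, 'k, 'm) rep \<Rightarrow> ('v, 'a, 'k, 'n) rep
    \<Rightarrow> ('v, 'a, 'k, 'm, 'n) extension rel"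
where
  "extension_equiv Q R A B =
    {((E, \<iota>, \<pi>), (E', \<iota>', \<pi>')).
      (E, \<iota>, \<pi>) \<in> extensions Q R A B \<and> (E', \<iota>', \<pi>') \<in> extensions Q R A B \<and>
      (\<exists>\<theta>\<in>rep_isos Q R E E'. \<forall>i\<in>verts Q.
        (\<forall>x\<in>carrier (space_at B i). \<theta> i (\<iota> i x) = \<iota>' i x) \<and>
        (\<forall>x\<in>carrier (space_at E i). \<pi>' i (\<theta> i x) = \<pi> i x))}"

definition Ext1 ::
  "('v, 'a) pre_digraph \<Rightarrow> 'k ring \<Rightarrow> ('v, 'a, 'k, 'm) rep \<Rightarrow> ('v, 'a, 'k, 'n) rep
    \<Rightarrow> ('v, 'a, 'k, 'm, 'n) extension set set"
where
  "Ext1 Q R A B = extensions Q R A B // extension_equiv Q R A B"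

text \<open>The zero element of \<open>Ext1 Q R M M\<close> is the class of the split extension; the group
  is zero iff there is no other class.\<close>

definition rigid ::
  "('v, 'a) pre_digraph \<Rightarrow> 'k ring \<Rightarrow> ('v, 'a, 'k, 'm) rep \<Rightarrow> bool"
where
  "rigid Q R M \<longleftrightarrow> is_singleton (Ext1 Q R M M)"


section \<open>Base change from the integers\<close>

text \<open>\<open>V \<otimes>\<^sub>\<int> F\<close> is the free abelian group on \<open>V \<times> F\<close> modulo biadditivity; over the integers,
  biadditive maps are balanced.\<close>

abbreviation tensor_free :: "(int, 'm) module \<Rightarrow> 'f ring \<Rightarrow> ('m \<times> 'f \<Rightarrow>\<^sub>0 int) monoid" where
  "tensor_free V F \<equiv> free_Abelian_group (carrier V \<times> carrier F)"

definition tensor_relators :: "(int, 'm) module \<Rightarrow> 'f ring \<Rightarrow> ('m \<times> 'f \<Rightarrow>\<^sub>0 int) set" where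
  "tensor_relators V F =
    {frag_of (v \<oplus>\<^bsub>V\<^esub> w, c) - frag_of (v, c) - frag_of (w, c) | v w c.
      v \<in> carrier V \<and> w \<in> carrier V \<and> c \<in> carrier F} \<union>
    {frag_of (v, c \<oplus>\<^bsub>F\<^esub> d) - frag_of (v, c) - frag_of (v, d) | v c d.
      v \<in> carrier V \<and> c \<in> carrier F \<and> d \<in> carrier F}"

definition tensor_group ::
  "(int, 'm) module \<Rightarrow> 'f ring \<Rightarrow> ('m \<times> 'f \<Rightarrow>\<^sub>0 int) set monoid"
where
  "tensor_group V F =
    tensor_free V F Mod generate (tensor_free V F) (tensor_relators V F)"

definition tensor_class ::
  "(int, 'm) module \<Rightarrow> 'f ring \<Rightarrow> ('m \<times> 'f \<Rightarrow>\<^sub>0 int) \<Rightarrow> ('m \<times> 'f \<Rightarrow>\<^sub>0 int) set"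
where
  "tensor_class V F u =
    generate (tensor_free V F) (tensor_relators V F) #>\<^bsub>tensor_free V F\<^esub> u"

text \<open>The map \<open>V \<otimes> F \<rightarrow> W \<otimes> F\<close> with \<open>v \<otimes> c \<mapsto> w \<otimes> d\<close> where \<open>(w, d) = g (v, c)\<close>,
  for \<open>g\<close> compatible with the relations.\<close>

definition tensor_induced ::
  "(int, 'n) module \<Rightarrow> 'f ring \<Rightarrow> ('m \<times> 'f \<Rightarrow> 'n \<times> 'f)
    \<Rightarrow> ('m \<times> 'f \<Rightarrow>\<^sub>0 int) set \<Rightarrow> ('n \<times> 'f \<Rightarrow>\<^sub>0 int) set"
where
  "tensor_induced W F g C =
    the_elem ((\<lambda>u. tensor_class W F (frag_extend (\<lambda>p. frag_of (g p)) u)) ` C)"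

text \<open>The multiplicative fields of the record play no role in a module.\<close>

definition tensor_module ::
  "(int, 'm) module \<Rightarrow> 'f ring \<Rightarrow> ('f, ('m \<times> 'f \<Rightarrow>\<^sub>0 int) set) module"
where
  "tensor_module V F =
    \<lparr>carrier = carrier (tensor_group V F), monoid.mult = undefined, monoid.one = undefined,
     ring.zero = \<one>\<^bsub>tensor_group V F\<^esub>, ring.add = (\<otimes>\<^bsub>tensor_group V F\<^esub>),
     module.smult = (\<lambda>a. tensor_induced V F (\<lambda>(v, c). (v, a \<otimes>\<^bsub>F\<^esub> c)))\<rparr>"

definition base_change ::
  "('v, 'a) pre_digraph \<Rightarrow> ('v, 'a, int, 'm) rep \<Rightarrow> 'f ring
    \<Rightarrow> ('v, 'a, 'f, ('m \<times> 'f \<Rightarrow>\<^sub>0 int) set) rep"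
where
  "base_change Q M F =
    \<lparr>space_at = (\<lambda>i. tensor_module (space_at M i) F),
     map_at = (\<lambda>\<alpha>. tensor_induced (space_at M (head Q \<alpha>)) F (\<lambda>(v, c). (map_at M \<alpha> v, c)))\<rparr>"

text \<open>Fields with elements in \<open>nat\<close> represent all countable fields up to isomorphism, in particular
  all prime fields. This is enough to have rigidity over every field, since rigidity is invariant
  under field extension.\<close>

definition rigid_Z_form ::
  "('v, 'a) pre_digraph \<Rightarrow> 'k ring \<Rightarrow> ('v, 'a, 'k, 'm) rep \<Rightarrow> ('v, 'a, int, 'n) rep \<Rightarrow> bool"
where
  "rigid_Z_form Q K M M\<^sub>Z \<longleftrightarrow>
    finite_free_representation Q \<Z> M\<^sub>Z \<and>
    rep_isos Q K M (base_change Q M\<^sub>Z K) \<noteq> {} \<and>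
    (\<forall>F :: nat ring. field F \<longrightarrow> rigid Q F (base_change Q M\<^sub>Z F))"


section \<open>Quiver Grassmannians\<close>

definition quiver_Grassmannian ::
  "('v, 'a) pre_digraph \<Rightarrow> 'k ring \<Rightarrow> ('v \<Rightarrow> nat) \<Rightarrow> ('v, 'a, 'k, 'm) rep \<Rightarrow> ('v \<Rightarrow> 'm set) set"
where
  "quiver_Grassmannian Q F e M =
    {U \<in> (\<Pi>\<^sub>E i\<in>verts Q. {W. submodule W F (space_at M i) \<and>
                              has_rank F (space_at M i\<lparr>carrier := W\<rparr>) (e i)}).
      \<forall>\<alpha>\<in>arcs Q. map_at M \<alpha> ` U (tail Q \<alpha>) \<subseteq> U (head Q \<alpha>)}"

text \<open>The points over a field \<open>F\<close> of the quiver Grassmannian scheme over the integers attached to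
  \<open>M\<^sub>Z\<close> and \<open>e\<close>, i.e. the points of its fibre over \<open>F\<close>.\<close>

definition scheme_points ::
  "('v, 'a) pre_digraph \<Rightarrow> ('v \<Rightarrow> nat) \<Rightarrow> ('v, 'a, int, 'm) rep \<Rightarrow> 'f ring
    \<Rightarrow> ('v \<Rightarrow> ('m \<times> 'f \<Rightarrow>\<^sub>0 int) set set) set"
where
  "scheme_points Q e M\<^sub>Z F = quiver_Grassmannian Q F e (base_change Q M\<^sub>Z F)"

end

theory Submission
  imports Defs "HOL-Number_Theory.Residues"
begin

text \<open>
  Fix a finite field with \<open>q\<close> elements, let \<open>M\<close> be the rigid representation over it, \<open>d\<close> its
  dimension vector, and let \<open>\<langle>e, d\<rangle> = (\<Sum>i. e i * d i) - (\<Sum>\<alpha>. e (tail \<alpha>) * d (head \<alpha>))\<close> be the Euler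
  form, so that \<open>\<langle>dim N, d\<rangle> = dim Hom(N, M) - dim Ext\<^sup>1(N, M)\<close>.

  The representations \<open>N\<close> with \<open>Ext\<^sup>1(N, M) = 0\<close> are closed under extensions and, because quiver
  representations are hereditary, under subrepresentations; as \<open>M\<close> is rigid, they contain the
  subrepresentations of \<open>M\<close>. They form the torsion-free class of a torsion pair: each \<open>N\<close> has exactly
  one subrepresentation \<open>T\<close> with \<open>Ext\<^sup>1(N/T, M) = 0\<close> such that no non-zero quotient of \<open>T\<close> is in the class
  (\<open>ex_torsion_sub\<close>, \<open>torsion_sub_unique\<close>). The Euler form separates the two sides of the pair. If
  \<open>Ext\<^sup>1(N, M) = 0\<close>, then \<open>\<langle>dim N, d\<rangle> \<ge> 0\<close>. If \<open>N\<close> is torsion and non-zero, then \<open>Hom(N, M) = 0\<close>, since the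
  image of a map to \<open>M\<close> is a quotient of \<open>N\<close> in the class, and \<open>Ext\<^sup>1(N, M) \<noteq> 0\<close>, so
  \<open>\<langle>dim N, d\<rangle> < 0\<close> (\<open>ext_zero_euler_nonneg\<close>, \<open>torsion_euler_neg\<close>).

  Now sort all representation structures on a fixed graded vector space of dimension vector \<open>e\<close> by
  their torsion part. This expresses a power of \<open>q\<close> through the numbers \<open>x t\<close> of torsion-free and
  \<open>y t\<close> of torsion structures in the dimension vectors \<open>t \<le> e\<close>. The two unknowns \<open>x e\<close> and \<open>y e\<close>
  occur as the sum \<open>x e + y e\<close>, and one of them is zero, by the sign of \<open>\<langle>e, d\<rangle>\<close>. By induction, both are
  polynomials in \<open>q\<close> that depend only on \<open>Q\<close>, \<open>d\<close> and \<open>e\<close> (\<open>structure_recursion\<close>, \<open>ex_structure_polys\<close>).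

  Next count the pairs of a torsion-free structure \<open>N\<close> on that space and a homomorphism \<open>N \<rightarrow> M\<close>. There
  are \<open>q\<close> to the power \<open>\<langle>e, d\<rangle>\<close> homomorphisms for each \<open>N\<close>. On the other hand, such a pair consists
  of a point of \<open>Gr\<^sub>f(M)\<close> (the image), a torsion-free structure on the kernel and linear data
  whose number is a polynomial in \<open>q\<close>. In the resulting formula \<open>|Gr\<^sub>e(M)|\<close> has the coefficient
  \<open>\<Prod>i. |GL(e i, q)|\<close>, so by induction \<open>|Gr\<^sub>e(M)| * (\<Prod>i. |GL(e i, q)|)\<close> is a polynomial in \<open>q\<close>
  (\<open>count_homs_by_image\<close>, \<open>grass_recursion\<close>). Since \<open>|Gr\<^sub>e(M)|\<close> is an integer for infinitely many \<open>q\<close>,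
  namely for all primes, the division by this monic polynomial leaves no remainder
  (\<open>integral_quotient_polynomial\<close>, \<open>quiver_grass_polynomial\<close>).

  All of this applies to \<open>M\<^sub>Z \<otimes> F\<close> for every finite field \<open>F\<close> with one and the same \<open>d\<close>, the ranks of \<open>M\<^sub>Z\<close>:
  the space at \<open>i\<close> has \<open>q ^ d i\<close> elements (\<open>card_tensor\<close>), and the uniqueness of self-extensions
  up to equivalence yields the linear-algebra form of rigidity used above (\<open>rigid_surjective\<close>).
\<close>

section \<open>Linear algebra over a finite field\<close>

text \<open>All vector spaces below are subspaces of one module \<open>A\<close>, so that one addition and one scalar
  multiplication serve for all of them.\<close>

locale finite_field_module = module F A for F :: "('f, 'g) ring_scheme" (structure) and A :: "('f, 'm, 'h) module_scheme" (structure) +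
  assumes is_field: "field F" and finite_field: "finite (carrier F)"
begin

abbreviation subspace :: "'m set \<Rightarrow> bool" where
  "subspace W \<equiv> submodule W F A"

text \<open>Linear maps are extensional because they are going to be counted.\<close>

definition lin :: "'m set \<Rightarrow> 'm set \<Rightarrow> ('m \<Rightarrow> 'm) set" where
  "lin V B = {f \<in> V \<rightarrow>\<^sub>E B.
     (\<forall>x\<in>V. \<forall>y\<in>V. f (x \<oplus>\<^bsub>A\<^esub> y) = f x \<oplus>\<^bsub>A\<^esub> f y) \<and>
     (\<forall>c\<in>carrier F. \<forall>x\<in>V. f (c \<odot>\<^bsub>A\<^esub> x) = c \<odot>\<^bsub>A\<^esub> f x)}"

abbreviation q :: nat where "q \<equiv> card (carrier F)"

lemma q_ge_2: "q \<ge> 2"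
proof -
  have "card {\<zero>, \<one>} \<le> q"
    by (rule card_mono) (use finite_field in auto)
  moreover have "\<zero> \<noteq> \<one>" using domain.one_not_zero[OF field.axioms(1)[OF is_field]] by simp
  ultimately show ?thesis by simp
qed

lemma subspace_carrier: "subspace W \<Longrightarrow> x \<in> W \<Longrightarrow> x \<in> carrier A"
  using submoduleE(1) by blast

lemma subspace_add: "subspace W \<Longrightarrow> x \<in> W \<Longrightarrow> y \<in> W \<Longrightarrow> x \<oplus>\<^bsub>A\<^esub> y \<in> W"
  using submoduleE(5) by blast

lemma subspace_smult: "subspace W \<Longrightarrow> c \<in> carrier F \<Longrightarrow> x \<in> W \<Longrightarrow> c \<odot>\<^bsub>A\<^esub> x \<in> W"
  using submoduleE(4) by blast

lemma subspace_neg: "subspace W \<Longrightarrow> x \<in> W \<Longrightarrow> \<ominus>\<^bsub>A\<^esub> x \<in> W"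
  using submoduleE(3) by blast

lemma subspace_minus: "subspace W \<Longrightarrow> x \<in> W \<Longrightarrow> y \<in> W \<Longrightarrow> x \<ominus>\<^bsub>A\<^esub> y \<in> W"
  by (simp add: a_minus_def subspace_add subspace_neg)

lemma subspace_zero: "subspace W \<Longrightarrow> \<zero>\<^bsub>A\<^esub> \<in> W"
  using submoduleE(2)[of W] subspace_minus[of W] subspace_carrier[of W]
  by (metis M.r_neg a_minus_def ex_in_conv)

lemmas subspace_closed = subspace_add subspace_smult subspace_neg subspace_minus subspace_zero

lemma subspaceI:
  assumes "W \<subseteq> carrier A" "\<zero>\<^bsub>A\<^esub> \<in> W"
    and "\<And>x y. x \<in> W \<Longrightarrow> y \<in> W \<Longrightarrow> x \<oplus>\<^bsub>A\<^esub> y \<in> W"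
    and "\<And>c x. c \<in> carrier F \<Longrightarrow> x \<in> W \<Longrightarrow> c \<odot>\<^bsub>A\<^esub> x \<in> W"
  shows "subspace W"
proof (rule submoduleI)
  fix a assume a: "a \<in> W"
  then have "(\<ominus> \<one>) \<odot>\<^bsub>A\<^esub> a = \<ominus>\<^bsub>A\<^esub> a" using assms(1) by (subst smult_l_minus) auto
  with assms(4)[of "\<ominus> \<one>" a] a show "\<ominus>\<^bsub>A\<^esub> a \<in> W" by simp
qed (use assms in auto)

lemma subspace_singleton_zero: "subspace {\<zero>\<^bsub>A\<^esub>}"
  by (rule subspaceI) auto

lemma subspace_Int: "subspace V \<Longrightarrow> subspace W \<Longrightarrow> subspace (V \<inter> W)"
  by (rule subspaceI) (auto simp: subspace_closed subspace_carrier)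

lemma linI:
  assumes "\<And>x. x \<in> V \<Longrightarrow> f x \<in> B" "f \<in> extensional V"
    and "\<And>x y. x \<in> V \<Longrightarrow> y \<in> V \<Longrightarrow> f (x \<oplus>\<^bsub>A\<^esub> y) = f x \<oplus>\<^bsub>A\<^esub> f y"
    and "\<And>c x. c \<in> carrier F \<Longrightarrow> x \<in> V \<Longrightarrow> f (c \<odot>\<^bsub>A\<^esub> x) = c \<odot>\<^bsub>A\<^esub> f x"
  shows "f \<in> lin V B"
  using assms unfolding lin_def by (auto simp: PiE_def)

lemma lin_closed: "f \<in> lin V B \<Longrightarrow> x \<in> V \<Longrightarrow> f x \<in> B"
  by (auto simp: lin_def)

lemma lin_add: "f \<in> lin V B \<Longrightarrow> x \<in> V \<Longrightarrow> y \<in> V \<Longrightarrow> f (x \<oplus>\<^bsub>A\<^esub> y) = f x \<oplus>\<^bsub>A\<^esub> f y"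
  by (auto simp: lin_def)

lemma lin_smult: "f \<in> lin V B \<Longrightarrow> c \<in> carrier F \<Longrightarrow> x \<in> V \<Longrightarrow> f (c \<odot>\<^bsub>A\<^esub> x) = c \<odot>\<^bsub>A\<^esub> f x"
  by (auto simp: lin_def)

lemma lin_extensional: "f \<in> lin V B \<Longrightarrow> f \<in> extensional V"
  by (auto simp: lin_def PiE_def)

lemma lin_eqI:
  "f \<in> lin V B \<Longrightarrow> g \<in> lin V Y \<Longrightarrow> (\<And>x. x \<in> V \<Longrightarrow> f x = g x) \<Longrightarrow> f = g"
  by (blast intro: extensionalityI lin_extensional)

lemma lin_zero:
  assumes "f \<in> lin V B" "subspace V" "subspace B" shows "f \<zero>\<^bsub>A\<^esub> = \<zero>\<^bsub>A\<^esub>"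
proof -
  have "f (\<zero> \<odot>\<^bsub>A\<^esub> \<zero>\<^bsub>A\<^esub>) = \<zero> \<odot>\<^bsub>A\<^esub> f \<zero>\<^bsub>A\<^esub>"
    using assms by (intro lin_smult[of f V B]) (auto simp: subspace_zero)
  moreover have "f \<zero>\<^bsub>A\<^esub> \<in> carrier A"
    using assms lin_closed subspace_carrier subspace_zero by metis
  ultimately show ?thesis by simp
qed

lemma lin_neg:
  assumes "f \<in> lin V B" "subspace V" "subspace B" "x \<in> V" shows "f (\<ominus>\<^bsub>A\<^esub> x) = \<ominus>\<^bsub>A\<^esub> f x"
proof -
  have 1: "x \<in> carrier A" "f x \<in> carrier A"
    using assms lin_closed subspace_carrier by metis+
  have "f ((\<ominus> \<one>) \<odot>\<^bsub>A\<^esub> x) = (\<ominus> \<one>) \<odot>\<^bsub>A\<^esub> f x"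
    using assms by (intro lin_smult[of f V B]) auto
  then show ?thesis using 1 by (simp add: smult_l_minus)
qed

lemma lin_minus:
  assumes "f \<in> lin V B" "subspace V" "subspace B" "x \<in> V" "y \<in> V"
  shows "f (x \<ominus>\<^bsub>A\<^esub> y) = f x \<ominus>\<^bsub>A\<^esub> f y"
  using assms by (simp add: a_minus_def lin_add[of f V B] lin_neg[of f V B] subspace_neg)

lemma lin_mono: "f \<in> lin V B \<Longrightarrow> B \<subseteq> Y \<Longrightarrow> f \<in> lin V Y"
  by (auto simp: lin_def)

lemma lin_codomain: "f \<in> lin V Y \<Longrightarrow> (\<And>x. x \<in> V \<Longrightarrow> f x \<in> B) \<Longrightarrow> f \<in> lin V B"
  by (auto simp: lin_def)

lemma lin_restrict: "f \<in> lin V B \<Longrightarrow> subspace W \<Longrightarrow> W \<subseteq> V \<Longrightarrow> restrict f W \<in> lin W B"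
  by (rule linI) (auto simp: lin_closed lin_add lin_smult subset_iff subspace_closed)

lemma lin_compose:
  assumes "f \<in> lin V Y" "g \<in> lin Y Z" "subspace V"
  shows "(\<lambda>x\<in>V. g (f x)) \<in> lin V Z"
  by (rule linI)
    (use assms in \<open>auto simp: lin_closed[of f V Y] lin_closed[of g Y Z] lin_add[of f V Y] lin_add[of g Y Z]
      lin_smult[of f V Y] lin_smult[of g Y Z] subspace_closed\<close>)

lemma lin_plus:
  assumes "f \<in> lin V B" "g \<in> lin V B" "subspace V" "subspace B"
  shows "(\<lambda>x\<in>V. f x \<oplus>\<^bsub>A\<^esub> g x) \<in> lin V B"
proof -
  have *: "\<And>x. x \<in> V \<Longrightarrow> f x \<in> carrier A" "\<And>x. x \<in> V \<Longrightarrow> g x \<in> carrier A"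
    using assms lin_closed subspace_carrier by metis+
  show ?thesis
    by (rule linI)
      (use assms in \<open>auto simp: lin_closed[of _ V B] lin_add[of _ V B] lin_smult[of _ V B]
        smult_r_distr * M.add.m_ac subspace_closed\<close>)
qed

lemma lin_diff:
  assumes "f \<in> lin V B" "g \<in> lin V B" "subspace V" "subspace B"
  shows "(\<lambda>x\<in>V. f x \<ominus>\<^bsub>A\<^esub> g x) \<in> lin V B"
proof -
  have *: "\<And>x. x \<in> V \<Longrightarrow> f x \<in> carrier A" "\<And>x. x \<in> V \<Longrightarrow> g x \<in> carrier A"
    using assms lin_closed subspace_carrier by metis+
  show ?thesis
    by (rule linI)
      (use assms in \<open>auto simp: lin_closed[of _ V B] lin_add[of _ V B] lin_smult[of _ V B] a_minus_def
        smult_r_distr smult_r_minus * M.add.m_ac M.minus_add subspace_closed\<close>)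
qed

lemma lin_zero_map: "subspace V \<Longrightarrow> subspace B \<Longrightarrow> (\<lambda>x\<in>V. \<zero>\<^bsub>A\<^esub>) \<in> lin V B"
  by (rule linI) (auto simp: subspace_closed)

lemma lin_id: "subspace V \<Longrightarrow> (\<lambda>x\<in>V. x) \<in> lin V V"
  by (rule linI) (auto simp: subspace_closed)

lemma subspace_kernel:
  assumes "f \<in> lin V B" "subspace V" "subspace B"
  shows "subspace {x \<in> V. f x = \<zero>\<^bsub>A\<^esub>}"
  by (rule subspaceI)
    (use assms in \<open>auto simp: lin_add[of f V B] lin_smult[of f V B] lin_zero[of f V B] subspace_closed
      subspace_carrier\<close>)

lemma subspace_image:
  assumes f: "f \<in> lin V B" and "subspace V" "subspace B"
  shows "subspace (f ` V)"
proof (rule subspaceI)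
  show "f ` V \<subseteq> carrier A" using assms lin_closed subspace_carrier by blast
  show "\<zero>\<^bsub>A\<^esub> \<in> f ` V" using lin_zero[OF assms] subspace_zero[OF assms(2)] by (metis imageI)
next
  fix x y assume "x \<in> f ` V" "y \<in> f ` V"
  then show "x \<oplus>\<^bsub>A\<^esub> y \<in> f ` V" using assms by (auto simp: lin_add[OF f, symmetric] subspace_closed)
next
  fix c x assume "c \<in> carrier F" "x \<in> f ` V"
  then show "c \<odot>\<^bsub>A\<^esub> x \<in> f ` V" using assms by (auto simp: lin_smult[OF f, symmetric] subspace_closed)
qed

lemma minus_eq_zero_iff: "x \<in> carrier A \<Longrightarrow> y \<in> carrier A \<Longrightarrow> x \<ominus>\<^bsub>A\<^esub> y = \<zero>\<^bsub>A\<^esub> \<longleftrightarrow> x = y"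
  by (metis M.minus_equality M.minus_minus M.r_neg a_minus_def M.add.inv_closed M.a_comm)

lemma lin_inj_on_iff:
  assumes "f \<in> lin V B" "subspace V" "subspace B"
  shows "inj_on f V \<longleftrightarrow> (\<forall>x\<in>V. f x = \<zero>\<^bsub>A\<^esub> \<longrightarrow> x = \<zero>\<^bsub>A\<^esub>)"
proof
  assume "inj_on f V"
  then show "\<forall>x\<in>V. f x = \<zero>\<^bsub>A\<^esub> \<longrightarrow> x = \<zero>\<^bsub>A\<^esub>"
    by (metis assms inj_on_def lin_zero subspace_zero)
next
  assume *: "\<forall>x\<in>V. f x = \<zero>\<^bsub>A\<^esub> \<longrightarrow> x = \<zero>\<^bsub>A\<^esub>"
  show "inj_on f V"
  proof (rule inj_onI)
    fix x y assume "x \<in> V" "y \<in> V" "f x = f y"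
    then have "f (x \<ominus>\<^bsub>A\<^esub> y) = \<zero>\<^bsub>A\<^esub>" "x \<ominus>\<^bsub>A\<^esub> y \<in> V"
      using assms minus_eq_zero_iff by (auto simp: lin_minus[of f V B] subspace_minus lin_closed subspace_carrier)
    with * have "x \<ominus>\<^bsub>A\<^esub> y = \<zero>\<^bsub>A\<^esub>" by blast
    then show "x = y" using minus_eq_zero_iff assms \<open>x \<in> V\<close> \<open>y \<in> V\<close> subspace_carrier by metis
  qed
qed

lemma lin_inverse:
  assumes f: "f \<in> lin V B" and inj: "inj_on f V" and V: "subspace V"
  shows "(\<lambda>y\<in>f ` V. the_inv_into V f y) \<in> lin (f ` V) V"
proof (rule linI)
  fix x y assume "x \<in> f ` V" "y \<in> f ` V"
  then obtain v w where vw: "v \<in> V" "w \<in> V" "x = f v" "y = f w" by blast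
  then have "x \<oplus>\<^bsub>A\<^esub> y = f (v \<oplus>\<^bsub>A\<^esub> w)" using f by (simp add: lin_add)
  with vw show "(\<lambda>y\<in>f ` V. the_inv_into V f y) (x \<oplus>\<^bsub>A\<^esub> y) =
    (\<lambda>y\<in>f ` V. the_inv_into V f y) x \<oplus>\<^bsub>A\<^esub> (\<lambda>y\<in>f ` V. the_inv_into V f y) y"
    using inj V by (simp add: the_inv_into_f_f subspace_closed)
next
  fix c x assume "c \<in> carrier F" "x \<in> f ` V"
  then obtain v where v: "v \<in> V" "x = f v" by blast
  then have "c \<odot>\<^bsub>A\<^esub> x = f (c \<odot>\<^bsub>A\<^esub> v)" using f \<open>c \<in> carrier F\<close> by (simp add: lin_smult)
  with v show "(\<lambda>y\<in>f ` V. the_inv_into V f y) (c \<odot>\<^bsub>A\<^esub> x) = c \<odot>\<^bsub>A\<^esub> (\<lambda>y\<in>f ` V. the_inv_into V f y) x"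
    using inj V \<open>c \<in> carrier F\<close> by (simp add: the_inv_into_f_f subspace_closed)
qed (use inj in \<open>auto simp: the_inv_into_f_f\<close>)

subsection \<open>Adjoining a vector\<close>

definition adjoin :: "'m set \<Rightarrow> 'm \<Rightarrow> 'm set" where
  "adjoin W v = (\<lambda>(w, c). w \<oplus>\<^bsub>A\<^esub> c \<odot>\<^bsub>A\<^esub> v) ` (W \<times> carrier F)"

lemma adjoinI: "w \<in> W \<Longrightarrow> c \<in> carrier F \<Longrightarrow> w \<oplus>\<^bsub>A\<^esub> c \<odot>\<^bsub>A\<^esub> v \<in> adjoin W v"
  by (auto simp: adjoin_def)

lemma subset_adjoin: "subspace W \<Longrightarrow> v \<in> carrier A \<Longrightarrow> W \<subseteq> adjoin W v"
  using adjoinI[of _ W \<zero> v] by (auto simp: subspace_carrier)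

lemma in_adjoin: "subspace W \<Longrightarrow> v \<in> carrier A \<Longrightarrow> v \<in> adjoin W v"
  using adjoinI[of "\<zero>\<^bsub>A\<^esub>" W \<one> v] by (auto simp: subspace_zero)

lemma subspace_adjoin:
  assumes "subspace W" "v \<in> carrier A" shows "subspace (adjoin W v)"
proof (rule subspaceI)
  show "adjoin W v \<subseteq> carrier A" using assms by (auto simp: adjoin_def subspace_carrier)
  show "\<zero>\<^bsub>A\<^esub> \<in> adjoin W v" using assms subset_adjoin subspace_zero by blast
next
  fix x y assume "x \<in> adjoin W v" "y \<in> adjoin W v"
  then obtain w c w' c' where *: "w \<in> W" "c \<in> carrier F" "w' \<in> W" "c' \<in> carrier F"
    "x = w \<oplus>\<^bsub>A\<^esub> c \<odot>\<^bsub>A\<^esub> v" "y = w' \<oplus>\<^bsub>A\<^esub> c' \<odot>\<^bsub>A\<^esub> v" by (auto simp: adjoin_def)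
  then have "x \<oplus>\<^bsub>A\<^esub> y = (w \<oplus>\<^bsub>A\<^esub> w') \<oplus>\<^bsub>A\<^esub> (c \<oplus> c') \<odot>\<^bsub>A\<^esub> v"
    using assms by (simp add: smult_l_distr M.add.m_ac subspace_carrier)
  then show "x \<oplus>\<^bsub>A\<^esub> y \<in> adjoin W v" using * assms adjoinI by (simp add: subspace_closed)
next
  fix a x assume a: "a \<in> carrier F" "x \<in> adjoin W v"
  then obtain w c where *: "w \<in> W" "c \<in> carrier F" "x = w \<oplus>\<^bsub>A\<^esub> c \<odot>\<^bsub>A\<^esub> v"
    by (auto simp: adjoin_def)
  then have "a \<odot>\<^bsub>A\<^esub> x = (a \<odot>\<^bsub>A\<^esub> w) \<oplus>\<^bsub>A\<^esub> (a \<otimes> c) \<odot>\<^bsub>A\<^esub> v"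
    using assms a by (simp add: smult_r_distr smult_assoc1 subspace_carrier)
  then show "a \<odot>\<^bsub>A\<^esub> x \<in> adjoin W v" using * a assms adjoinI by (simp add: subspace_closed)
qed

lemma adjoin_subset: "subspace V \<Longrightarrow> W \<subseteq> V \<Longrightarrow> v \<in> V \<Longrightarrow> adjoin W v \<subseteq> V"
  by (auto simp: adjoin_def subspace_closed subset_iff)

text \<open>If two expressions agree and \<open>c \<noteq> c'\<close>, dividing by \<open>c - c'\<close> puts \<open>v\<close> into \<open>W\<close>.\<close>

lemma inj_on_adjoin:
  assumes W: "subspace W" and v: "v \<in> carrier A" "v \<notin> W"
  shows "inj_on (\<lambda>(w, c). w \<oplus>\<^bsub>A\<^esub> c \<odot>\<^bsub>A\<^esub> v) (W \<times> carrier F)"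
proof (rule inj_onI, clarify)
  fix w c w' c' assume *: "w \<in> W" "c \<in> carrier F" "w' \<in> W" "c' \<in> carrier F"
    and eq: "w \<oplus>\<^bsub>A\<^esub> c \<odot>\<^bsub>A\<^esub> v = w' \<oplus>\<^bsub>A\<^esub> c' \<odot>\<^bsub>A\<^esub> v"
  have car: "w \<in> carrier A" "w' \<in> carrier A" using * W subspace_carrier by blast+
  define a where "a = c \<ominus> c'"
  have a: "a \<in> carrier F" using * by (simp add: a_def)
  have "a \<odot>\<^bsub>A\<^esub> v = c \<odot>\<^bsub>A\<^esub> v \<ominus>\<^bsub>A\<^esub> c' \<odot>\<^bsub>A\<^esub> v"
    using * v by (simp add: a_def R.minus_eq M.minus_eq smult_l_distr smult_l_minus)
  also have "\<dots> = w' \<ominus>\<^bsub>A\<^esub> w"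
  proof -
    have "c \<odot>\<^bsub>A\<^esub> v = (w' \<oplus>\<^bsub>A\<^esub> c' \<odot>\<^bsub>A\<^esub> v) \<ominus>\<^bsub>A\<^esub> w"
      using eq[symmetric] car * v M.add.inv_solve_right[of "c \<odot>\<^bsub>A\<^esub> v" "w' \<oplus>\<^bsub>A\<^esub> c' \<odot>\<^bsub>A\<^esub> v" w]
      by (simp add: M.minus_eq M.a_comm)
    then show ?thesis using car * v by (simp add: M.minus_eq M.add.m_ac M.r_neg2 M.r_neg)
  qed
  finally have av: "a \<odot>\<^bsub>A\<^esub> v \<in> W" using W * subspace_minus by simp
  have "a = \<zero>"
  proof (rule ccontr)
    assume "a \<noteq> \<zero>"
    then have u: "a \<in> Units F" using a is_field field.field_Units by blast
    then have "inv a \<odot>\<^bsub>A\<^esub> (a \<odot>\<^bsub>A\<^esub> v) = v"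
      using a v by (simp add: smult_assoc1[symmetric])
    moreover have "inv a \<odot>\<^bsub>A\<^esub> (a \<odot>\<^bsub>A\<^esub> v) \<in> W" using W av u by (simp add: subspace_smult)
    ultimately show False using v by simp
  qed
  then have "c = c'" using * by (simp add: a_def)
  with eq car * v show "w = w' \<and> c = c'" by simp
qed

lemma card_adjoin:
  assumes "subspace W" "v \<in> carrier A" "v \<notin> W"
  shows "card (adjoin W v) = card W * q"
  unfolding adjoin_def by (subst card_image[OF inj_on_adjoin[OF assms]]) (simp add: card_cartesian_product)

text \<open>The engine of the inductions on the dimension: it yields the extension of linear maps and the
  numbers of linear and of injective linear maps.\<close>

lemma lin_adjoin_bij:
  assumes W: "subspace W" and v: "v \<in> carrier A" "v \<notin> W" and B: "subspace B"
  shows "bij_betw (\<lambda>g. (restrict g W, g v)) (lin (adjoin W v) B) (lin W B \<times> B)"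
proof (rule bij_betw_imageI)
  show "inj_on (\<lambda>g. (restrict g W, g v)) (lin (adjoin W v) B)"
  proof (rule inj_onI)
    fix g h assume gh: "g \<in> lin (adjoin W v) B" "h \<in> lin (adjoin W v) B"
      and eq: "(restrict g W, g v) = (restrict h W, h v)"
    show "g = h"
    proof (rule lin_eqI[OF gh])
      fix x assume "x \<in> adjoin W v"
      then obtain w c where *: "w \<in> W" "c \<in> carrier F" "x = w \<oplus>\<^bsub>A\<^esub> c \<odot>\<^bsub>A\<^esub> v" by (auto simp: adjoin_def)
      have in_ad: "w \<in> adjoin W v" "v \<in> adjoin W v" using * subset_adjoin[OF W v(1)] in_adjoin[OF W v(1)] by auto
      have "g w = h w" using eq * by (metis prod.inject restrict_apply')
      then show "g x = h x"
        using * in_ad eq gh subspace_smult[OF subspace_adjoin[OF W v(1)]]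
        by (simp add: lin_add[of _ "adjoin W v" B] lin_smult[of _ "adjoin W v" B])
    qed
  qed
  show "(\<lambda>g. (restrict g W, g v)) ` lin (adjoin W v) B = lin W B \<times> B"
  proof
    show "(\<lambda>g. (restrict g W, g v)) ` lin (adjoin W v) B \<subseteq> lin W B \<times> B"
      using W v subset_adjoin[OF W v(1)] in_adjoin[OF W v(1)] by (auto intro: lin_restrict lin_closed)
    show "lin W B \<times> B \<subseteq> (\<lambda>g. (restrict g W, g v)) ` lin (adjoin W v) B"
    proof clarify
      fix f x assume f: "f \<in> lin W B" and x: "x \<in> B"
      define p where "p = the_inv_into (W \<times> carrier F) (\<lambda>(w, c). w \<oplus>\<^bsub>A\<^esub> c \<odot>\<^bsub>A\<^esub> v)"
      define g where "g = (\<lambda>y\<in>adjoin W v. f (fst (p y)) \<oplus>\<^bsub>A\<^esub> snd (p y) \<odot>\<^bsub>A\<^esub> x)"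
      have g: "g (w \<oplus>\<^bsub>A\<^esub> c \<odot>\<^bsub>A\<^esub> v) = f w \<oplus>\<^bsub>A\<^esub> c \<odot>\<^bsub>A\<^esub> x" if "w \<in> W" "c \<in> carrier F" for w c
      proof -
        have "p (w \<oplus>\<^bsub>A\<^esub> c \<odot>\<^bsub>A\<^esub> v) = (w, c)"
          using the_inv_into_f_f[OF inj_on_adjoin[OF W v], of "(w, c)"] that by (simp add: p_def)
        then show ?thesis using that by (simp add: g_def adjoinI)
      qed
      have xc: "x \<in> carrier A" using x B subspace_carrier by blast
      have fc: "f w \<in> carrier A" if "w \<in> W" for w using that f B lin_closed subspace_carrier by blast
      have "g \<in> lin (adjoin W v) B"
      proof (rule linI)
        fix y assume "y \<in> adjoin W v"
        then show "g y \<in> B" using g f x B by (auto simp: adjoin_def subspace_closed lin_closed)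
      next
        fix y z assume "y \<in> adjoin W v" "z \<in> adjoin W v"
        then obtain w c w' c' where *: "w \<in> W" "c \<in> carrier F" "w' \<in> W" "c' \<in> carrier F"
          "y = w \<oplus>\<^bsub>A\<^esub> c \<odot>\<^bsub>A\<^esub> v" "z = w' \<oplus>\<^bsub>A\<^esub> c' \<odot>\<^bsub>A\<^esub> v" by (auto simp: adjoin_def)
        then have "y \<oplus>\<^bsub>A\<^esub> z = (w \<oplus>\<^bsub>A\<^esub> w') \<oplus>\<^bsub>A\<^esub> (c \<oplus> c') \<odot>\<^bsub>A\<^esub> v"
          using W v by (simp add: smult_l_distr M.add.m_ac subspace_carrier)
        then show "g (y \<oplus>\<^bsub>A\<^esub> z) = g y \<oplus>\<^bsub>A\<^esub> g z"
          using * g xc fc f W by (simp add: subspace_closed smult_l_distr M.add.m_ac lin_add)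
      next
        fix a y assume a: "a \<in> carrier F" "y \<in> adjoin W v"
        then obtain w c where *: "w \<in> W" "c \<in> carrier F" "y = w \<oplus>\<^bsub>A\<^esub> c \<odot>\<^bsub>A\<^esub> v"
          by (auto simp: adjoin_def)
        then have "a \<odot>\<^bsub>A\<^esub> y = (a \<odot>\<^bsub>A\<^esub> w) \<oplus>\<^bsub>A\<^esub> (a \<otimes> c) \<odot>\<^bsub>A\<^esub> v"
          using W v a by (simp add: smult_r_distr smult_assoc1 subspace_carrier)
        then show "g (a \<odot>\<^bsub>A\<^esub> y) = a \<odot>\<^bsub>A\<^esub> g y"
          using * g xc fc f W a by (simp add: subspace_closed smult_r_distr smult_assoc1 lin_smult)
      qed (simp add: g_def)
      moreover have "restrict g W = f"
      proof (rule extensionalityI[of _ W])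
        fix w assume w: "w \<in> W"
        then have "g w = f w \<oplus>\<^bsub>A\<^esub> \<zero> \<odot>\<^bsub>A\<^esub> x"
          using g[of w \<zero>] v W by (simp add: subspace_carrier)
        then show "restrict g W w = f w" using w xc fc by simp
      qed (use f lin_extensional in auto)
      moreover have "g v = x"
        using g[of "\<zero>\<^bsub>A\<^esub>" \<one>] v W xc B by (simp add: lin_zero[OF f] subspace_zero)
      ultimately show "(f, x) \<in> (\<lambda>g. (restrict g W, g v)) ` lin (adjoin W v) B"
        by (metis (mono_tags, lifting) image_iff)
    qed
  qed
qed

lemma subspace_induct [consumes 4, case_names base adjoin]:
  assumes "subspace V" "finite V" "subspace W" "W \<subseteq> V"
    and base: "P W"
    and step: "\<And>U v. \<lbrakk>subspace U; W \<subseteq> U; U \<subseteq> V; v \<in> V; v \<notin> U; v \<in> carrier A; P U\<rbrakk> \<Longrightarrow> P (adjoin U v)"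
  shows "P V"
proof -
  have "P V" if "subspace U" "W \<subseteq> U" "U \<subseteq> V" "P U" for U
    using that
  proof (induction "card (V - U)" arbitrary: U rule: less_induct)
    case less
    show ?case
    proof (cases "U = V")
      case False
      then obtain v where v: "v \<in> V" "v \<notin> U" using less.prems by blast
      have vc: "v \<in> carrier A" using v assms(1) subspace_carrier by blast
      have "card (V - adjoin U v) < card (V - U)"
        using v assms(2) in_adjoin[OF less.prems(1) vc] subset_adjoin[OF less.prems(1) vc]
        by (intro psubset_card_mono) auto
      then show ?thesis
      proof (rule less.hyps)
        show "P (adjoin U v)" using step less.prems v vc by blast
        show "subspace (adjoin U v)" using subspace_adjoin less.prems vc by blast
        show "W \<subseteq> adjoin U v" using subset_adjoin[OF less.prems(1) vc] less.prems by blast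
        show "adjoin U v \<subseteq> V" using adjoin_subset assms(1) less.prems v by blast
      qed
    qed (use less.prems in simp)
  qed
  then show ?thesis using assms by blast
qed

end

section \<open>Polynomials that count subspaces and linear maps\<close>

text \<open>The Gaussian binomial coefficients. The Pascal rule shows that their coefficients are integers,
  which the quotient formula does not.\<close>

fun gauss_binomial :: "nat \<Rightarrow> nat \<Rightarrow> int poly" where
  "gauss_binomial n 0 = 1"
| "gauss_binomial 0 (Suc t) = 0"
| "gauss_binomial (Suc n) (Suc t) = gauss_binomial n t + monom 1 (Suc t) * gauss_binomial n (Suc t)"

text \<open>The number of injective linear maps from dimension \<open>t\<close> to dimension \<open>n\<close> over the field with \<open>q\<close>
  elements; for \<open>t = n\<close> this is the order of the general linear group, and monic.\<close>

definition injection_poly :: "nat \<Rightarrow> nat \<Rightarrow> int poly" where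
  "injection_poly n t = (\<Prod>i<t. monom 1 n - monom 1 i)"

text \<open>The number of linear maps from dimension \<open>n\<close> onto dimension \<open>t\<close>: from all maps, those with a
  smaller image are subtracted.\<close>

fun surjection_poly :: "nat \<Rightarrow> nat \<Rightarrow> int poly" where
  "surjection_poly n t = monom 1 (n * t) - (\<Sum>s\<in>{..<t}. gauss_binomial t s * surjection_poly n s)"

declare surjection_poly.simps [simp del]

lemma poly_injection_poly: "poly (injection_poly n t) x = (\<Prod>i<t. x ^ n - x ^ i)"
  by (simp add: injection_poly_def poly_prod poly_monom)

lemma prod_diff_power_Suc:
  fixes x :: "'a :: comm_ring_1"
  shows "(\<Prod>i<Suc t. x ^ Suc n - x ^ i) = (x ^ Suc n - 1) * x ^ t * (\<Prod>i<t. x ^ n - x ^ i)"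
proof -
  have "(\<Prod>i<Suc t. x ^ Suc n - x ^ i) = (x ^ Suc n - 1) * (\<Prod>i<t. x * (x ^ n - x ^ i))"
    by (subst prod.lessThan_Suc_shift) (simp add: algebra_simps)
  also have "(\<Prod>i<t. x * (x ^ n - x ^ i)) = x ^ t * (\<Prod>i<t. x ^ n - x ^ i)"
    by (subst prod.distrib) simp
  finally show ?thesis by (simp add: algebra_simps)
qed

lemma gauss_binomial_times_injections:
  "poly (gauss_binomial n t) x * (\<Prod>i<t. x ^ t - x ^ i) = (\<Prod>i<t. x ^ n - x ^ i)"
proof (induction n t rule: gauss_binomial.induct)
  case (2 t)
  have "(\<Prod>i<Suc t. x ^ 0 - x ^ i) = 0" by (rule prod_zero) (auto intro!: bexI[of _ 0])
  then show ?case by simp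
next
  case (3 n t)
  have "poly (gauss_binomial (Suc n) (Suc t)) x * (\<Prod>i<Suc t. x ^ Suc t - x ^ i) =
     (x ^ Suc t - 1) * x ^ t * (poly (gauss_binomial n t) x * (\<Prod>i<t. x ^ t - x ^ i)) +
     x ^ Suc t * (poly (gauss_binomial n (Suc t)) x * (\<Prod>i<Suc t. x ^ Suc t - x ^ i))"
    unfolding prod_diff_power_Suc by (simp add: poly_monom algebra_simps)
  also have "\<dots> = (x ^ Suc t - 1) * x ^ t * (\<Prod>i<t. x ^ n - x ^ i) + x ^ Suc t * (\<Prod>i<Suc t. x ^ n - x ^ i)"
    unfolding 3 ..
  also have "\<dots> = (\<Prod>i<Suc t. x ^ Suc n - x ^ i)"
    unfolding prod_diff_power_Suc by (simp add: algebra_simps)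
  finally show ?case .
qed simp

lemma prod_diff_power_pos:
  fixes x :: int assumes "x \<ge> 2" shows "(\<Prod>i<t. x ^ t - x ^ i) > 0"
  using assms by (intro prod_pos) (simp add: power_strict_increasing)

lemma card_constant_fibres:
  assumes "finite D" "\<And>y. y \<in> f ` D \<Longrightarrow> card {x \<in> D. f x = y} = k"
  shows "card D = card (f ` D) * k"
proof -
  have "card D = (\<Sum>x\<in>D. 1)" by simp
  also have "\<dots> = (\<Sum>y\<in>f ` D. \<Sum>x\<in>{x \<in> D. f x = y}. 1)"
    by (rule sum.image_gen) fact
  also have "\<dots> = card (f ` D) * k" using assms(2) by simp
  finally show ?thesis .
qed

context finite_field_module
begin

subsection \<open>Extension and factorization of linear maps\<close>

lemma linear_extension:
  assumes "f \<in> lin W B" "subspace W" "W \<subseteq> V" "subspace V" "finite V" "subspace B"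
  obtains g where "g \<in> lin V B" "\<And>x. x \<in> W \<Longrightarrow> g x = f x"
proof -
  from assms(4,5,2,3) have "\<exists>g\<in>lin V B. \<forall>x\<in>W. g x = f x"
  proof (induction V rule: subspace_induct)
    case base
    then show ?case using assms(1) by blast
  next
    case (adjoin U v)
    then obtain g where g: "g \<in> lin U B" "\<forall>x\<in>W. g x = f x" by blast
    have "(g, \<zero>\<^bsub>A\<^esub>) \<in> lin U B \<times> B" using g assms(6) subspace_zero by blast
    then obtain h where h: "h \<in> lin (adjoin U v) B" "restrict h U = g"
      using lin_adjoin_bij[OF adjoin(1,6,5) assms(6)] unfolding bij_betw_def
      by (metis (no_types, lifting) imageE prod.inject)
    have "h x = f x" if "x \<in> W" for x
      using h(2) g(2) that adjoin(2) by (metis restrict_apply' subsetD)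
    with h(1) show ?case by blast
  qed
  with that show ?thesis by blast
qed

text \<open>Preimages of one point under \<open>h\<close> differ by an element of the kernel of \<open>h\<close>, so \<open>f\<close> descends to the
  image of \<open>h\<close>; from there it is extended to \<open>Z\<close>.\<close>

lemma linear_factor:
  assumes h: "h \<in> lin V Z" and f: "f \<in> lin V B" and ker: "\<And>x. x \<in> V \<Longrightarrow> h x = \<zero>\<^bsub>A\<^esub> \<Longrightarrow> f x = \<zero>\<^bsub>A\<^esub>"
    and sub: "subspace V" "subspace Z" "finite Z" "subspace B"
  obtains g where "g \<in> lin Z B" "\<And>x. x \<in> V \<Longrightarrow> g (h x) = f x"
proof -
  have eq: "f x = f y" if "x \<in> V" "y \<in> V" "h x = h y" for x y
  proof -
    have "h (x \<ominus>\<^bsub>A\<^esub> y) = \<zero>\<^bsub>A\<^esub>"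
      using that h sub minus_eq_zero_iff by (simp add: lin_minus[of h V Z] lin_closed subspace_carrier)
    then have "f (x \<ominus>\<^bsub>A\<^esub> y) = \<zero>\<^bsub>A\<^esub>" using ker that sub by (simp add: subspace_minus)
    then have "f x \<ominus>\<^bsub>A\<^esub> f y = \<zero>\<^bsub>A\<^esub>" using that f sub by (simp add: lin_minus[of f V B])
    moreover have "f x \<in> carrier A" "f y \<in> carrier A"
      using that f sub lin_closed subspace_carrier by metis+
    ultimately show ?thesis using minus_eq_zero_iff by blast
  qed
  define g0 where "g0 = (\<lambda>y\<in>h ` V. f (SOME x. x \<in> V \<and> h x = y))"
  have g0: "g0 (h x) = f x" if "x \<in> V" for x
  proof -
    define x' where "x' = (SOME z. z \<in> V \<and> h z = h x)"
    have "x' \<in> V \<and> h x' = h x" unfolding x'_def using someI[of "\<lambda>z. z \<in> V \<and> h z = h x" x] that by simp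
    moreover have "g0 (h x) = f x'" using that by (simp add: g0_def x'_def)
    ultimately show ?thesis using eq that by metis
  qed
  have "g0 \<in> lin (h ` V) B"
  proof (rule linI)
    fix x y assume "x \<in> h ` V" "y \<in> h ` V"
    then obtain v w where "v \<in> V" "w \<in> V" "x = h v" "y = h w" by blast
    then show "g0 (x \<oplus>\<^bsub>A\<^esub> y) = g0 x \<oplus>\<^bsub>A\<^esub> g0 y"
      using g0 sub by (simp add: lin_add[OF h, symmetric] subspace_closed lin_add[OF f])
  next
    fix c x assume "c \<in> carrier F" "x \<in> h ` V"
    then obtain v where "v \<in> V" "x = h v" by blast
    then show "g0 (c \<odot>\<^bsub>A\<^esub> x) = c \<odot>\<^bsub>A\<^esub> g0 x"
      using g0 sub \<open>c \<in> carrier F\<close> by (simp add: lin_smult[OF h, symmetric] subspace_closed lin_smult[OF f])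
  qed (use g0 f in \<open>auto simp: lin_closed g0_def extensional_def\<close>)
  then obtain g where "g \<in> lin Z B" "\<And>x. x \<in> h ` V \<Longrightarrow> g x = g0 x"
    using subspace_image[OF h sub(1,2)] sub h lin_closed
    by (metis linear_extension[of g0 "h ` V" B Z] image_subsetI)
  with g0 that show ?thesis by auto
qed

lemma projection_along:
  assumes "subspace W" "W \<subseteq> V" "subspace V" "finite V"
  obtains p where "p \<in> lin V V" "\<And>x. x \<in> V \<Longrightarrow> p (p x) = p x"
    "\<And>x. x \<in> V \<Longrightarrow> p x = \<zero>\<^bsub>A\<^esub> \<longleftrightarrow> x \<in> W"
proof -
  obtain r where r: "r \<in> lin V W" "\<And>x. x \<in> W \<Longrightarrow> r x = x"
    using linear_extension[OF lin_id[OF assms(1)] assms(1-4,1)] by (metis restrict_apply')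
  define p where "p = (\<lambda>x\<in>V. (\<lambda>x\<in>V. x) x \<ominus>\<^bsub>A\<^esub> r x)"
  have rV: "r \<in> lin V V" using r(1) assms(2) lin_mono by blast
  have p: "p \<in> lin V V" unfolding p_def by (rule lin_diff[OF lin_id[OF assms(3)] rV assms(3,3)])
  have rp: "r (p x) = \<zero>\<^bsub>A\<^esub>" if "x \<in> V" for x
  proof -
    have "r x \<in> W" using r(1) that lin_closed by blast
    moreover have "r (p x) = r x \<ominus>\<^bsub>A\<^esub> r (r x)"
      using that \<open>r x \<in> W\<close> assms(2) lin_minus[OF rV assms(3,3), of x "r x"] by (auto simp: p_def)
    ultimately show ?thesis using r(2) assms(1) subspace_carrier minus_eq_zero_iff by simp
  qed
  show ?thesis
  proof
    show "p \<in> lin V V" by fact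
    fix x assume x: "x \<in> V"
    then have px: "p x \<in> V" using p lin_closed by blast
    then have "p (p x) = p x \<ominus>\<^bsub>A\<^esub> r (p x)" by (simp add: p_def)
    then show "p (p x) = p x" using rp[OF x] subspace_carrier[OF assms(3) px] by (simp add: M.minus_eq)
    have "p x = \<zero>\<^bsub>A\<^esub> \<longleftrightarrow> x = r x"
      using x minus_eq_zero_iff[of x "r x"] lin_closed[OF rV x] subspace_carrier[OF assms(3)] by (simp add: p_def)
    also have "\<dots> \<longleftrightarrow> x \<in> W" using r lin_closed x by metis
    finally show "p x = \<zero>\<^bsub>A\<^esub> \<longleftrightarrow> x \<in> W" .
  qed
qed

text \<open>A projection along \<open>U\<close> restricts to \<open>W\<close> with kernel \<open>W \<inter> U\<close>, so \<open>f\<close> factors through it.\<close>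

lemma extension_by_zero:
  assumes "f \<in> lin W B" "subspace W" "W \<subseteq> V" "subspace U" "U \<subseteq> V" "subspace V" "finite V" "subspace B"
    and "\<And>x. x \<in> W \<Longrightarrow> x \<in> U \<Longrightarrow> f x = \<zero>\<^bsub>A\<^esub>"
  obtains g where "g \<in> lin V B" "\<And>x. x \<in> W \<Longrightarrow> g x = f x" "\<And>x. x \<in> U \<Longrightarrow> g x = \<zero>\<^bsub>A\<^esub>"
proof -
  obtain p where p: "p \<in> lin V V" "\<And>x. x \<in> V \<Longrightarrow> p x = \<zero>\<^bsub>A\<^esub> \<longleftrightarrow> x \<in> U"
    using projection_along[OF assms(4-7)] by metis
  obtain g where g: "g \<in> lin V B" "\<And>x. x \<in> W \<Longrightarrow> g (restrict p W x) = f x"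
  proof (rule linear_factor[where f = f and B = B])
    show "restrict p W \<in> lin W V" using lin_restrict[OF p(1)] assms(2,3) by blast
    fix x assume "x \<in> W" "restrict p W x = \<zero>\<^bsub>A\<^esub>"
    then show "f x = \<zero>\<^bsub>A\<^esub>" using p(2) assms(3,9) by auto
  qed (use assms in auto)
  show ?thesis
  proof
    show "(\<lambda>x\<in>V. g (p x)) \<in> lin V B" by (rule lin_compose) (use p g assms in auto)
    show "(\<lambda>x\<in>V. g (p x)) x = f x" if "x \<in> W" for x using g(2) that assms(3) by auto
    show "(\<lambda>x\<in>V. g (p x)) x = \<zero>\<^bsub>A\<^esub>" if "x \<in> U" for x
    proof -
      have "x \<in> V" "p x = \<zero>\<^bsub>A\<^esub>" using p(2) that assms(5) by auto
      then show ?thesis using lin_zero[OF g(1)] assms by simp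
    qed
  qed
qed

subsection \<open>Dimension\<close>

text \<open>The dimension is read off from the cardinality, so that no bases are needed.\<close>

definition dim :: "'m set \<Rightarrow> nat" where
  "dim V = (THE n. card V = q ^ n)"

lemma q_power_inject: "q ^ m = q ^ n \<longleftrightarrow> m = n"
  using q_ge_2 by (simp add: power_inject_exp)

lemma dimI: "card V = q ^ n \<Longrightarrow> dim V = n"
  unfolding dim_def using q_power_inject by (intro the_equality) auto

lemma card_eq_dim:
  assumes "subspace V" "finite V" shows "card V = q ^ dim V"
proof -
  have "{\<zero>\<^bsub>A\<^esub>} \<subseteq> V" using assms subspace_zero by blast
  with assms subspace_singleton_zero have "\<exists>n. card V = q ^ n"
  proof (induction V rule: subspace_induct)
    case base
    show ?case by (intro exI[of _ 0]) simp
  next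
    case (adjoin U v)
    then show ?case using card_adjoin by (metis mult.commute power_Suc)
  qed
  then show ?thesis using dimI by auto
qed

lemma dim_adjoin:
  assumes "subspace W" "finite W" "v \<in> carrier A" "v \<notin> W"
  shows "dim (adjoin W v) = Suc (dim W)"
  by (rule dimI) (simp add: card_adjoin assms card_eq_dim)

lemma dim_singleton_zero [simp]: "dim {\<zero>\<^bsub>A\<^esub>} = 0"
  by (rule dimI) simp

lemma subspace_zero_induct [consumes 2, case_names zero adjoin]:
  assumes "subspace V" "finite V" "P {\<zero>\<^bsub>A\<^esub>}"
    and "\<And>U v. \<lbrakk>subspace U; finite U; U \<subseteq> V; v \<in> V; v \<notin> U; v \<in> carrier A; P U\<rbrakk> \<Longrightarrow> P (adjoin U v)"
  shows "P V"
  by (rule subspace_induct[of V "{\<zero>\<^bsub>A\<^esub>}"])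
    (use assms subspace_singleton_zero subspace_zero in \<open>auto intro: finite_subset\<close>)

lemma dim_mono: "subspace V \<Longrightarrow> finite V \<Longrightarrow> subspace W \<Longrightarrow> W \<subseteq> V \<Longrightarrow> dim W \<le> dim V"
  using card_mono[of V W] q_ge_2 finite_subset[of W V]
  by (auto simp: card_eq_dim power_increasing_iff[of q])

lemma dim_eq_imp_eq:
  "subspace V \<Longrightarrow> finite V \<Longrightarrow> subspace W \<Longrightarrow> W \<subseteq> V \<Longrightarrow> dim W = dim V \<Longrightarrow> W = V"
  using card_subset_eq[of V W] finite_subset[of W V] by (simp add: card_eq_dim)

lemma dim_zero_iff: "subspace V \<Longrightarrow> finite V \<Longrightarrow> dim V = 0 \<longleftrightarrow> V = {\<zero>\<^bsub>A\<^esub>}"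
  using dim_eq_imp_eq[of V "{\<zero>\<^bsub>A\<^esub>}"] subspace_singleton_zero subspace_zero by auto

lemma ex_subspace_dim:
  assumes "subspace V" "finite V" "t \<le> dim V"
  obtains W where "subspace W" "W \<subseteq> V" "dim W = t"
proof -
  from assms(1,2) have "t \<le> dim V \<longrightarrow> (\<exists>W. subspace W \<and> W \<subseteq> V \<and> dim W = t)"
  proof (induction V rule: subspace_zero_induct)
    case zero
    then show ?case using subspace_singleton_zero by auto
  next
    case (adjoin U v)
    then show ?case
      using dim_adjoin[of U v] subspace_adjoin[of U v] subset_adjoin[of U v] by (metis le_SucE order.trans order.refl)
  qed
  with assms(3) that show ?thesis by blast
qed

lemma finite_lin: "finite V \<Longrightarrow> finite B \<Longrightarrow> finite (lin V B)"
  by (rule finite_subset[of _ "V \<rightarrow>\<^sub>E B"]) (auto simp: lin_def intro: finite_PiE)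

lemma lin_singleton_zero: 
  assumes "subspace B" shows "lin {\<zero>\<^bsub>A\<^esub>} B = {\<lambda>x\<in>{\<zero>\<^bsub>A\<^esub>}. \<zero>\<^bsub>A\<^esub>}"
proof -
  have "f = (\<lambda>x\<in>{\<zero>\<^bsub>A\<^esub>}. \<zero>\<^bsub>A\<^esub>)" if "f \<in> lin {\<zero>\<^bsub>A\<^esub>} B" for f
    using lin_zero[OF that subspace_singleton_zero assms] lin_extensional[OF that] by (auto simp: extensional_def fun_eq_iff)
  then show ?thesis using lin_zero_map[OF subspace_singleton_zero assms] by blast
qed

lemma card_lin:
  assumes "subspace V" "finite V" "subspace B" "finite B"
  shows "card (lin V B) = q ^ (dim V * dim B)"
  using assms(1,2)
proof (induction V rule: subspace_zero_induct)
  case zero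
  then show ?case by (simp add: lin_singleton_zero assms)
next
  case (adjoin U v)
  have "card (lin (adjoin U v) B) = card (lin U B \<times> B)"
    by (rule bij_betw_same_card[OF lin_adjoin_bij]) (use adjoin assms in auto)
  also have "\<dots> = q ^ (dim (adjoin U v) * dim B)"
    using adjoin by (simp add: card_cartesian_product dim_adjoin card_eq_dim[OF assms(3,4)] power_add)
  finally show ?case .
qed

lemma inj_on_adjoin_iff:
  assumes U: "subspace U" "v \<in> carrier A" "v \<notin> U" and B: "subspace B" and f: "f \<in> lin (adjoin U v) B"
  shows "inj_on f (adjoin U v) \<longleftrightarrow> inj_on f U \<and> f v \<notin> f ` U"
proof
  assume "inj_on f (adjoin U v)"
  then show "inj_on f U \<and> f v \<notin> f ` U"
    using subset_adjoin[OF U(1,2)] in_adjoin[OF U(1,2)] U(3) inj_on_subset[of f "adjoin U v" U]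
      inj_on_image_mem_iff[of f "adjoin U v" v U] by blast
next
  assume *: "inj_on f U \<and> f v \<notin> f ` U"
  note sub = subspace_adjoin[OF U(1,2)]
  note mem = subset_adjoin[OF U(1,2)] in_adjoin[OF U(1,2)]
  show "inj_on f (adjoin U v)"
    unfolding lin_inj_on_iff[OF f sub B]
  proof clarify
    fix x assume x: "x \<in> adjoin U v" "f x = \<zero>\<^bsub>A\<^esub>"
    then obtain u c where uc: "u \<in> U" "c \<in> carrier F" "x = u \<oplus>\<^bsub>A\<^esub> c \<odot>\<^bsub>A\<^esub> v" by (auto simp: adjoin_def)
    have car: "u \<in> carrier A" "f u \<in> carrier A" "f v \<in> carrier A"
      using uc mem f B U lin_closed[OF f] subspace_carrier by blast+
    have eq: "f u \<oplus>\<^bsub>A\<^esub> c \<odot>\<^bsub>A\<^esub> f v = \<zero>\<^bsub>A\<^esub>"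
      using x(2) uc mem sub by (auto simp: lin_add[OF f] lin_smult[OF f] subspace_smult subset_iff)
    have "c = \<zero>"
    proof (rule ccontr)
      assume "c \<noteq> \<zero>"
      then have u: "c \<in> Units F" using uc is_field field.field_Units by blast
      have "c \<odot>\<^bsub>A\<^esub> f v = \<ominus>\<^bsub>A\<^esub> f u" using eq car uc
        by (metis M.a_comm M.minus_equality smult_closed)
      then have "inv c \<odot>\<^bsub>A\<^esub> (c \<odot>\<^bsub>A\<^esub> f v) = inv c \<odot>\<^bsub>A\<^esub> (\<ominus>\<^bsub>A\<^esub> f u)" by simp
      then have "f v = inv c \<odot>\<^bsub>A\<^esub> f (\<ominus>\<^bsub>A\<^esub> u)"
        using u car uc mem lin_neg[OF f sub B, of u] by (auto simp: smult_assoc1[symmetric])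
      also have "\<dots> = f (inv c \<odot>\<^bsub>A\<^esub> (\<ominus>\<^bsub>A\<^esub> u))"
        using u uc mem sub subspace_neg[OF U(1)] by (subst lin_smult[OF f]) (auto simp: subset_iff)
      also have "\<dots> \<in> f ` U" using u uc U by (simp add: subspace_closed)
      finally show False using * by blast
    qed
    with eq uc car U have "x = u" "f u = \<zero>\<^bsub>A\<^esub>" by auto
    moreover have "restrict f U \<in> lin U B" using lin_restrict[OF f U(1) mem(1)] .
    then have "\<forall>x\<in>U. restrict f U x = \<zero>\<^bsub>A\<^esub> \<longrightarrow> x = \<zero>\<^bsub>A\<^esub>"
      using lin_inj_on_iff[of "restrict f U" U B] U(1) B * by (simp add: inj_on_def)
    ultimately show "x = \<zero>\<^bsub>A\<^esub>" using uc by simp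
  qed
qed

lemma card_injective_lin:
  assumes "subspace V" "finite V" and B: "subspace B" "finite B"
  shows "int (card {f \<in> lin V B. inj_on f V}) = poly (injection_poly (dim B) (dim V)) (int q)"
  using assms(1,2)
proof (induction V rule: subspace_zero_induct)
  case zero
  have "{f \<in> lin {\<zero>\<^bsub>A\<^esub>} B. inj_on f {\<zero>\<^bsub>A\<^esub>}} = lin {\<zero>\<^bsub>A\<^esub>} B" by auto
  then show ?case by (simp add: lin_singleton_zero B poly_injection_poly)
next
  case (adjoin U v)
  let ?I = "{f \<in> lin U B. inj_on f U}"
  have sub: "U \<subseteq> adjoin U v" using subset_adjoin adjoin by blast
  have "bij_betw (\<lambda>g. (restrict g U, g v)) {f \<in> lin (adjoin U v) B. inj_on f (adjoin U v)}
     (SIGMA f:?I. B - f ` U)"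
  proof (rule bij_betw_imageI)
    note bij = lin_adjoin_bij[OF adjoin(1,6,5) B(1)]
    show "inj_on (\<lambda>g. (restrict g U, g v)) {f \<in> lin (adjoin U v) B. inj_on f (adjoin U v)}"
      by (rule inj_on_subset[OF bij_betw_imp_inj_on[OF bij]]) auto
    have "(\<lambda>g. (restrict g U, g v)) ` {f \<in> lin (adjoin U v) B. inj_on f (adjoin U v)} =
       {p \<in> (\<lambda>g. (restrict g U, g v)) ` lin (adjoin U v) B. inj_on (fst p) U \<and> snd p \<notin> fst p ` U}"
      using inj_on_adjoin_iff[OF adjoin(1,6,5) B(1)] by (auto simp: inj_on_def)
    also have "\<dots> = (SIGMA f:?I. B - f ` U)"
      unfolding bij_betw_imp_surj_on[OF bij] by auto
    finally show "(\<lambda>g. (restrict g U, g v)) ` {f \<in> lin (adjoin U v) B. inj_on f (adjoin U v)} =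
      (SIGMA f:?I. B - f ` U)" .
  qed
  then have "card {f \<in> lin (adjoin U v) B. inj_on f (adjoin U v)} = card (SIGMA f:?I. B - f ` U)"
    by (rule bij_betw_same_card)
  also have "\<dots> = (\<Sum>f\<in>?I. card (B - f ` U))"
    by (rule card_SigmaI) (use B adjoin finite_lin in auto)
  also have "int \<dots> = (\<Sum>f\<in>?I. int q ^ dim B - int q ^ dim U)"
    unfolding of_nat_sum
  proof (rule sum.cong)
    fix f assume f: "f \<in> ?I"
    then have "f ` U \<subseteq> B" using lin_closed by blast
    moreover have "card (f ` U) = q ^ dim U" using f adjoin by (simp add: card_image card_eq_dim)
    ultimately have "card (B - f ` U) = card B - q ^ dim U" "q ^ dim U \<le> card B"
      using card_Diff_subset[of "f ` U" B] adjoin B card_mono[of B "f ` U"] by auto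
    then show "int (card (B - f ` U)) = int q ^ dim B - int q ^ dim U"
      using card_eq_dim[OF B] by (simp add: of_nat_diff)
  qed simp
  finally show ?case using adjoin by (simp add: poly_injection_poly dim_adjoin)
qed

definition grass :: "'m set \<Rightarrow> nat \<Rightarrow> 'm set set" where
  "grass V t = {W. subspace W \<and> W \<subseteq> V \<and> dim W = t}"

lemma finite_grass: "finite V \<Longrightarrow> finite (grass V t)"
  by (rule finite_subset[of _ "Pow V"]) (auto simp: grass_def)

lemma injective_lin_surj:
  assumes "f \<in> lin V W" "inj_on f V" "subspace V" "finite V" "subspace W" "finite W" "dim W = dim V"
  shows "f ` V = W"
  by (rule card_subset_eq) (use assms in \<open>auto simp: lin_closed card_image card_eq_dim\<close>)

text \<open>Every \<open>t\<close>-dimensional subspace of \<open>V\<close> is the image of \<open>|GL(t, q)|\<close> injective maps from one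
  fixed \<open>t\<close>-dimensional space.\<close>

lemma card_grass:
  assumes V: "subspace V" "finite V"
  shows "int (card (grass V t)) = poly (gauss_binomial (dim V) t) (int q)"
proof -
  have pos: "(\<Prod>i<t. int q ^ t - int q ^ i) > 0" using q_ge_2 by (intro prod_diff_power_pos) simp
  show ?thesis
  proof (cases "t \<le> dim V")
    case False
    then have "grass V t = {}" using dim_mono V by (auto simp: grass_def)
    moreover have "(\<Prod>i<t. int q ^ dim V - int q ^ i) = 0"
      using False by (intro prod_zero) (auto intro!: bexI[of _ "dim V"])
    then have "poly (gauss_binomial (dim V) t) (int q) = 0"
      using gauss_binomial_times_injections[of "dim V" t "int q"] pos by (metis less_irrefl mult_eq_0_iff)
    ultimately show ?thesis by simp
  next
    case True
    then obtain T where T: "subspace T" "T \<subseteq> V" "dim T = t" using ex_subspace_dim V by metis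
    have finT: "finite T" using T V finite_subset by blast
    let ?I = "{f \<in> lin T V. inj_on f T}"
    have "card ?I = (\<Sum>W\<in>grass V t. card {f \<in> lin T W. inj_on f T})"
    proof -
      have "card ?I = (\<Sum>f\<in>?I. 1)" by simp
      also have "\<dots> = (\<Sum>W\<in>grass V t. \<Sum>f\<in>{f \<in> ?I. f ` T = W}. 1)"
      proof (rule sum.group[symmetric])
        show "finite ?I" using finite_lin finT V by simp
        show "finite (grass V t)" using finite_grass V by blast
        show "(\<lambda>f. f ` T) ` ?I \<subseteq> grass V t"
        proof clarify
          fix f assume f: "f \<in> lin T V" "inj_on f T"
          then have "dim (f ` T) = t"
            by (intro dimI) (use T finT in \<open>simp add: card_image card_eq_dim\<close>)
          then show "f ` T \<in> grass V t"
            using f subspace_image[OF f(1) T(1) V(1)] lin_closed by (auto simp: grass_def)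
        qed
      qed
      also have "\<dots> = (\<Sum>W\<in>grass V t. card {f \<in> lin T W. inj_on f T})"
      proof (rule sum.cong)
        fix W assume W: "W \<in> grass V t"
        then have WV: "subspace W" "W \<subseteq> V" "dim W = t" by (auto simp: grass_def)
        then have "{f \<in> ?I. f ` T = W} = {f \<in> lin T W. inj_on f T}"
          using injective_lin_surj[of _ T W] T finT finite_subset[OF WV(2) V(2)]
          by (auto intro: lin_mono lin_codomain lin_closed)
        then show "(\<Sum>f\<in>{f \<in> ?I. f ` T = W}. 1) = card {f \<in> lin T W. inj_on f T}" by simp
      qed simp
      finally show ?thesis .
    qed
    then have "int (card ?I) = (\<Sum>W\<in>grass V t. int (card {f \<in> lin T W. inj_on f T}))" by simp
    also have "\<dots> = (\<Sum>W\<in>grass V t. \<Prod>i<t. int q ^ t - int q ^ i)"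
    proof (rule sum.cong)
      fix W assume "W \<in> grass V t"
      then have "subspace W" "W \<subseteq> V" "dim W = t" by (auto simp: grass_def)
      then show "int (card {f \<in> lin T W. inj_on f T}) = (\<Prod>i<t. int q ^ t - int q ^ i)"
        using card_injective_lin[OF T(1) finT, of W] V T by (simp add: poly_injection_poly finite_subset)
    qed simp
    finally have "int (card (grass V t)) * (\<Prod>i<t. int q ^ t - int q ^ i) =
       poly (gauss_binomial (dim V) t) (int q) * (\<Prod>i<t. int q ^ t - int q ^ i)"
      using card_injective_lin[OF T(1) finT V] T(3)
      by (simp add: poly_injection_poly gauss_binomial_times_injections)
    then show ?thesis using pos by (metis less_irrefl mult_right_cancel)
  qed
qed

lemma card_surjective_lin:
  assumes V: "subspace V" "finite V" and "subspace B" "finite B"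
  shows "int (card {f \<in> lin V B. f ` V = B}) = poly (surjection_poly (dim V) (dim B)) (int q)"
  using assms(3,4)
proof (induction "dim B" arbitrary: B rule: less_induct)
  case less
  let ?S = "\<lambda>W. {f \<in> lin V W. f ` V = W}"
  let ?D = "{W. subspace W \<and> W \<subseteq> B}"
  have finD: "finite ?D" using less.prems by (auto intro: finite_subset[of _ "Pow B"])
  have fin_lin: "finite (lin V B)" using finite_lin V less.prems by blast
  have "card (lin V B) = (\<Sum>f\<in>lin V B. 1)" by simp
  also have "\<dots> = (\<Sum>W\<in>?D. \<Sum>f\<in>{f \<in> lin V B. f ` V = W}. 1)"
    by (rule sum.group[symmetric])
      (use fin_lin finD subspace_image[OF _ V(1) less.prems(1)] lin_closed in auto)
  also have "\<dots> = (\<Sum>W\<in>?D. card (?S W))"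
  proof (rule sum.cong)
    fix W assume "W \<in> ?D"
    then have "{f \<in> lin V B. f ` V = W} = ?S W" by (auto intro: lin_mono lin_codomain)
    then show "(\<Sum>f\<in>{f \<in> lin V B. f ` V = W}. 1) = card (?S W)" by simp
  qed simp
  also have "\<dots> = card (?S B) + (\<Sum>W\<in>?D - {B}. card (?S W))"
    by (rule sum.remove) (use finD less.prems in auto)
  finally have split: "card (lin V B) = card (?S B) + (\<Sum>W\<in>?D - {B}. card (?S W))" .
  have dim_less: "dim W < dim B" if "W \<in> ?D - {B}" for W
  proof -
    have "dim W \<noteq> dim B" using dim_eq_imp_eq less.prems that by blast
    then show "dim W < dim B" using dim_mono[of B W] less.prems that by auto
  qed
  have split': "int q ^ (dim V * dim B) = int (card (?S B)) + int (\<Sum>W\<in>?D - {B}. card (?S W))"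
    using arg_cong[OF split, of int] by (simp only: card_lin[OF V less.prems] of_nat_add of_nat_power)
  have "int (\<Sum>W\<in>?D - {B}. card (?S W)) = (\<Sum>W\<in>?D - {B}. poly (surjection_poly (dim V) (dim W)) (int q))"
    unfolding of_nat_sum
  proof (rule sum.cong)
    fix W assume W: "W \<in> ?D - {B}"
    then have "finite W" using less.prems finite_subset by blast
    with W show "int (card (?S W)) = poly (surjection_poly (dim V) (dim W)) (int q)"
      using less.hyps[OF dim_less[OF W]] by simp
  qed simp
  also have "\<dots> = (\<Sum>s\<in>{..<dim B}. \<Sum>W\<in>{W \<in> ?D - {B}. dim W = s}. poly (surjection_poly (dim V) (dim W)) (int q))"
    using sum.group[of "?D - {B}" "{..<dim B}" dim "\<lambda>W. poly (surjection_poly (dim V) (dim W)) (int q)"]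
      finD dim_less by (simp add: image_subset_iff)
  also have "\<dots> = (\<Sum>s\<in>{..<dim B}. poly (gauss_binomial (dim B) s * surjection_poly (dim V) s) (int q))"
  proof (rule sum.cong)
    fix s assume "s \<in> {..<dim B}"
    then have "{W \<in> ?D - {B}. dim W = s} = grass B s" by (auto simp: grass_def)
    then have "(\<Sum>W\<in>{W \<in> ?D - {B}. dim W = s}. poly (surjection_poly (dim V) (dim W)) (int q)) =
       (\<Sum>W\<in>grass B s. poly (surjection_poly (dim V) s) (int q))"
      by (intro sum.cong) (auto simp: grass_def)
    then show "(\<Sum>W\<in>{W \<in> ?D - {B}. dim W = s}. poly (surjection_poly (dim V) (dim W)) (int q)) =
       poly (gauss_binomial (dim B) s * surjection_poly (dim V) s) (int q)"
      using card_grass[OF less.prems] by simp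
  qed simp
  finally have "int (card (?S B)) = int q ^ (dim V * dim B) -
     (\<Sum>s\<in>{..<dim B}. poly (gauss_binomial (dim B) s * surjection_poly (dim V) s) (int q))"
    using split' by linarith
  then show ?case
    by (subst surjection_poly.simps) (simp add: poly_sum poly_monom)
qed

lemma rank_nullity:
  assumes h: "h \<in> lin V B" and V: "subspace V" "finite V" and B: "subspace B"
  shows "dim {x \<in> V. h x = \<zero>\<^bsub>A\<^esub>} + dim (h ` V) = dim V"
proof -
  let ?K = "{x \<in> V. h x = \<zero>\<^bsub>A\<^esub>}"
  have "card V = card (h ` V) * card ?K"
  proof (rule card_constant_fibres[OF V(2)])
    fix y assume "y \<in> h ` V"
    then obtain x0 where x0: "x0 \<in> V" "y = h x0" by blast
    have car: "x0 \<in> carrier A" "h x0 \<in> carrier A" using x0 V B h lin_closed subspace_carrier by metis+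
    have "bij_betw (\<lambda>x. x \<oplus>\<^bsub>A\<^esub> x0) ?K {x \<in> V. h x = y}"
    proof (rule bij_betwI[where g = "\<lambda>x. x \<ominus>\<^bsub>A\<^esub> x0"])
      show "(\<lambda>x. x \<oplus>\<^bsub>A\<^esub> x0) \<in> ?K \<rightarrow> {x \<in> V. h x = y}"
        using x0 car V by (auto simp: lin_add[OF h] subspace_closed)
      show "(\<lambda>x. x \<ominus>\<^bsub>A\<^esub> x0) \<in> {x \<in> V. h x = y} \<rightarrow> ?K"
        using x0 car V minus_eq_zero_iff[of "h x0" "h x0"] by (auto simp: lin_minus[OF h V(1) B] subspace_closed)
      show "x \<oplus>\<^bsub>A\<^esub> x0 \<ominus>\<^bsub>A\<^esub> x0 = x" if "x \<in> ?K" for x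
        using that car subspace_carrier[OF V(1)] by (simp add: M.minus_eq M.a_assoc M.r_neg)
      show "x \<ominus>\<^bsub>A\<^esub> x0 \<oplus>\<^bsub>A\<^esub> x0 = x" if "x \<in> {x \<in> V. h x = y}" for x
        using that car subspace_carrier[OF V(1)] by (simp add: M.minus_eq M.a_assoc M.l_neg)
    qed
    then show "card {x \<in> V. h x = y} = card ?K" by (rule bij_betw_same_card[symmetric])
  qed
  moreover have "card ?K = q ^ dim ?K" by (rule card_eq_dim) (use V subspace_kernel[OF h] B in auto)
  moreover have "card (h ` V) = q ^ dim (h ` V)" by (rule card_eq_dim) (use V subspace_image[OF h] B in auto)
  ultimately have "q ^ dim V = q ^ (dim ?K + dim (h ` V))"
    using card_eq_dim[OF V] by (simp add: power_add)
  then show ?thesis using q_power_inject by simp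
qed

end

section \<open>Block triangular maps\<close>

lemma bij_betw_PiE_Times:
  assumes "\<And>i. i \<in> I \<Longrightarrow> bij_betw (\<lambda>f. (a i f, b i f, c i f)) (S i) (S1 i \<times> S2 i \<times> S3 i)"
  shows "bij_betw (\<lambda>N. (\<lambda>i\<in>I. a i (N i), \<lambda>i\<in>I. b i (N i), \<lambda>i\<in>I. c i (N i)))
    (PiE I S) (PiE I S1 \<times> PiE I S2 \<times> PiE I S3)"
proof -
  define g where "g i = the_inv_into (S i) (\<lambda>f. (a i f, b i f, c i f))" for i
  have g: "g i (a i f, b i f, c i f) = f" if "i \<in> I" "f \<in> S i" for i f
    using assms[OF that(1)] that(2) unfolding g_def bij_betw_def
    using the_inv_into_f_f[of "\<lambda>f. (a i f, b i f, c i f)" "S i" f] by simp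
  have g': "g i (x, y, z) \<in> S i \<and> a i (g i (x, y, z)) = x \<and> b i (g i (x, y, z)) = y \<and> c i (g i (x, y, z)) = z"
    if "i \<in> I" "x \<in> S1 i" "y \<in> S2 i" "z \<in> S3 i" for i x y z
  proof -
    have *: "(x, y, z) \<in> (\<lambda>f. (a i f, b i f, c i f)) ` S i"
      using assms[OF that(1)] that(2-) by (simp add: bij_betw_def)
    then obtain f where f: "f \<in> S i" "(x, y, z) = (a i f, b i f, c i f)" by blast
    then have "g i (x, y, z) = f" using g that(1) by simp
    with f show ?thesis by simp
  qed
  have abc: "a i f \<in> S1 i \<and> b i f \<in> S2 i \<and> c i f \<in> S3 i" if "i \<in> I" "f \<in> S i" for i f
    using bij_betwE[OF assms[OF that(1)]] that(2) by auto
  show ?thesis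
  proof (rule bij_betwI[where g = "\<lambda>(x, y, z). \<lambda>i\<in>I. g i (x i, y i, z i)"])
    show "(\<lambda>N. (\<lambda>i\<in>I. a i (N i), \<lambda>i\<in>I. b i (N i), \<lambda>i\<in>I. c i (N i)))
      \<in> PiE I S \<rightarrow> PiE I S1 \<times> PiE I S2 \<times> PiE I S3"
      using abc by (auto simp: PiE_iff)
    show "(\<lambda>(x, y, z). \<lambda>i\<in>I. g i (x i, y i, z i)) \<in> PiE I S1 \<times> PiE I S2 \<times> PiE I S3 \<rightarrow> PiE I S"
      using g' by (auto simp: PiE_iff)
  next
    fix N assume "N \<in> PiE I S"
    then show "(\<lambda>(x, y, z). \<lambda>i\<in>I. g i (x i, y i, z i))
      (\<lambda>i\<in>I. a i (N i), \<lambda>i\<in>I. b i (N i), \<lambda>i\<in>I. c i (N i)) = N"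
      using g by (auto simp: PiE_iff extensional_def fun_eq_iff)
  next
    fix p assume "p \<in> PiE I S1 \<times> PiE I S2 \<times> PiE I S3"
    then obtain x y z where "p = (x, y, z)" "x \<in> PiE I S1" "y \<in> PiE I S2" "z \<in> PiE I S3" by auto
    then show "(\<lambda>N. (\<lambda>i\<in>I. a i (N i), \<lambda>i\<in>I. b i (N i), \<lambda>i\<in>I. c i (N i)))
      ((\<lambda>(x, y, z). \<lambda>i\<in>I. g i (x i, y i, z i)) p) = p"
      using g' by (auto simp: PiE_iff extensional_def fun_eq_iff)
  qed
qed

context finite_field_module
begin

text \<open>The image of a projection with kernel \<open>W\<close> is a complement of \<open>W\<close>. It stands for the quotient
  \<open>V/W\<close>, which thereby remains a subspace of \<open>A\<close>.\<close>

definition projection :: "'m set \<Rightarrow> 'm set \<Rightarrow> ('m \<Rightarrow> 'm) \<Rightarrow> bool" where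
  "projection V W p \<longleftrightarrow> p \<in> lin V V \<and> (\<forall>x\<in>V. p (p x) = p x) \<and> (\<forall>x\<in>V. p x = \<zero>\<^bsub>A\<^esub> \<longleftrightarrow> x \<in> W)"

lemma ex_projection:
  "subspace W \<Longrightarrow> W \<subseteq> V \<Longrightarrow> subspace V \<Longrightarrow> finite V \<Longrightarrow> \<exists>p. projection V W p"
  unfolding projection_def by (metis projection_along)

context
  fixes V W p
  assumes V: "subspace V" "finite V" and W: "subspace W" "W \<subseteq> V" and p: "projection V W p"
begin

lemma projection_lin: "p \<in> lin V V" and projection_idem: "x \<in> V \<Longrightarrow> p (p x) = p x"
  and projection_kernel: "x \<in> V \<Longrightarrow> p x = \<zero>\<^bsub>A\<^esub> \<longleftrightarrow> x \<in> W"
  using p by (auto simp: projection_def)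

lemma projection_closed: "x \<in> V \<Longrightarrow> p x \<in> V"
  using lin_closed[OF projection_lin] .

lemma projection_fixes: "x \<in> p ` V \<Longrightarrow> p x = x"
  using projection_idem by auto

lemma complement_subset: "p ` V \<subseteq> V"
  using projection_closed by blast

lemma subspace_complement: "subspace (p ` V)"
  using subspace_image projection_lin V by blast

lemma projection_rest: "x \<in> V \<Longrightarrow> x \<ominus>\<^bsub>A\<^esub> p x \<in> W"
  using projection_kernel[of "x \<ominus>\<^bsub>A\<^esub> p x"] projection_closed[of x] V projection_idem[of x]
    minus_eq_zero_iff[of "p x" "p x"]
  by (simp add: subspace_minus lin_minus[OF projection_lin V(1,1)] subspace_carrier)

lemma projection_split: "x \<in> V \<Longrightarrow> (x \<ominus>\<^bsub>A\<^esub> p x) \<oplus>\<^bsub>A\<^esub> p x = x"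
  using projection_closed[of x] V by (simp add: subspace_carrier M.minus_eq M.a_assoc M.l_neg)

lemma dim_complement: "dim W + dim (p ` V) = dim V"
proof -
  have "{x \<in> V. p x = \<zero>\<^bsub>A\<^esub>} = W" using projection_kernel W by blast
  then show ?thesis using rank_nullity[OF projection_lin V V(1)] by simp
qed

lemma lin_projection:
  assumes "f \<in> lin (p ` V) B"
  shows "(\<lambda>x\<in>V. f (p x)) \<in> lin V B"
  by (rule lin_compose[OF lin_codomain[OF projection_lin] assms]) (use V in auto)

lemma lin_vanishing_projection:
  assumes "f \<in> lin V B" "subspace B" "\<And>x. x \<in> W \<Longrightarrow> f x = \<zero>\<^bsub>A\<^esub>" "x \<in> V"
  shows "f (p x) = f x"
proof -
  have "p x \<in> V" using projection_closed assms by blast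
  then have "f x \<ominus>\<^bsub>A\<^esub> f (p x) = \<zero>\<^bsub>A\<^esub>"
    using assms(3)[OF projection_rest[OF assms(4)]] lin_minus[OF assms(1) V(1) assms(2) assms(4)] by simp
  moreover have "f x \<in> carrier A" "f (p x) \<in> carrier A"
    using lin_closed[OF assms(1)] subspace_carrier[OF assms(2)] assms(4) \<open>p x \<in> V\<close> by auto
  ultimately show ?thesis using minus_eq_zero_iff by metis
qed

end

text \<open>With respect to decompositions of \<open>V\<close> and \<open>V'\<close>, a map that preserves the first summands has
  three blocks; they can be chosen independently.\<close>

lemma block_bij:
  assumes V: "subspace V" "finite V" and W: "subspace W" "W \<subseteq> V" and p: "projection V W p"
    and V': "subspace V'" "finite V'" and W': "subspace W'" "W' \<subseteq> V'" and p': "projection V' W' p'"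
  shows "bij_betw (\<lambda>f. (restrict f W, \<lambda>x\<in>p ` V. p' (f x), \<lambda>x\<in>p ` V. f x \<ominus>\<^bsub>A\<^esub> p' (f x)))
    {f \<in> lin V V'. f ` W \<subseteq> W'}
    (lin W W' \<times> lin (p ` V) (p' ` V') \<times> lin (p ` V) W')"
proof -
  note P = projection_lin[OF V W p] projection_idem[OF V W p] projection_kernel[OF V W p]
    projection_closed[OF V W p] complement_subset[OF V W p] subspace_complement[OF V W p]
    projection_rest[OF V W p] projection_split[OF V W p] projection_fixes[OF V W p]
  note P' = projection_lin[OF V' W' p'] projection_idem[OF V' W' p'] projection_kernel[OF V' W' p']
    projection_closed[OF V' W' p'] complement_subset[OF V' W' p'] subspace_complement[OF V' W' p']
    projection_rest[OF V' W' p'] projection_split[OF V' W' p'] projection_fixes[OF V' W' p']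
  let ?C = "p ` V" and ?C' = "p' ` V'"
  define r where "r = (\<lambda>x\<in>V. (\<lambda>x\<in>V. x) x \<ominus>\<^bsub>A\<^esub> p x)"
  have r: "r \<in> lin V W"
  proof (rule lin_codomain)
    show "r \<in> lin V V" unfolding r_def by (rule lin_diff[OF lin_id[OF V(1)] P(1) V(1) V(1)])
    show "r x \<in> W" if "x \<in> V" for x using that P(7) by (simp add: r_def)
  qed
  have C: "x \<in> V" "p x = x" "x \<ominus>\<^bsub>A\<^esub> p x = \<zero>\<^bsub>A\<^esub>" if "x \<in> ?C" for x
  proof -
    show x: "x \<in> V" using that P(5) by blast
    show px: "p x = x" using P(9)[OF that] .
    show "x \<ominus>\<^bsub>A\<^esub> p x = \<zero>\<^bsub>A\<^esub>"
      unfolding px using subspace_carrier[OF V(1) x] minus_eq_zero_iff[of x x] by simp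
  qed
  show ?thesis
  proof (rule bij_betwI[where g = "\<lambda>(P, S, T). \<lambda>x\<in>V. P (x \<ominus>\<^bsub>A\<^esub> p x) \<oplus>\<^bsub>A\<^esub> (S (p x) \<oplus>\<^bsub>A\<^esub> T (p x))"])
    show "(\<lambda>f. (restrict f W, \<lambda>x\<in>?C. p' (f x), \<lambda>x\<in>?C. f x \<ominus>\<^bsub>A\<^esub> p' (f x)))
      \<in> {f \<in> lin V V'. f ` W \<subseteq> W'} \<rightarrow> lin W W' \<times> lin ?C ?C' \<times> lin ?C W'"
    proof (rule funcsetI, elim CollectE conjE, intro SigmaI)
      fix f assume f: "f \<in> lin V V'" "f ` W \<subseteq> W'"
      show "restrict f W \<in> lin W W'"
        by (rule lin_codomain[OF lin_restrict[OF f(1) W]]) (use f(2) in auto)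
      have pf: "(\<lambda>x\<in>V. p' (f x)) \<in> lin V V'" by (rule lin_compose[OF f(1) P'(1) V(1)])
      have "restrict (\<lambda>x\<in>V. p' (f x)) ?C \<in> lin ?C ?C'"
        by (rule lin_codomain[OF lin_restrict[OF pf P(6,5)]]) (use C(1) lin_closed[OF f(1)] in auto)
      moreover have "restrict (\<lambda>x\<in>V. p' (f x)) ?C = (\<lambda>x\<in>?C. p' (f x))"
        by (rule restrict_ext) (use C(1) in auto)
      ultimately show "(\<lambda>x\<in>?C. p' (f x)) \<in> lin ?C ?C'" by simp
      have df: "(\<lambda>x\<in>V. f x \<ominus>\<^bsub>A\<^esub> (\<lambda>x\<in>V. p' (f x)) x) \<in> lin V V'"
        by (rule lin_diff[OF f(1) pf V(1) V'(1)])
      have "restrict (\<lambda>x\<in>V. f x \<ominus>\<^bsub>A\<^esub> (\<lambda>x\<in>V. p' (f x)) x) ?C \<in> lin ?C W'"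
        by (rule lin_codomain[OF lin_restrict[OF df P(6,5)]]) (use C(1) lin_closed[OF f(1)] P'(7) in auto)
      moreover have "restrict (\<lambda>x\<in>V. f x \<ominus>\<^bsub>A\<^esub> (\<lambda>x\<in>V. p' (f x)) x) ?C = (\<lambda>x\<in>?C. f x \<ominus>\<^bsub>A\<^esub> p' (f x))"
        by (rule restrict_ext) (use C(1) in auto)
      ultimately show "(\<lambda>x\<in>?C. f x \<ominus>\<^bsub>A\<^esub> p' (f x)) \<in> lin ?C W'" by simp
    qed
  next
    have "(\<lambda>x\<in>V. P (x \<ominus>\<^bsub>A\<^esub> p x) \<oplus>\<^bsub>A\<^esub> (S (p x) \<oplus>\<^bsub>A\<^esub> T (p x))) \<in> {f \<in> lin V V'. f ` W \<subseteq> W'}"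
      if PST: "P \<in> lin W W'" "S \<in> lin ?C ?C'" "T \<in> lin ?C W'" for P S T
    proof (intro CollectI conjI)
      have 1: "(\<lambda>x\<in>V. P (r x)) \<in> lin V V'"
        by (rule lin_mono[OF lin_compose[OF r PST(1) V(1)] W'(2)])
      have 2: "(\<lambda>x\<in>V. S (p x)) \<in> lin V V'"
        by (rule lin_mono[OF lin_projection[OF V W p PST(2)] P'(5)])
      have 3: "(\<lambda>x\<in>V. T (p x)) \<in> lin V V'"
        by (rule lin_mono[OF lin_projection[OF V W p PST(3)] W'(2)])
      have "(\<lambda>x\<in>V. (\<lambda>x\<in>V. P (r x)) x \<oplus>\<^bsub>A\<^esub> (\<lambda>x\<in>V. (\<lambda>x\<in>V. S (p x)) x \<oplus>\<^bsub>A\<^esub> (\<lambda>x\<in>V. T (p x)) x) x) \<in> lin V V'"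
        by (rule lin_plus[OF 1 lin_plus[OF 2 3 V(1) V'(1)] V(1) V'(1)])
      also have "(\<lambda>x\<in>V. (\<lambda>x\<in>V. P (r x)) x \<oplus>\<^bsub>A\<^esub> (\<lambda>x\<in>V. (\<lambda>x\<in>V. S (p x)) x \<oplus>\<^bsub>A\<^esub> (\<lambda>x\<in>V. T (p x)) x) x) =
        (\<lambda>x\<in>V. P (x \<ominus>\<^bsub>A\<^esub> p x) \<oplus>\<^bsub>A\<^esub> (S (p x) \<oplus>\<^bsub>A\<^esub> T (p x)))"
        by (rule restrict_ext) (simp add: r_def)
      finally show "(\<lambda>x\<in>V. P (x \<ominus>\<^bsub>A\<^esub> p x) \<oplus>\<^bsub>A\<^esub> (S (p x) \<oplus>\<^bsub>A\<^esub> T (p x))) \<in> lin V V'" .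
      show "(\<lambda>x\<in>V. P (x \<ominus>\<^bsub>A\<^esub> p x) \<oplus>\<^bsub>A\<^esub> (S (p x) \<oplus>\<^bsub>A\<^esub> T (p x))) ` W \<subseteq> W'"
      proof (rule image_subsetI)
        fix x assume x: "x \<in> W"
        then have xV: "x \<in> V" "p x = \<zero>\<^bsub>A\<^esub>" using W(2) P(3) by auto
        have "x \<ominus>\<^bsub>A\<^esub> p x = x" using xV subspace_carrier[OF V(1)] by (simp add: M.minus_eq)
        then show "(\<lambda>x\<in>V. P (x \<ominus>\<^bsub>A\<^esub> p x) \<oplus>\<^bsub>A\<^esub> (S (p x) \<oplus>\<^bsub>A\<^esub> T (p x))) x \<in> W'"
          using xV x lin_closed[OF PST(1) x] lin_zero[OF PST(2) P(6) P'(6)] lin_zero[OF PST(3) P(6) W'(1)]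
          by (simp add: subspace_closed[OF W'(1)])
      qed
    qed
    then show "(\<lambda>(P, S, T). \<lambda>x\<in>V. P (x \<ominus>\<^bsub>A\<^esub> p x) \<oplus>\<^bsub>A\<^esub> (S (p x) \<oplus>\<^bsub>A\<^esub> T (p x)))
      \<in> lin W W' \<times> lin ?C ?C' \<times> lin ?C W' \<rightarrow> {f \<in> lin V V'. f ` W \<subseteq> W'}"
      by (intro funcsetI) (elim SigmaE, simp only: prod.case)
  next
    fix f assume f: "f \<in> {f \<in> lin V V'. f ` W \<subseteq> W'}"
    then have fl: "f \<in> lin V V'" by blast
    have "restrict f W (x \<ominus>\<^bsub>A\<^esub> p x) \<oplus>\<^bsub>A\<^esub> (p' (f (p x)) \<oplus>\<^bsub>A\<^esub> (f (p x) \<ominus>\<^bsub>A\<^esub> p' (f (p x)))) = f x" if x: "x \<in> V" for x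
    proof -
      have px: "p x \<in> V" "x \<ominus>\<^bsub>A\<^esub> p x \<in> W" "x \<ominus>\<^bsub>A\<^esub> p x \<in> V" using x P(4,7) W(2) by auto
      have car: "f (p x) \<in> carrier A" "p' (f (p x)) \<in> carrier A" "f (x \<ominus>\<^bsub>A\<^esub> p x) \<in> carrier A"
        using px lin_closed[OF fl] P'(4) subspace_carrier[OF V'(1)] by auto
      have "p' (f (p x)) \<oplus>\<^bsub>A\<^esub> (f (p x) \<ominus>\<^bsub>A\<^esub> p' (f (p x))) = f (p x)"
        using car by (simp add: M.minus_eq M.a_lcomm M.r_neg)
      moreover have "f (x \<ominus>\<^bsub>A\<^esub> p x) \<oplus>\<^bsub>A\<^esub> f (p x) = f x"
        using lin_add[OF fl px(3,1)] P(8)[OF x] by simp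
      ultimately show ?thesis using px by simp
    qed
    then show "(\<lambda>(P, S, T). \<lambda>x\<in>V. P (x \<ominus>\<^bsub>A\<^esub> p x) \<oplus>\<^bsub>A\<^esub> (S (p x) \<oplus>\<^bsub>A\<^esub> T (p x)))
      (restrict f W, \<lambda>x\<in>?C. p' (f x), \<lambda>x\<in>?C. f x \<ominus>\<^bsub>A\<^esub> p' (f x)) = f"
      using lin_extensional[OF fl] by (auto simp: extensional_def fun_eq_iff)
  next
    fix z assume "z \<in> lin W W' \<times> lin ?C ?C' \<times> lin ?C W'"
    then obtain P S T where z: "z = (P, S, T)" and PST: "P \<in> lin W W'" "S \<in> lin ?C ?C'" "T \<in> lin ?C W'" by auto
    define g where "g = (\<lambda>x\<in>V. P (x \<ominus>\<^bsub>A\<^esub> p x) \<oplus>\<^bsub>A\<^esub> (S (p x) \<oplus>\<^bsub>A\<^esub> T (p x)))"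
    have gW: "g x = P x" if x: "x \<in> W" for x
    proof -
      have xV: "x \<in> V" "p x = \<zero>\<^bsub>A\<^esub>" using x W(2) P(3) by auto
      have "x \<ominus>\<^bsub>A\<^esub> p x = x" using xV subspace_carrier[OF V(1)] by (simp add: M.minus_eq)
      then show ?thesis
        using xV lin_closed[OF PST(1) x] lin_zero[OF PST(2) P(6) P'(6)] lin_zero[OF PST(3) P(6) W'(1)]
          subspace_carrier[OF W'(1)] by (simp add: g_def)
    qed
    have gC: "g x = S x \<oplus>\<^bsub>A\<^esub> T x" "p' (g x) = S x" "g x \<ominus>\<^bsub>A\<^esub> p' (g x) = T x" if x: "x \<in> ?C" for x
    proof -
      have ST: "S x \<in> ?C'" "S x \<in> V'" "T x \<in> W'" "T x \<in> V'"
        using lin_closed[OF PST(2) x] lin_closed[OF PST(3) x] P'(5) W'(2) by auto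
      then have car: "S x \<in> carrier A" "T x \<in> carrier A" using subspace_carrier[OF V'(1)] by auto
      show g: "g x = S x \<oplus>\<^bsub>A\<^esub> T x"
        using C[OF x] lin_zero[OF PST(1) W(1) W'(1)] car by (simp add: g_def)
      have "p' (T x) = \<zero>\<^bsub>A\<^esub>" using P'(3) ST by blast
      then show "p' (g x) = S x"
        using g ST P'(9)[OF ST(1)] lin_add[OF P'(1) ST(2,4)] car by simp
      then show "g x \<ominus>\<^bsub>A\<^esub> p' (g x) = T x"
        using g car M.a_comm[of "S x" "T x"] by (simp add: M.minus_eq M.a_assoc M.r_neg)
    qed
    have "restrict g W = P"
      by (rule extensionalityI[of _ W]) (use gW lin_extensional[OF PST(1)] in auto)
    moreover have "(\<lambda>x\<in>?C. p' (g x)) = S"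
      by (rule extensionalityI[of _ ?C]) (use gC(2) lin_extensional[OF PST(2)] in auto)
    moreover have "(\<lambda>x\<in>?C. g x \<ominus>\<^bsub>A\<^esub> p' (g x)) = T"
      by (rule extensionalityI[of _ ?C]) (use gC(3) lin_extensional[OF PST(3)] in auto)
    ultimately show "(\<lambda>f. (restrict f W, \<lambda>x\<in>?C. p' (f x), \<lambda>x\<in>?C. f x \<ominus>\<^bsub>A\<^esub> p' (f x)))
      ((\<lambda>(P, S, T). \<lambda>x\<in>V. P (x \<ominus>\<^bsub>A\<^esub> p x) \<oplus>\<^bsub>A\<^esub> (S (p x) \<oplus>\<^bsub>A\<^esub> T (p x))) z) = z"
      unfolding z prod.case g_def[symmetric] by simp
  qed
qed

end

section \<open>The torsion pair of a rigid representation\<close>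

lemma bij_betw_Collect:
  assumes "bij_betw f S T" "\<And>x. x \<in> S \<Longrightarrow> P x \<longleftrightarrow> R (f x)"
  shows "bij_betw f {x \<in> S. P x} {y \<in> T. R y}"
  using assms unfolding bij_betw_def by (auto simp: inj_on_def)

context finite_field_module
begin

lemma restrict_lin_closed: "restrict f V \<in> lin V B \<Longrightarrow> x \<in> V \<Longrightarrow> f x \<in> B"
  using lin_closed[of "restrict f V" V B x] by simp

lemma lin_compose_restrict:
  assumes "restrict f V \<in> lin V Y" "g \<in> lin Y Z" "subspace V"
  shows "(\<lambda>x\<in>V. g (f x)) \<in> lin V Z"
proof -
  have "(\<lambda>x\<in>V. g (restrict f V x)) \<in> lin V Z" by (rule lin_compose[OF assms])
  moreover have "(\<lambda>x\<in>V. g (restrict f V x)) = (\<lambda>x\<in>V. g (f x))" by (rule restrict_ext) simp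
  ultimately show ?thesis by simp
qed

lemma diff_of_sums:
  assumes "a \<in> carrier A" "b \<in> carrier A" "c \<in> carrier A" "d \<in> carrier A"
  shows "(a \<oplus>\<^bsub>A\<^esub> b) \<ominus>\<^bsub>A\<^esub> (c \<oplus>\<^bsub>A\<^esub> d) = (a \<ominus>\<^bsub>A\<^esub> c) \<oplus>\<^bsub>A\<^esub> (b \<ominus>\<^bsub>A\<^esub> d)"
  using assms by (simp add: M.minus_eq M.minus_add M.add.m_ac)

lemma add_diff_cancel:
  assumes "a \<in> carrier A" "b \<in> carrier A"
  shows "a \<oplus>\<^bsub>A\<^esub> (b \<ominus>\<^bsub>A\<^esub> a) = b"
  using assms M.a_lcomm[of a b "\<ominus>\<^bsub>A\<^esub> a"] by (simp add: M.minus_eq M.r_neg)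

lemma card_PiE_lin:
  assumes "finite I" "\<And>i. i \<in> I \<Longrightarrow> subspace (V i) \<and> finite (V i) \<and> subspace (B i) \<and> finite (B i)"
  shows "card (PiE I (\<lambda>i. lin (V i) (B i))) = q ^ (\<Sum>i\<in>I. dim (V i) * dim (B i))"
  by (simp add: card_PiE assms power_sum card_lin cong: prod.cong)

end

text \<open>The last assumption says that \<open>Ext\<^sup>1(M, M)\<close>, the cokernel of
  \<open>\<Prod>i. Hom(M i, M i) \<rightarrow> \<Prod>\<alpha>. Hom(M (tail \<alpha>), M (head \<alpha>))\<close>, vanishes.\<close>

locale rigid_rep = finite_field_module F A
  for F :: "('f, 'g) ring_scheme" (structure) and A :: "('f, 'b, 'h) module_scheme" (structure) +
  fixes Q :: "('v, 'e) pre_digraph" and M :: "'v \<Rightarrow> 'b set" and m :: "'e \<Rightarrow> 'b \<Rightarrow> 'b"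
  assumes finite_quiver: "fin_digraph Q"
    and M_space: "i \<in> verts Q \<Longrightarrow> subspace (M i) \<and> finite (M i)"
    and m_lin: "\<alpha> \<in> arcs Q \<Longrightarrow> m \<alpha> \<in> lin (M (tail Q \<alpha>)) (M (head Q \<alpha>))"
    and rigid: "(\<And>\<alpha>. \<alpha> \<in> arcs Q \<Longrightarrow> \<psi> \<alpha> \<in> lin (M (tail Q \<alpha>)) (M (head Q \<alpha>))) \<Longrightarrow>
      \<exists>\<phi>. (\<forall>i\<in>verts Q. \<phi> i \<in> lin (M i) (M i)) \<and>
        (\<forall>\<alpha>\<in>arcs Q. \<forall>x\<in>M (tail Q \<alpha>).
          \<psi> \<alpha> x = \<phi> (head Q \<alpha>) (m \<alpha> x) \<ominus>\<^bsub>A\<^esub> m \<alpha> (\<phi> (tail Q \<alpha>) x))"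
begin

abbreviation src where "src \<equiv> tail Q"
abbreviation tgt where "tgt \<equiv> head Q"

lemma finite_verts [simp]: "finite (verts Q)" and finite_arcs [simp]: "finite (arcs Q)"
  and src_in [simp]: "\<alpha> \<in> arcs Q \<Longrightarrow> src \<alpha> \<in> verts Q" and tgt_in [simp]: "\<alpha> \<in> arcs Q \<Longrightarrow> tgt \<alpha> \<in> verts Q"
  using finite_quiver
  by (auto simp: fin_digraph_def fin_digraph_axioms_def wf_digraph_def)

definition gspace :: "('v \<Rightarrow> 'b set) \<Rightarrow> bool" where
  "gspace V \<longleftrightarrow> (\<forall>i\<in>verts Q. subspace (V i) \<and> finite (V i))"

definition subfam :: "('v \<Rightarrow> 'b set) \<Rightarrow> ('v \<Rightarrow> 'b set) \<Rightarrow> bool" where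
  "subfam W V \<longleftrightarrow> (\<forall>i\<in>verts Q. subspace (W i) \<and> W i \<subseteq> V i)"

text \<open>A structure on \<open>V\<close> is restricted to subrepresentations without changing the maps, so the maps
  need to be linear on \<open>V\<close> only.\<close>

definition acts :: "('v \<Rightarrow> 'b set) \<Rightarrow> ('e \<Rightarrow> 'b \<Rightarrow> 'b) \<Rightarrow> bool" where
  "acts V N \<longleftrightarrow> (\<forall>\<alpha>\<in>arcs Q. restrict (N \<alpha>) (V (src \<alpha>)) \<in> lin (V (src \<alpha>)) (V (tgt \<alpha>)))"

definition stable :: "('v \<Rightarrow> 'b set) \<Rightarrow> ('e \<Rightarrow> 'b \<Rightarrow> 'b) \<Rightarrow> bool" where
  "stable W N \<longleftrightarrow> (\<forall>\<alpha>\<in>arcs Q. N \<alpha> ` W (src \<alpha>) \<subseteq> W (tgt \<alpha>))"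

text \<open>The differential of the two-term complex with cohomology \<open>Hom(N, M)\<close> and \<open>Ext\<^sup>1(N, M)\<close>.\<close>

definition delta :: "('e \<Rightarrow> 'b \<Rightarrow> 'b) \<Rightarrow> ('v \<Rightarrow> 'b \<Rightarrow> 'b) \<Rightarrow> 'e \<Rightarrow> 'b \<Rightarrow> 'b" where
  "delta N \<phi> \<alpha> x = \<phi> (tgt \<alpha>) (N \<alpha> x) \<ominus>\<^bsub>A\<^esub> m \<alpha> (\<phi> (src \<alpha>) x)"

text \<open>\<open>Ext\<^sup>1(V/W, M) = 0\<close>, where maps on \<open>V/W\<close> are encoded as maps on \<open>V\<close> that vanish on \<open>W\<close>.\<close>

definition ext_zero :: "('v \<Rightarrow> 'b set) \<Rightarrow> ('v \<Rightarrow> 'b set) \<Rightarrow> ('e \<Rightarrow> 'b \<Rightarrow> 'b) \<Rightarrow> bool" where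
  "ext_zero V W N \<longleftrightarrow> (\<forall>\<psi>.
     (\<forall>\<alpha>\<in>arcs Q. \<psi> \<alpha> \<in> lin (V (src \<alpha>)) (M (tgt \<alpha>)) \<and> (\<forall>x\<in>W (src \<alpha>). \<psi> \<alpha> x = \<zero>\<^bsub>A\<^esub>)) \<longrightarrow>
     (\<exists>\<phi>. (\<forall>i\<in>verts Q. \<phi> i \<in> lin (V i) (M i) \<and> (\<forall>x\<in>W i. \<phi> i x = \<zero>\<^bsub>A\<^esub>)) \<and>
       (\<forall>\<alpha>\<in>arcs Q. \<forall>x\<in>V (src \<alpha>). delta N \<phi> \<alpha> x = \<psi> \<alpha> x)))"

text \<open>No non-zero quotient \<open>W/U\<close> satisfies \<open>Ext\<^sup>1(W/U, M) = 0\<close>.\<close>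

definition torsion :: "('v \<Rightarrow> 'b set) \<Rightarrow> ('e \<Rightarrow> 'b \<Rightarrow> 'b) \<Rightarrow> bool" where
  "torsion W N \<longleftrightarrow> (\<forall>U. subfam U W \<and> stable U N \<and> ext_zero W U N \<longrightarrow> (\<forall>i\<in>verts Q. U i = W i))"

definition homs :: "('v \<Rightarrow> 'b set) \<Rightarrow> ('e \<Rightarrow> 'b \<Rightarrow> 'b) \<Rightarrow> ('v \<Rightarrow> 'b \<Rightarrow> 'b) set" where
  "homs V N = {h \<in> PiE (verts Q) (\<lambda>i. lin (V i) (M i)).
     \<forall>\<alpha>\<in>arcs Q. \<forall>x\<in>V (src \<alpha>). h (tgt \<alpha>) (N \<alpha> x) = m \<alpha> (h (src \<alpha>) x)}"

abbreviation zero_fam :: "'v \<Rightarrow> 'b set" where "zero_fam \<equiv> (\<lambda>_. {\<zero>\<^bsub>A\<^esub>})"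

lemma gspaceD: "gspace V \<Longrightarrow> i \<in> verts Q \<Longrightarrow> subspace (V i)" "gspace V \<Longrightarrow> i \<in> verts Q \<Longrightarrow> finite (V i)"
  by (auto simp: gspace_def)

lemma M_spaceD: "i \<in> verts Q \<Longrightarrow> subspace (M i)" "i \<in> verts Q \<Longrightarrow> finite (M i)"
  using M_space by auto

lemma subfamD: "subfam W V \<Longrightarrow> i \<in> verts Q \<Longrightarrow> subspace (W i)" "subfam W V \<Longrightarrow> i \<in> verts Q \<Longrightarrow> W i \<subseteq> V i"
  by (auto simp: subfam_def)

lemma subfam_in: "subfam W V \<Longrightarrow> i \<in> verts Q \<Longrightarrow> x \<in> W i \<Longrightarrow> x \<in> V i"
  by (auto simp: subfam_def)

lemma subfam_gspace: "subfam W V \<Longrightarrow> gspace V \<Longrightarrow> gspace W"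
  by (auto simp: subfam_def gspace_def intro: finite_subset)

lemma subfam_trans: "subfam U W \<Longrightarrow> subfam W V \<Longrightarrow> subfam U V"
  by (auto simp: subfam_def)

lemma subfam_refl: "gspace V \<Longrightarrow> subfam V V"
  by (auto simp: subfam_def gspace_def)

lemma subfam_zero: "gspace V \<Longrightarrow> subfam zero_fam V"
  using subspace_singleton_zero subspace_zero by (auto simp: subfam_def gspace_def)

lemma subfam_Int: "subfam U V \<Longrightarrow> subfam W V \<Longrightarrow> subfam (\<lambda>i. W i \<inter> U i) W"
  using subspace_Int by (auto simp: subfam_def)

lemma stable_Int: "stable U N \<Longrightarrow> stable W N \<Longrightarrow> stable (\<lambda>i. W i \<inter> U i) N"
  by (fastforce simp: stable_def)

lemma actsD: "acts V N \<Longrightarrow> \<alpha> \<in> arcs Q \<Longrightarrow> restrict (N \<alpha>) (V (src \<alpha>)) \<in> lin (V (src \<alpha>)) (V (tgt \<alpha>))"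
  by (auto simp: acts_def)

lemma acts_closed: "acts V N \<Longrightarrow> \<alpha> \<in> arcs Q \<Longrightarrow> x \<in> V (src \<alpha>) \<Longrightarrow> N \<alpha> x \<in> V (tgt \<alpha>)"
  using restrict_lin_closed[OF actsD] by blast

lemma acts_zero: 
  assumes "acts V N" "gspace V" "\<alpha> \<in> arcs Q" shows "N \<alpha> \<zero>\<^bsub>A\<^esub> = \<zero>\<^bsub>A\<^esub>"
  using lin_zero[OF actsD[OF assms(1,3)]] subspace_zero[of "V (src \<alpha>)"] assms by (simp add: gspaceD)

lemma acts_stable: "acts V N \<Longrightarrow> stable V N"
  using acts_closed by (auto simp: stable_def)

lemma stable_zero: "acts V N \<Longrightarrow> gspace V \<Longrightarrow> stable zero_fam N"
  using acts_zero by (auto simp: stable_def)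

lemma ext_zeroI:
  assumes "\<And>\<psi>. (\<And>\<alpha>. \<alpha> \<in> arcs Q \<Longrightarrow> \<psi> \<alpha> \<in> lin (V (src \<alpha>)) (M (tgt \<alpha>))) \<Longrightarrow>
     (\<And>\<alpha> x. \<alpha> \<in> arcs Q \<Longrightarrow> x \<in> W (src \<alpha>) \<Longrightarrow> \<psi> \<alpha> x = \<zero>\<^bsub>A\<^esub>) \<Longrightarrow>
     \<exists>\<phi>. (\<forall>i\<in>verts Q. \<phi> i \<in> lin (V i) (M i) \<and> (\<forall>x\<in>W i. \<phi> i x = \<zero>\<^bsub>A\<^esub>)) \<and>
       (\<forall>\<alpha>\<in>arcs Q. \<forall>x\<in>V (src \<alpha>). delta N \<phi> \<alpha> x = \<psi> \<alpha> x)"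
  shows "ext_zero V W N"
  unfolding ext_zero_def using assms by blast

lemma ext_zeroE:
  assumes "ext_zero V W N" "\<And>\<alpha>. \<alpha> \<in> arcs Q \<Longrightarrow> \<psi> \<alpha> \<in> lin (V (src \<alpha>)) (M (tgt \<alpha>))"
    "\<And>\<alpha> x. \<alpha> \<in> arcs Q \<Longrightarrow> x \<in> W (src \<alpha>) \<Longrightarrow> \<psi> \<alpha> x = \<zero>\<^bsub>A\<^esub>"
  obtains \<phi> where "\<And>i. i \<in> verts Q \<Longrightarrow> \<phi> i \<in> lin (V i) (M i)"
    "\<And>i x. i \<in> verts Q \<Longrightarrow> x \<in> W i \<Longrightarrow> \<phi> i x = \<zero>\<^bsub>A\<^esub>"
    "\<And>\<alpha> x. \<alpha> \<in> arcs Q \<Longrightarrow> x \<in> V (src \<alpha>) \<Longrightarrow> delta N \<phi> \<alpha> x = \<psi> \<alpha> x"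
proof -
  have "\<exists>\<phi>. (\<forall>i\<in>verts Q. \<phi> i \<in> lin (V i) (M i) \<and> (\<forall>x\<in>W i. \<phi> i x = \<zero>\<^bsub>A\<^esub>)) \<and>
       (\<forall>\<alpha>\<in>arcs Q. \<forall>x\<in>V (src \<alpha>). delta N \<phi> \<alpha> x = \<psi> \<alpha> x)"
    using assms unfolding ext_zero_def by blast
  then show ?thesis using that by blast
qed

lemma delta_lin:
  assumes V: "gspace V" and N: "acts V N" and a: "\<alpha> \<in> arcs Q" and \<phi>: "\<And>i. i \<in> verts Q \<Longrightarrow> \<phi> i \<in> lin (V i) (M i)"
  shows "(\<lambda>x\<in>V (src \<alpha>). delta N \<phi> \<alpha> x) \<in> lin (V (src \<alpha>)) (M (tgt \<alpha>))"
proof -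
  have s: "subspace (V (src \<alpha>))" "subspace (M (tgt \<alpha>))" using V a by (simp_all add: gspaceD M_spaceD)
  have 1: "(\<lambda>x\<in>V (src \<alpha>). \<phi> (tgt \<alpha>) (N \<alpha> x)) \<in> lin (V (src \<alpha>)) (M (tgt \<alpha>))"
    by (rule lin_compose_restrict[OF actsD[OF N a] \<phi> s(1)]) (simp add: a)
  have 2: "(\<lambda>x\<in>V (src \<alpha>). m \<alpha> (\<phi> (src \<alpha>) x)) \<in> lin (V (src \<alpha>)) (M (tgt \<alpha>))"
    by (rule lin_compose[OF \<phi> m_lin[OF a] s(1)]) (simp add: a)
  have "(\<lambda>x\<in>V (src \<alpha>). delta N \<phi> \<alpha> x) = (\<lambda>x\<in>V (src \<alpha>). (\<lambda>x\<in>V (src \<alpha>). \<phi> (tgt \<alpha>) (N \<alpha> x)) x \<ominus>\<^bsub>A\<^esub>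
      (\<lambda>x\<in>V (src \<alpha>). m \<alpha> (\<phi> (src \<alpha>) x)) x)"
    by (rule restrict_ext) (simp add: delta_def)
  also have "\<dots> \<in> lin (V (src \<alpha>)) (M (tgt \<alpha>))"
    by (rule lin_diff[OF 1 2 s])
  finally show ?thesis .
qed

lemma delta_add:
  assumes V: "gspace V" and N: "acts V N" and a: "\<alpha> \<in> arcs Q" and x: "x \<in> V (src \<alpha>)"
    and \<phi>: "\<And>i. i \<in> verts Q \<Longrightarrow> \<phi> i \<in> lin (V i) (M i)" and \<phi>': "\<And>i. i \<in> verts Q \<Longrightarrow> \<phi>' i \<in> lin (V i) (M i)"
    and \<theta>: "\<And>i x. i \<in> verts Q \<Longrightarrow> x \<in> V i \<Longrightarrow> \<theta> i x = \<phi> i x \<oplus>\<^bsub>A\<^esub> \<phi>' i x"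
  shows "delta N \<theta> \<alpha> x = delta N \<phi> \<alpha> x \<oplus>\<^bsub>A\<^esub> delta N \<phi>' \<alpha> x"
proof -
  have Nx: "N \<alpha> x \<in> V (tgt \<alpha>)" using acts_closed[OF N a x] .
  have in_M: "\<phi> (src \<alpha>) x \<in> M (src \<alpha>)" "\<phi>' (src \<alpha>) x \<in> M (src \<alpha>)"
    "\<phi> (tgt \<alpha>) (N \<alpha> x) \<in> M (tgt \<alpha>)" "\<phi>' (tgt \<alpha>) (N \<alpha> x) \<in> M (tgt \<alpha>)"
    using a x Nx lin_closed[OF \<phi>] lin_closed[OF \<phi>'] by simp_all
  then have "m \<alpha> (\<phi> (src \<alpha>) x) \<in> M (tgt \<alpha>)" "m \<alpha> (\<phi>' (src \<alpha>) x) \<in> M (tgt \<alpha>)"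
    using lin_closed[OF m_lin[OF a]] by simp_all
  then have "\<phi> (tgt \<alpha>) (N \<alpha> x) \<in> carrier A" "\<phi>' (tgt \<alpha>) (N \<alpha> x) \<in> carrier A"
    "m \<alpha> (\<phi> (src \<alpha>) x) \<in> carrier A" "m \<alpha> (\<phi>' (src \<alpha>) x) \<in> carrier A"
    using in_M a subspace_carrier[OF M_spaceD(1)[of "tgt \<alpha>"]] by simp_all
  then show ?thesis
    using a x Nx by (simp add: delta_def \<theta> lin_add[OF m_lin[OF a] in_M(1,2)] diff_of_sums)
qed

lemma ext_zero_self: 
  assumes "gspace V" "acts V N" shows "ext_zero V V N"
proof (rule ext_zeroI)
  fix \<psi> assume \<psi>: "\<And>\<alpha> x. \<alpha> \<in> arcs Q \<Longrightarrow> x \<in> V (src \<alpha>) \<Longrightarrow> \<psi> \<alpha> x = \<zero>\<^bsub>A\<^esub>"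
  have "delta N (\<lambda>i. \<lambda>x\<in>V i. \<zero>\<^bsub>A\<^esub>) \<alpha> x = \<psi> \<alpha> x" if "\<alpha> \<in> arcs Q" "x \<in> V (src \<alpha>)" for \<alpha> x
    using acts_closed[OF assms(2) that] lin_zero[OF m_lin[OF that(1)]] that \<psi>
    by (simp add: delta_def M_spaceD M.minus_eq)
  then show "\<exists>\<phi>. (\<forall>i\<in>verts Q. \<phi> i \<in> lin (V i) (M i) \<and> (\<forall>x\<in>V i. \<phi> i x = \<zero>\<^bsub>A\<^esub>)) \<and>
       (\<forall>\<alpha>\<in>arcs Q. \<forall>x\<in>V (src \<alpha>). delta N \<phi> \<alpha> x = \<psi> \<alpha> x)"
    using lin_zero_map assms by (intro exI[of _ "\<lambda>i. \<lambda>x\<in>V i. \<zero>\<^bsub>A\<^esub>"]) (simp add: gspaceD M_spaceD)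
qed

text \<open>Closure under extensions: given a family \<open>\<psi>\<close> on \<open>V/W\<close>, first make it a coboundary on \<open>U/W\<close>,
  extend the solution linearly to \<open>V\<close>, and solve for the difference, which lives on \<open>V/U\<close>.\<close>

lemma ext_zero_trans:
  assumes V: "gspace V" and N: "acts V N" and U: "subfam U V" "stable U N" and W: "subfam W U"
    and "ext_zero V U N" "ext_zero U W N"
  shows "ext_zero V W N"
proof (rule ext_zeroI)
  fix \<psi> assume \<psi>: "\<And>\<alpha>. \<alpha> \<in> arcs Q \<Longrightarrow> \<psi> \<alpha> \<in> lin (V (src \<alpha>)) (M (tgt \<alpha>))"
    "\<And>\<alpha> x. \<alpha> \<in> arcs Q \<Longrightarrow> x \<in> W (src \<alpha>) \<Longrightarrow> \<psi> \<alpha> x = \<zero>\<^bsub>A\<^esub>"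
  obtain \<phi> where \<phi>: "\<And>i. i \<in> verts Q \<Longrightarrow> \<phi> i \<in> lin (U i) (M i)"
    "\<And>i x. i \<in> verts Q \<Longrightarrow> x \<in> W i \<Longrightarrow> \<phi> i x = \<zero>\<^bsub>A\<^esub>"
    "\<And>\<alpha> x. \<alpha> \<in> arcs Q \<Longrightarrow> x \<in> U (src \<alpha>) \<Longrightarrow> delta N \<phi> \<alpha> x = restrict (\<psi> \<alpha>) (U (src \<alpha>)) x"
  proof (rule ext_zeroE[OF \<open>ext_zero U W N\<close>])
    show "restrict (\<psi> \<alpha>) (U (src \<alpha>)) \<in> lin (U (src \<alpha>)) (M (tgt \<alpha>))" if "\<alpha> \<in> arcs Q" for \<alpha>
      by (rule lin_restrict[OF \<psi>(1)[OF that]]) (use subfamD[OF U(1)] that in auto)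
    show "restrict (\<psi> \<alpha>) (U (src \<alpha>)) x = \<zero>\<^bsub>A\<^esub>" if "\<alpha> \<in> arcs Q" "x \<in> W (src \<alpha>)" for \<alpha> x
      using \<psi>(2) that subfamD(2)[OF W, of "src \<alpha>"] by auto
  qed auto
  have "\<exists>g. g \<in> lin (V i) (M i) \<and> (\<forall>x\<in>U i. g x = \<phi> i x)" if "i \<in> verts Q" for i
    by (rule linear_extension[OF \<phi>(1)[OF that], of "V i"])
      (use that V U subfamD gspaceD M_spaceD in auto)
  then obtain \<phi>1 where \<phi>1: "\<And>i. i \<in> verts Q \<Longrightarrow> \<phi>1 i \<in> lin (V i) (M i)"
    "\<And>i x. i \<in> verts Q \<Longrightarrow> x \<in> U i \<Longrightarrow> \<phi>1 i x = \<phi> i x" by metis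
  define \<psi>' where "\<psi>' = (\<lambda>\<alpha>. \<lambda>x\<in>V (src \<alpha>). \<psi> \<alpha> x \<ominus>\<^bsub>A\<^esub> (\<lambda>x\<in>V (src \<alpha>). delta N \<phi>1 \<alpha> x) x)"
  have \<psi>M: "\<psi> \<alpha> x \<in> carrier A" "delta N \<phi>1 \<alpha> x \<in> carrier A" if "\<alpha> \<in> arcs Q" "x \<in> V (src \<alpha>)" for \<alpha> x
    using lin_closed[OF \<psi>(1)[OF that(1)] that(2)] lin_closed[OF delta_lin[where \<phi>=\<phi>1, OF V N that(1) \<phi>1(1)] that(2)]
      subspace_carrier[OF M_spaceD(1)[of "tgt \<alpha>"]] that by auto
  obtain \<phi>2 where \<phi>2: "\<And>i. i \<in> verts Q \<Longrightarrow> \<phi>2 i \<in> lin (V i) (M i)"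
    "\<And>i x. i \<in> verts Q \<Longrightarrow> x \<in> U i \<Longrightarrow> \<phi>2 i x = \<zero>\<^bsub>A\<^esub>"
    "\<And>\<alpha> x. \<alpha> \<in> arcs Q \<Longrightarrow> x \<in> V (src \<alpha>) \<Longrightarrow> delta N \<phi>2 \<alpha> x = \<psi>' \<alpha> x"
  proof (rule ext_zeroE[OF \<open>ext_zero V U N\<close>])
    fix \<alpha> assume a: "\<alpha> \<in> arcs Q"
    show "\<psi>' \<alpha> \<in> lin (V (src \<alpha>)) (M (tgt \<alpha>))"
      unfolding \<psi>'_def
      by (rule lin_diff[OF \<psi>(1)[OF a] delta_lin[where \<phi>=\<phi>1, OF V N a \<phi>1(1)]]) (use a V in \<open>auto simp: gspaceD M_spaceD\<close>)
    fix x assume x: "x \<in> U (src \<alpha>)"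
    then have xV: "x \<in> V (src \<alpha>)" using subfam_in[OF U(1)] a by simp
    have "N \<alpha> x \<in> U (tgt \<alpha>)" using U(2) a x by (auto simp: stable_def)
    then have "delta N \<phi>1 \<alpha> x = delta N \<phi> \<alpha> x" using a x by (simp add: delta_def \<phi>1(2))
    also have "\<dots> = \<psi> \<alpha> x" using \<phi>(3)[OF a x] x by simp
    finally show "\<psi>' \<alpha> x = \<zero>\<^bsub>A\<^esub>" using xV \<psi>M[OF a xV] minus_eq_zero_iff by (simp add: \<psi>'_def)
  qed auto
  \<comment> \<open>\<open>\<phi>1\<close> solves the equation on \<open>U\<close> and \<open>\<phi>2\<close> corrects it on \<open>V\<close> without changing it on \<open>U\<close>.\<close>
  define \<theta> where "\<theta> = (\<lambda>i. \<lambda>x\<in>V i. \<phi>1 i x \<oplus>\<^bsub>A\<^esub> \<phi>2 i x)"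
  have "\<theta> i \<in> lin (V i) (M i)" if "i \<in> verts Q" for i
    unfolding \<theta>_def by (rule lin_plus[OF \<phi>1(1)[OF that] \<phi>2(1)[OF that]]) (use that V in \<open>auto simp: gspaceD M_spaceD\<close>)
  moreover have "\<theta> i x = \<zero>\<^bsub>A\<^esub>" if "i \<in> verts Q" "x \<in> W i" for i x
  proof -
    have "x \<in> U i" "x \<in> V i" using subfam_in[OF W that] subfam_in[OF U(1)] that(1) by auto
    then show ?thesis using that \<phi>1(2) \<phi>2(2) \<phi>(2) by (simp add: \<theta>_def)
  qed
  moreover have "delta N \<theta> \<alpha> x = \<psi> \<alpha> x" if "\<alpha> \<in> arcs Q" "x \<in> V (src \<alpha>)" for \<alpha> x
  proof -
    have "delta N \<theta> \<alpha> x = delta N \<phi>1 \<alpha> x \<oplus>\<^bsub>A\<^esub> delta N \<phi>2 \<alpha> x"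
      by (rule delta_add[OF V N that \<phi>1(1) \<phi>2(1)]) (auto simp: \<theta>_def)
    then show ?thesis using \<psi>M[OF that] that by (simp add: \<phi>2(3) \<psi>'_def add_diff_cancel)
  qed
  ultimately show "\<exists>\<phi>. (\<forall>i\<in>verts Q. \<phi> i \<in> lin (V i) (M i) \<and> (\<forall>x\<in>W i. \<phi> i x = \<zero>\<^bsub>A\<^esub>)) \<and>
       (\<forall>\<alpha>\<in>arcs Q. \<forall>x\<in>V (src \<alpha>). delta N \<phi> \<alpha> x = \<psi> \<alpha> x)" by blast
qed

text \<open>Closure under subobjects, for \<open>W/(W \<inter> U)\<close> inside \<open>V/U\<close>: a family on the subobject extends
  linearly to \<open>V/U\<close>, and the extension is a coboundary. The absence of relations in the quiver
  makes every linear extension admissible.\<close>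

lemma ext_zero_Int:
  assumes V: "gspace V" and N: "acts V N" and U: "subfam U V" and W: "subfam W V" "stable W N"
    and "ext_zero V U N"
  shows "ext_zero W (\<lambda>i. W i \<inter> U i) N"
proof (rule ext_zeroI)
  fix \<psi> assume \<psi>: "\<And>\<alpha>. \<alpha> \<in> arcs Q \<Longrightarrow> \<psi> \<alpha> \<in> lin (W (src \<alpha>)) (M (tgt \<alpha>))"
    "\<And>\<alpha> x. \<alpha> \<in> arcs Q \<Longrightarrow> x \<in> W (src \<alpha>) \<inter> U (src \<alpha>) \<Longrightarrow> \<psi> \<alpha> x = \<zero>\<^bsub>A\<^esub>"
  have "\<exists>g. g \<in> lin (V (src \<alpha>)) (M (tgt \<alpha>)) \<and> (\<forall>x\<in>W (src \<alpha>). g x = \<psi> \<alpha> x) \<and> (\<forall>x\<in>U (src \<alpha>). g x = \<zero>\<^bsub>A\<^esub>)"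
    if "\<alpha> \<in> arcs Q" for \<alpha>
    by (rule extension_by_zero[OF \<psi>(1)[OF that], of "V (src \<alpha>)" "U (src \<alpha>)"])
      (use that V U W \<psi>(2) subfamD gspaceD M_spaceD in auto)
  then obtain \<psi>' where \<psi>': "\<And>\<alpha>. \<alpha> \<in> arcs Q \<Longrightarrow> \<psi>' \<alpha> \<in> lin (V (src \<alpha>)) (M (tgt \<alpha>))"
    "\<And>\<alpha> x. \<alpha> \<in> arcs Q \<Longrightarrow> x \<in> W (src \<alpha>) \<Longrightarrow> \<psi>' \<alpha> x = \<psi> \<alpha> x"
    "\<And>\<alpha> x. \<alpha> \<in> arcs Q \<Longrightarrow> x \<in> U (src \<alpha>) \<Longrightarrow> \<psi>' \<alpha> x = \<zero>\<^bsub>A\<^esub>" by metis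
  obtain \<phi> where \<phi>: "\<And>i. i \<in> verts Q \<Longrightarrow> \<phi> i \<in> lin (V i) (M i)"
    "\<And>i x. i \<in> verts Q \<Longrightarrow> x \<in> U i \<Longrightarrow> \<phi> i x = \<zero>\<^bsub>A\<^esub>"
    "\<And>\<alpha> x. \<alpha> \<in> arcs Q \<Longrightarrow> x \<in> V (src \<alpha>) \<Longrightarrow> delta N \<phi> \<alpha> x = \<psi>' \<alpha> x"
    using ext_zeroE[OF \<open>ext_zero V U N\<close> \<psi>'(1,3)] by blast
  define \<theta> where "\<theta> = (\<lambda>i. restrict (\<phi> i) (W i))"
  have "\<theta> i \<in> lin (W i) (M i)" if "i \<in> verts Q" for i
    unfolding \<theta>_def by (rule lin_restrict[OF \<phi>(1)[OF that]]) (use subfamD[OF W(1) that] in auto)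
  moreover have "\<theta> i x = \<zero>\<^bsub>A\<^esub>" if "i \<in> verts Q" "x \<in> W i \<inter> U i" for i x
    using that \<phi>(2) by (simp add: \<theta>_def)
  moreover have "delta N \<theta> \<alpha> x = \<psi> \<alpha> x" if "\<alpha> \<in> arcs Q" "x \<in> W (src \<alpha>)" for \<alpha> x
  proof -
    have "N \<alpha> x \<in> W (tgt \<alpha>)" using W(2) that by (auto simp: stable_def)
    then have "delta N \<theta> \<alpha> x = delta N \<phi> \<alpha> x" using that by (simp add: delta_def \<theta>_def)
    moreover have "x \<in> V (src \<alpha>)" using subfam_in[OF W(1)] that by simp
    ultimately show ?thesis using \<phi>(3) \<psi>'(2) that by simp
  qed
  ultimately show "\<exists>\<phi>. (\<forall>i\<in>verts Q. \<phi> i \<in> lin (W i) (M i) \<and> (\<forall>x\<in>W i \<inter> U i. \<phi> i x = \<zero>\<^bsub>A\<^esub>)) \<and>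
       (\<forall>\<alpha>\<in>arcs Q. \<forall>x\<in>W (src \<alpha>). delta N \<phi> \<alpha> x = \<psi> \<alpha> x)" by blast
qed

lemma ext_zero_sub:
  assumes "gspace V" "acts V N" "subfam W V" "stable W N" "ext_zero V zero_fam N"
  shows "ext_zero W zero_fam N"
proof -
  have "ext_zero W (\<lambda>i. W i \<inter> zero_fam i) N"
    using ext_zero_Int[OF assms(1,2) subfam_zero[OF assms(1)] assms(3,4,5)] .
  moreover have "\<forall>i\<in>verts Q. W i \<inter> zero_fam i = zero_fam i"
    using subfam_zero[OF subfam_gspace[OF assms(3,1)]] by (auto simp: subfam_def)
  ultimately show ?thesis unfolding ext_zero_def by simp
qed

text \<open>Take \<open>W\<close> smallest with \<open>Ext\<^sup>1(V/W, M) = 0\<close>. By closure under extensions, a quotient of \<open>W\<close> in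
  the class would give a smaller one.\<close>

lemma ex_torsion_sub:
  assumes V: "gspace V" and N: "acts V N"
  shows "\<exists>W. subfam W V \<and> stable W N \<and> ext_zero V W N \<and> torsion W N"
proof -
  let ?P = "\<lambda>W. subfam W V \<and> stable W N \<and> ext_zero V W N"
  let ?c = "\<lambda>W. \<Sum>i\<in>verts Q. card (W i)"
  have "?P V" using subfam_refl[OF V] acts_stable[OF N] ext_zero_self[OF V N] by blast
  from ex_has_least_nat[where P = ?P and m = ?c, OF this]
  obtain W where W: "?P W" and min: "\<And>U. ?P U \<Longrightarrow> ?c W \<le> ?c U" by blast
  have "torsion W N"
    unfolding torsion_def
  proof (intro allI impI, elim conjE)
    fix U assume U: "subfam U W" "stable U N" "ext_zero W U N"
    have "?P U" using U W ext_zero_trans[OF V N] subfam_trans by blast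
    then have le: "?c W \<le> ?c U" by (rule min)
    have fin: "finite (W i)" if "i \<in> verts Q" for i
      using gspaceD(2)[OF subfam_gspace[OF _ V]] W that by blast
    show "\<forall>i\<in>verts Q. U i = W i"
    proof (rule ccontr)
      assume "\<not> (\<forall>i\<in>verts Q. U i = W i)"
      then obtain i where i: "i \<in> verts Q" "U i \<noteq> W i" by blast
      have "?c U < ?c W"
        by (rule sum_strict_mono_ex1)
          (use i fin subfamD(2)[OF U(1)] in \<open>auto intro!: card_mono bexI[of _ i] psubset_card_mono\<close>)
      with le show False by simp
    qed
  qed
  with W show ?thesis by blast
qed

text \<open>\<open>W/(W \<inter> W')\<close> embeds into \<open>V/W'\<close> and hence is in the class; as \<open>W\<close> is torsion, \<open>W \<subseteq> W'\<close>.\<close>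

lemma torsion_sub_unique:
  assumes V: "gspace V" and N: "acts V N"
    and W: "subfam W V" "stable W N" "ext_zero V W N" "torsion W N"
    and W': "subfam W' V" "stable W' N" "ext_zero V W' N" "torsion W' N"
    and i: "i \<in> verts Q"
  shows "W i = W' i"
proof -
  have *: "\<forall>i\<in>verts Q. W i \<inter> U i = W i"
    if "subfam W V" "stable W N" "torsion W N" "subfam U V" "stable U N" "ext_zero V U N" for W U
    using that(3) ext_zero_Int[OF V N that(4,1,2,6)] subfam_Int[OF that(4,1)] stable_Int[OF that(5,2)]
    unfolding torsion_def by blast
  have "W i \<inter> W' i = W i" "W' i \<inter> W i = W' i" using *[of W W'] *[of W' W] W W' i by blast+
  then show ?thesis by blast
qed

lemma homsD:
  assumes "h \<in> homs V N"
  shows "i \<in> verts Q \<Longrightarrow> h i \<in> lin (V i) (M i)"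
    "\<alpha> \<in> arcs Q \<Longrightarrow> x \<in> V (src \<alpha>) \<Longrightarrow> h (tgt \<alpha>) (N \<alpha> x) = m \<alpha> (h (src \<alpha>) x)"
  using assms by (auto simp: homs_def)

abbreviation ker :: "('v \<Rightarrow> 'b set) \<Rightarrow> ('v \<Rightarrow> 'b \<Rightarrow> 'b) \<Rightarrow> 'v \<Rightarrow> 'b set" where
  "ker V h \<equiv> (\<lambda>i. {x \<in> V i. h i x = \<zero>\<^bsub>A\<^esub>})"

lemma ker_subfam:
  assumes "gspace V" "\<And>i. i \<in> verts Q \<Longrightarrow> h i \<in> lin (V i) (M i)"
  shows "subfam (ker V h) V"
  unfolding subfam_def
proof (intro ballI conjI)
  fix i assume i: "i \<in> verts Q"
  show "subspace (ker V h i)"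
    using subspace_kernel[OF assms(2)[OF i] gspaceD(1)[OF assms(1) i] M_spaceD(1)[OF i]] .
qed auto

lemma ker_stable: 
  assumes "acts V N" "h \<in> homs V N" shows "stable (ker V h) N"
  unfolding stable_def
  using acts_closed[OF assms(1)] homsD[OF assms(2)] lin_zero[OF m_lin]
  by (auto simp: M_spaceD)

text \<open>\<open>V/ker h\<close> is a subrepresentation of \<open>M\<close>: families on it extend to \<open>M\<close>, where rigidity makes them
  coboundaries.\<close>

lemma ext_zero_ker:
  assumes V: "gspace V" and N: "acts V N" and h: "h \<in> homs V N"
  shows "ext_zero V (ker V h) N"
proof (rule ext_zeroI)
  fix \<psi> assume \<psi>: "\<And>\<alpha>. \<alpha> \<in> arcs Q \<Longrightarrow> \<psi> \<alpha> \<in> lin (V (src \<alpha>)) (M (tgt \<alpha>))"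
    "\<And>\<alpha> x. \<alpha> \<in> arcs Q \<Longrightarrow> x \<in> ker V h (src \<alpha>) \<Longrightarrow> \<psi> \<alpha> x = \<zero>\<^bsub>A\<^esub>"
  have "\<exists>g. g \<in> lin (M (src \<alpha>)) (M (tgt \<alpha>)) \<and> (\<forall>x\<in>V (src \<alpha>). g (h (src \<alpha>) x) = \<psi> \<alpha> x)"
    if "\<alpha> \<in> arcs Q" for \<alpha>
    by (rule linear_factor[OF homsD(1)[OF h src_in[OF that]] \<psi>(1)[OF that]])
      (use that V \<psi>(2) gspaceD M_spaceD in auto)
  then obtain g where g: "\<And>\<alpha>. \<alpha> \<in> arcs Q \<Longrightarrow> g \<alpha> \<in> lin (M (src \<alpha>)) (M (tgt \<alpha>))"
    "\<And>\<alpha> x. \<alpha> \<in> arcs Q \<Longrightarrow> x \<in> V (src \<alpha>) \<Longrightarrow> g \<alpha> (h (src \<alpha>) x) = \<psi> \<alpha> x" by metis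
  from rigid[OF g(1)] obtain \<phi> where \<phi>: "\<And>i. i \<in> verts Q \<Longrightarrow> \<phi> i \<in> lin (M i) (M i)"
    "\<And>\<alpha> x. \<alpha> \<in> arcs Q \<Longrightarrow> x \<in> M (src \<alpha>) \<Longrightarrow>
        g \<alpha> x = \<phi> (tgt \<alpha>) (m \<alpha> x) \<ominus>\<^bsub>A\<^esub> m \<alpha> (\<phi> (src \<alpha>) x)" by metis
  define \<theta> where "\<theta> = (\<lambda>i. \<lambda>x\<in>V i. \<phi> i (h i x))"
  have "\<theta> i \<in> lin (V i) (M i)" if "i \<in> verts Q" for i
    unfolding \<theta>_def by (rule lin_compose[OF homsD(1)[OF h that] \<phi>(1)[OF that]]) (use that V gspaceD in auto)
  moreover have "\<theta> i x = \<zero>\<^bsub>A\<^esub>" if "i \<in> verts Q" "x \<in> ker V h i" for i x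
    using that lin_zero[OF \<phi>(1)] by (simp add: \<theta>_def M_spaceD)
  moreover have "delta N \<theta> \<alpha> x = \<psi> \<alpha> x" if "\<alpha> \<in> arcs Q" "x \<in> V (src \<alpha>)" for \<alpha> x
  proof -
    have "h (src \<alpha>) x \<in> M (src \<alpha>)" using lin_closed[OF homsD(1)[OF h]] that by simp
    then have "g \<alpha> (h (src \<alpha>) x) = delta N \<theta> \<alpha> x"
      using that acts_closed[OF N that] \<phi>(2) homsD(2)[OF h that] by (simp add: delta_def \<theta>_def)
    then show ?thesis using g(2) that by simp
  qed
  ultimately show "\<exists>\<phi>. (\<forall>i\<in>verts Q. \<phi> i \<in> lin (V i) (M i) \<and> (\<forall>x\<in>ker V h i. \<phi> i x = \<zero>\<^bsub>A\<^esub>)) \<and>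
       (\<forall>\<alpha>\<in>arcs Q. \<forall>x\<in>V (src \<alpha>). delta N \<phi> \<alpha> x = \<psi> \<alpha> x)" by blast
qed

end

context rigid_rep
begin

section \<open>The sign of the Euler form\<close>

text \<open>The Euler form of \<open>V\<close> and \<open>M\<close> is \<open>vert_form V - arc_form V\<close>; the two parts are the dimensions of
  the two terms of the complex.\<close>

definition vert_form :: "('v \<Rightarrow> 'b set) \<Rightarrow> nat" where
  "vert_form V = (\<Sum>i\<in>verts Q. dim (V i) * dim (M i))"

definition arc_form :: "('v \<Rightarrow> 'b set) \<Rightarrow> nat" where
  "arc_form V = (\<Sum>\<alpha>\<in>arcs Q. dim (V (src \<alpha>)) * dim (M (tgt \<alpha>)))"

abbreviation vert_maps :: "('v \<Rightarrow> 'b set) \<Rightarrow> ('v \<Rightarrow> 'b \<Rightarrow> 'b) set" where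
  "vert_maps V \<equiv> PiE (verts Q) (\<lambda>i. lin (V i) (M i))"

abbreviation arc_maps :: "('v \<Rightarrow> 'b set) \<Rightarrow> ('v \<Rightarrow> 'b set) \<Rightarrow> ('e \<Rightarrow> 'b \<Rightarrow> 'b) set" where
  "arc_maps V W \<equiv> PiE (arcs Q) (\<lambda>\<alpha>. lin (V (src \<alpha>)) (W (tgt \<alpha>)))"

lemma gspace_M: "gspace M"
  using M_space by (simp add: gspace_def)

lemma card_vert_maps: "gspace V \<Longrightarrow> card (vert_maps V) = q ^ vert_form V"
  unfolding vert_form_def by (rule card_PiE_lin) (auto simp: gspaceD M_spaceD)

lemma card_arc_maps:
  "gspace V \<Longrightarrow> gspace W \<Longrightarrow> card (arc_maps V W) = q ^ (\<Sum>\<alpha>\<in>arcs Q. dim (V (src \<alpha>)) * dim (W (tgt \<alpha>)))"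
  by (rule card_PiE_lin) (auto simp: gspaceD)

lemma finite_vert_maps: "gspace V \<Longrightarrow> finite (vert_maps V)"
  by (rule finite_PiE) (auto simp: gspaceD M_spaceD finite_lin)

lemma finite_arc_maps: "gspace V \<Longrightarrow> gspace W \<Longrightarrow> finite (arc_maps V W)"
  by (rule finite_PiE) (auto simp: gspaceD finite_lin)

definition Delta :: "('v \<Rightarrow> 'b set) \<Rightarrow> ('e \<Rightarrow> 'b \<Rightarrow> 'b) \<Rightarrow> ('v \<Rightarrow> 'b \<Rightarrow> 'b) \<Rightarrow> 'e \<Rightarrow> 'b \<Rightarrow> 'b" where
  "Delta V N \<phi> = (\<lambda>\<alpha>\<in>arcs Q. \<lambda>x\<in>V (src \<alpha>). delta N \<phi> \<alpha> x)"

lemma Delta_in: 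
  assumes "gspace V" "acts V N" "\<phi> \<in> vert_maps V" shows "Delta V N \<phi> \<in> arc_maps V M"
  unfolding Delta_def using delta_lin[OF assms(1,2), of _ \<phi>] assms(3) by auto

lemma delta_carrier:
  assumes "gspace V" "acts V N" "\<phi> \<in> vert_maps V" "\<alpha> \<in> arcs Q" "x \<in> V (src \<alpha>)"
  shows "delta N \<phi> \<alpha> x \<in> carrier A"
proof -
  have "(\<lambda>x\<in>V (src \<alpha>). delta N \<phi> \<alpha> x) x \<in> M (tgt \<alpha>)"
    by (rule lin_closed[OF delta_lin[OF assms(1,2,4)] assms(5)]) (use assms(3) in auto)
  then show ?thesis using assms(4,5) subspace_carrier[OF M_spaceD(1)[of "tgt \<alpha>"]] by simp
qed

lemma homs_iff_delta:
  assumes "gspace V" "acts V N" "h \<in> vert_maps V"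
  shows "h \<in> homs V N \<longleftrightarrow> (\<forall>\<alpha>\<in>arcs Q. \<forall>x\<in>V (src \<alpha>). delta N h \<alpha> x = \<zero>\<^bsub>A\<^esub>)"
proof -
  have "delta N h \<alpha> x = \<zero>\<^bsub>A\<^esub> \<longleftrightarrow> h (tgt \<alpha>) (N \<alpha> x) = m \<alpha> (h (src \<alpha>) x)"
    if a: "\<alpha> \<in> arcs Q" and x: "x \<in> V (src \<alpha>)" for \<alpha> x
  proof -
    have h: "h i \<in> lin (V i) (M i)" if "i \<in> verts Q" for i using assms(3) that by auto
    have "h (tgt \<alpha>) (N \<alpha> x) \<in> carrier A" "m \<alpha> (h (src \<alpha>) x) \<in> carrier A"
      using lin_closed[OF h acts_closed[OF assms(2) a x]] lin_closed[OF m_lin[OF a] lin_closed[OF h x]]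
        subspace_carrier[OF M_spaceD(1)[of "tgt \<alpha>"]] a by auto
    then show ?thesis unfolding delta_def by (rule minus_eq_zero_iff)
  qed
  then show ?thesis using assms(3) by (auto simp: homs_def)
qed

text \<open>The fibres of the differential are the cosets of its kernel \<open>Hom(N, M)\<close>.\<close>

lemma card_Delta_homs:
  assumes V: "gspace V" and N: "acts V N"
  shows "q ^ vert_form V = card (Delta V N ` vert_maps V) * card (homs V N)"
  unfolding card_vert_maps[OF V, symmetric]
proof (rule card_constant_fibres[OF finite_vert_maps[OF V]])
  fix y assume "y \<in> Delta V N ` vert_maps V"
  then obtain \<phi>0 where \<phi>0: "\<phi>0 \<in> vert_maps V" "y = Delta V N \<phi>0" by blast
  have l0: "\<phi>0 i \<in> lin (V i) (M i)" if "i \<in> verts Q" for i using \<phi>0 that by auto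
  have car: "\<phi> i x \<in> carrier A" if "\<phi> \<in> vert_maps V" "i \<in> verts Q" "x \<in> V i" for \<phi> i x
  proof -
    have "\<phi> i \<in> lin (V i) (M i)" using that by auto
    then show ?thesis using lin_closed that subspace_carrier[OF M_spaceD(1)] by blast
  qed
  define f where "f h = (\<lambda>i\<in>verts Q. \<lambda>x\<in>V i. h i x \<oplus>\<^bsub>A\<^esub> \<phi>0 i x)" for h
  define g where "g h = (\<lambda>i\<in>verts Q. \<lambda>x\<in>V i. h i x \<ominus>\<^bsub>A\<^esub> \<phi>0 i x)" for h
  have f: "f h \<in> vert_maps V" if "h \<in> vert_maps V" for h
    unfolding f_def using that l0 V by (auto simp: gspaceD M_spaceD intro!: lin_plus)
  have g: "g h \<in> vert_maps V" if "h \<in> vert_maps V" for h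
    unfolding g_def using that l0 V by (auto simp: gspaceD M_spaceD intro!: lin_diff)
  have fg: "f (g h) = h" if "h \<in> vert_maps V" for h
  proof (rule PiE_ext[OF f[OF g[OF that]] that])
    fix i assume i: "i \<in> verts Q"
    have hi: "h i \<in> lin (V i) (M i)" using that i by auto
    show "f (g h) i = h i"
      by (rule extensionalityI[of _ "V i"])
        (use i lin_extensional[OF hi] car[OF that i] car[OF \<phi>0(1) i] in
          \<open>auto simp: f_def g_def M.minus_eq M.a_assoc M.l_neg\<close>)
  qed
  have gf: "g (f h) = h" if "h \<in> vert_maps V" for h
  proof (rule PiE_ext[OF g[OF f[OF that]] that])
    fix i assume i: "i \<in> verts Q"
    have hi: "h i \<in> lin (V i) (M i)" using that i by auto
    show "g (f h) i = h i"
      by (rule extensionalityI[of _ "V i"])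
        (use i lin_extensional[OF hi] car[OF that i] car[OF \<phi>0(1) i] in
          \<open>auto simp: f_def g_def M.minus_eq M.a_assoc M.r_neg\<close>)
  qed
  have delta_f: "delta N (f h) \<alpha> x = delta N h \<alpha> x \<oplus>\<^bsub>A\<^esub> delta N \<phi>0 \<alpha> x"
    if "h \<in> vert_maps V" "\<alpha> \<in> arcs Q" "x \<in> V (src \<alpha>)" for h \<alpha> x
    by (rule delta_add[OF V N that(2,3) _ l0]) (use that in \<open>auto simp: f_def\<close>)
  have Delta_eq: "Delta V N (f h) = y \<longleftrightarrow> h \<in> homs V N" if h: "h \<in> vert_maps V" for h
  proof -
    have "Delta V N (f h) = y \<longleftrightarrow> (\<forall>\<alpha>\<in>arcs Q. \<forall>x\<in>V (src \<alpha>). delta N (f h) \<alpha> x = delta N \<phi>0 \<alpha> x)"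
      unfolding \<phi>0(2) Delta_def by (auto simp: fun_eq_iff restrict_def)
    also have "\<dots> \<longleftrightarrow> (\<forall>\<alpha>\<in>arcs Q. \<forall>x\<in>V (src \<alpha>). delta N h \<alpha> x = \<zero>\<^bsub>A\<^esub>)"
      using delta_f[OF h] delta_carrier[OF V N h] delta_carrier[OF V N \<phi>0(1)] by simp
    finally show ?thesis using homs_iff_delta[OF V N h] by simp
  qed
  have sub: "homs V N \<subseteq> vert_maps V" by (auto simp: homs_def)
  have "bij_betw f (homs V N) {\<phi> \<in> vert_maps V. Delta V N \<phi> = y}"
  proof (rule bij_betwI[where g = g])
    show "f \<in> homs V N \<rightarrow> {\<phi> \<in> vert_maps V. Delta V N \<phi> = y}" using f Delta_eq sub by blast
    show "g \<in> {\<phi> \<in> vert_maps V. Delta V N \<phi> = y} \<rightarrow> homs V N"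
    proof (rule funcsetI, elim CollectE conjE)
      fix h assume "h \<in> vert_maps V" "Delta V N h = y"
      then show "g h \<in> homs V N" using Delta_eq[OF g] fg by simp
    qed
    show "g (f h) = h" if "h \<in> homs V N" for h using gf sub that by blast
    show "f (g h) = h" if "h \<in> {\<phi> \<in> vert_maps V. Delta V N \<phi> = y}" for h using fg that by blast
  qed
  then show "card {\<phi> \<in> vert_maps V. Delta V N \<phi> = y} = card (homs V N)"
    by (rule bij_betw_same_card[symmetric])
qed

lemma ext_zero_iff_Delta_surj:
  assumes V: "gspace V" and N: "acts V N"
  shows "ext_zero V zero_fam N \<longleftrightarrow> Delta V N ` vert_maps V = arc_maps V M"
proof
  assume ext_zero: "ext_zero V zero_fam N"
  have "\<psi> \<in> Delta V N ` vert_maps V" if \<psi>: "\<psi> \<in> arc_maps V M" for \<psi>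
  proof -
    have l: "\<psi> \<alpha> \<in> lin (V (src \<alpha>)) (M (tgt \<alpha>))" if "\<alpha> \<in> arcs Q" for \<alpha> using \<psi> that by auto
    have z: "\<psi> \<alpha> x = \<zero>\<^bsub>A\<^esub>" if "\<alpha> \<in> arcs Q" "x \<in> zero_fam (src \<alpha>)" for \<alpha> x
      using lin_zero[OF l] that V by (simp add: gspaceD M_spaceD)
    obtain \<phi> where \<phi>: "\<And>i. i \<in> verts Q \<Longrightarrow> \<phi> i \<in> lin (V i) (M i)"
      "\<And>i x. i \<in> verts Q \<Longrightarrow> x \<in> zero_fam i \<Longrightarrow> \<phi> i x = \<zero>\<^bsub>A\<^esub>"
      "\<And>\<alpha> x. \<alpha> \<in> arcs Q \<Longrightarrow> x \<in> V (src \<alpha>) \<Longrightarrow> delta N \<phi> \<alpha> x = \<psi> \<alpha> x"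
      by (rule ext_zeroE[OF ext_zero l z]) (assumption | rule that)+
    have r: "restrict \<phi> (verts Q) \<in> vert_maps V" using \<phi>(1) by auto
    moreover have "Delta V N (restrict \<phi> (verts Q)) = \<psi>"
    proof (rule PiE_ext[OF Delta_in[OF V N r] \<psi>])
      fix \<alpha> assume a: "\<alpha> \<in> arcs Q"
      show "Delta V N (restrict \<phi> (verts Q)) \<alpha> = \<psi> \<alpha>"
        by (rule extensionalityI[of _ "V (src \<alpha>)"])
          (use a \<phi>(3) lin_extensional[OF l[OF a]] in \<open>auto simp: Delta_def delta_def\<close>)
    qed
    ultimately show ?thesis by blast
  qed
  then show "Delta V N ` vert_maps V = arc_maps V M" using Delta_in[OF V N] by blast
next
  assume surj: "Delta V N ` vert_maps V = arc_maps V M"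
  show "ext_zero V zero_fam N"
  proof (rule ext_zeroI)
    fix \<psi> assume \<psi>: "\<And>\<alpha>. \<alpha> \<in> arcs Q \<Longrightarrow> \<psi> \<alpha> \<in> lin (V (src \<alpha>)) (M (tgt \<alpha>))"
    then have "restrict \<psi> (arcs Q) \<in> Delta V N ` vert_maps V" unfolding surj by auto
    then obtain \<phi> where \<phi>: "\<phi> \<in> vert_maps V" "restrict \<psi> (arcs Q) = Delta V N \<phi>" by blast
    have l: "\<phi> i \<in> lin (V i) (M i)" if "i \<in> verts Q" for i using \<phi>(1) that by auto
    have "delta N \<phi> \<alpha> x = \<psi> \<alpha> x" if "\<alpha> \<in> arcs Q" "x \<in> V (src \<alpha>)" for \<alpha> x
      using fun_cong[OF fun_cong[OF \<phi>(2), of \<alpha>], of x] that by (simp add: Delta_def)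
    moreover have "\<phi> i x = \<zero>\<^bsub>A\<^esub>" if "i \<in> verts Q" "x \<in> zero_fam i" for i x
      using lin_zero[OF l] that V by (simp add: gspaceD M_spaceD)
    ultimately show "\<exists>\<phi>. (\<forall>i\<in>verts Q. \<phi> i \<in> lin (V i) (M i) \<and> (\<forall>x\<in>zero_fam i. \<phi> i x = \<zero>\<^bsub>A\<^esub>)) \<and>
       (\<forall>\<alpha>\<in>arcs Q. \<forall>x\<in>V (src \<alpha>). delta N \<phi> \<alpha> x = \<psi> \<alpha> x)" using l by blast
  qed
qed

lemma card_arc_maps_M: "gspace V \<Longrightarrow> card (arc_maps V M) = q ^ arc_form V"
  unfolding arc_form_def by (rule card_arc_maps[OF _ gspace_M])

lemma ext_zero_card_homs:
  assumes V: "gspace V" and N: "acts V N" and ext_zero: "ext_zero V zero_fam N"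
  shows "q ^ vert_form V = q ^ arc_form V * card (homs V N)"
  using card_Delta_homs[OF V N] ext_zero card_arc_maps_M[OF V] by (simp add: ext_zero_iff_Delta_surj[OF V N])

lemma ext_zero_euler_nonneg:
  assumes "gspace V" "acts V N" "ext_zero V zero_fam N"
  shows "arc_form V \<le> vert_form V"
proof -
  have eq: "q ^ vert_form V = q ^ arc_form V * card (homs V N)" by (rule ext_zero_card_homs[OF assms])
  have "q ^ vert_form V \<noteq> 0" using q_ge_2 by simp
  then have "card (homs V N) \<noteq> 0" using eq by (metis mult_0_right)
  then have "q ^ arc_form V \<le> q ^ vert_form V" unfolding eq by simp
  then show ?thesis using q_ge_2 by (simp add: power_increasing_iff[of q])
qed

text \<open>For \<open>h : V \<rightarrow> M\<close>, the quotient \<open>V/ker h\<close> is in the torsion-free class, so the kernel of \<open>h\<close> is all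
  of \<open>V\<close>.\<close>

lemma torsion_homs:
  assumes V: "gspace V" and N: "acts V N" and tors: "torsion V N"
  shows "card (homs V N) = 1"
proof -
  have "h = (\<lambda>i\<in>verts Q. \<lambda>x\<in>V i. \<zero>\<^bsub>A\<^esub>)" if h: "h \<in> homs V N" for h
  proof -
    have "ker V h i = V i" if "i \<in> verts Q" for i
      using tors ext_zero_ker[OF V N h] ker_stable[OF N h] ker_subfam[OF V homsD(1)[OF h]] that
      unfolding torsion_def by blast
    then have z: "h i x = \<zero>\<^bsub>A\<^esub>" if "i \<in> verts Q" "x \<in> V i" for i x using that by blast
    have ext: "h \<in> extensional (verts Q)" "\<And>i. i \<in> verts Q \<Longrightarrow> h i \<in> extensional (V i)"
      using h lin_extensional[OF homsD(1)[OF h]] by (auto simp: homs_def PiE_def)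
    show ?thesis
    proof (rule extensionalityI[OF ext(1)])
      fix i assume i: "i \<in> verts Q"
      show "h i = (\<lambda>i\<in>verts Q. \<lambda>x\<in>V i. \<zero>\<^bsub>A\<^esub>) i"
        by (rule extensionalityI[OF ext(2)[OF i]]) (use i z in auto)
    qed simp
  qed
  moreover have "(\<lambda>i\<in>verts Q. \<lambda>x\<in>V i. \<zero>\<^bsub>A\<^esub>) \<in> homs V N"
    using acts_closed[OF N] lin_zero[OF m_lin] lin_zero_map V
    by (auto simp: homs_def gspaceD M_spaceD)
  ultimately have "homs V N = {\<lambda>i\<in>verts Q. \<lambda>x\<in>V i. \<zero>\<^bsub>A\<^esub>}" by blast
  then show ?thesis by simp
qed

text \<open>As \<open>Hom(V, M) = 0\<close>, the differential is injective. If the Euler form were not negative, it would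
  also be surjective, and \<open>V\<close> would be both torsion and torsion-free.\<close>

lemma torsion_euler_neg:
  assumes V: "gspace V" and N: "acts V N" and tors: "torsion V N"
    and nz: "i \<in> verts Q" "V i \<noteq> {\<zero>\<^bsub>A\<^esub>}"
  shows "vert_form V < arc_form V"
proof (rule ccontr)
  assume "\<not> vert_form V < arc_form V"
  then have "q ^ arc_form V \<le> q ^ vert_form V"
    using q_ge_2 by (intro power_increasing) auto
  also have "\<dots> = card (Delta V N ` vert_maps V)"
    using card_Delta_homs[OF V N] torsion_homs[OF V N tors] by simp
  finally have "card (arc_maps V M) \<le> card (Delta V N ` vert_maps V)"
    by (simp add: card_arc_maps_M[OF V])
  then have "Delta V N ` vert_maps V = arc_maps V M"
    using Delta_in[OF V N] finite_arc_maps[OF V gspace_M]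
    by (intro card_seteq) auto
  then have "ext_zero V zero_fam N" using ext_zero_iff_Delta_surj[OF V N] by blast
  then have "zero_fam i = V i"
    using tors subfam_zero[OF V] stable_zero[OF N V] nz(1) unfolding torsion_def by blast
  with nz(2) show False by simp
qed

subsection \<open>Counting module structures\<close>

lemma stableD: "stable W N \<Longrightarrow> \<alpha> \<in> arcs Q \<Longrightarrow> x \<in> W (src \<alpha>) \<Longrightarrow> N \<alpha> x \<in> W (tgt \<alpha>)"
  by (auto simp: stable_def image_subset_iff)

lemma ext_zero_cong:
  assumes "\<And>\<alpha> x. \<alpha> \<in> arcs Q \<Longrightarrow> x \<in> V (src \<alpha>) \<Longrightarrow> N \<alpha> x = N' \<alpha> x"
  shows "ext_zero V W N \<longleftrightarrow> ext_zero V W N'"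
  unfolding ext_zero_def delta_def using assms by simp

lemma ext_zero_fam_cong:
  assumes "\<And>i. i \<in> verts Q \<Longrightarrow> W i = W' i"
  shows "ext_zero V W N \<longleftrightarrow> ext_zero V W' N"
  unfolding ext_zero_def using assms by simp

lemma stable_fam_cong:
  assumes "\<And>i. i \<in> verts Q \<Longrightarrow> W i = W' i"
  shows "stable W N \<longleftrightarrow> stable W' N"
  unfolding stable_def using assms by simp

lemma stable_cong:
  assumes "\<And>\<alpha> x. \<alpha> \<in> arcs Q \<Longrightarrow> x \<in> W (src \<alpha>) \<Longrightarrow> N \<alpha> x = N' \<alpha> x"
  shows "stable W N \<longleftrightarrow> stable W N'"
  unfolding stable_def using assms by (auto simp: image_subset_iff)

lemma torsion_cong:
  assumes "\<And>\<alpha> x. \<alpha> \<in> arcs Q \<Longrightarrow> x \<in> W (src \<alpha>) \<Longrightarrow> N \<alpha> x = N' \<alpha> x"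
  shows "torsion W N \<longleftrightarrow> torsion W N'"
proof -
  have "stable U N \<longleftrightarrow> stable U N'" if "subfam U W" for U
    by (rule stable_cong) (use assms subfam_in[OF that] in simp)
  moreover have "ext_zero W U N \<longleftrightarrow> ext_zero W U N'" for U by (rule ext_zero_cong) (rule assms)
  ultimately show ?thesis unfolding torsion_def by blast
qed

abbreviation structures :: "('v \<Rightarrow> 'b set) \<Rightarrow> ('e \<Rightarrow> 'b \<Rightarrow> 'b) set" where
  "structures V \<equiv> arc_maps V V"

definition ext_zero_structures :: "('v \<Rightarrow> 'b set) \<Rightarrow> ('e \<Rightarrow> 'b \<Rightarrow> 'b) set" where
  "ext_zero_structures V = {N \<in> structures V. ext_zero V zero_fam N}"

definition torsion_structures :: "('v \<Rightarrow> 'b set) \<Rightarrow> ('e \<Rightarrow> 'b \<Rightarrow> 'b) set" where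
  "torsion_structures V = {N \<in> structures V. torsion V N}"

lemma structures_acts: "N \<in> structures V \<Longrightarrow> acts V N"
  unfolding acts_def
proof
  fix \<alpha> assume N: "N \<in> structures V" and a: "\<alpha> \<in> arcs Q"
  then have l: "N \<alpha> \<in> lin (V (src \<alpha>)) (V (tgt \<alpha>))" by auto
  then have "restrict (N \<alpha>) (V (src \<alpha>)) = N \<alpha>" using lin_extensional extensional_restrict by blast
  with l show "restrict (N \<alpha>) (V (src \<alpha>)) \<in> lin (V (src \<alpha>)) (V (tgt \<alpha>))" by simp
qed

context
  fixes V W :: "'v \<Rightarrow> 'b set" and p :: "'v \<Rightarrow> 'b \<Rightarrow> 'b"
  assumes V: "gspace V" and W: "subfam W V"
    and p: "\<And>i. i \<in> verts Q \<Longrightarrow> projection (V i) (W i) (p i)"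
begin

abbreviation C where "C \<equiv> (\<lambda>i. p i ` V i)"

text \<open>The structure on \<open>W\<close>, the structure on \<open>C \<cong> V/W\<close>, and the cocycle that glues them.\<close>

definition blocks where
  "blocks N = (\<lambda>\<alpha>\<in>arcs Q. restrict (N \<alpha>) (W (src \<alpha>)),
    \<lambda>\<alpha>\<in>arcs Q. \<lambda>x\<in>C (src \<alpha>). p (tgt \<alpha>) (N \<alpha> x),
    \<lambda>\<alpha>\<in>arcs Q. \<lambda>x\<in>C (src \<alpha>). N \<alpha> x \<ominus>\<^bsub>A\<^esub> p (tgt \<alpha>) (N \<alpha> x))"

lemma vert_facts:
  assumes "i \<in> verts Q"
  shows "subspace (V i)" "finite (V i)" "subspace (W i)" "W i \<subseteq> V i" "projection (V i) (W i) (p i)"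
  using assms V W p by (auto simp: gspaceD subfamD)

lemma bij_blocks:
  "bij_betw blocks {N \<in> structures V. stable W N} (structures W \<times> structures C \<times> arc_maps C W)"
proof -
  have eq: "{N \<in> structures V. stable W N} =
     PiE (arcs Q) (\<lambda>\<alpha>. {f \<in> lin (V (src \<alpha>)) (V (tgt \<alpha>)). f ` W (src \<alpha>) \<subseteq> W (tgt \<alpha>)})"
    by (auto simp: stable_def PiE_iff extensional_def image_subset_iff)
  show ?thesis
    unfolding eq blocks_def
    by (rule bij_betw_PiE_Times, rule block_bij) (simp_all add: vert_facts)
qed

lemma gspace_C: "gspace C"
  unfolding gspace_def using subspace_complement[OF vert_facts] vert_facts(2) by blast

lemma dim_C: "i \<in> verts Q \<Longrightarrow> dim (W i) + dim (C i) = dim (V i)"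
  using dim_complement[of "V i" "W i" "p i"] vert_facts by simp

lemma C_in: "i \<in> verts Q \<Longrightarrow> x \<in> C i \<Longrightarrow> x \<in> V i"
  using complement_subset[OF vert_facts] by blast

lemma ext_zero_quotient_iff:
  assumes N: "N \<in> structures V" "stable W N"
  shows "ext_zero V W N \<longleftrightarrow> ext_zero C zero_fam (fst (snd (blocks N)))"
proof -
  note N' = structures_acts[OF N(1)]
  define S where "S = fst (snd (blocks N))"
  have S: "S \<alpha> x = p (tgt \<alpha>) (N \<alpha> x)" if "\<alpha> \<in> arcs Q" "x \<in> C (src \<alpha>)" for \<alpha> x
    using that by (simp add: S_def blocks_def)
  have NC: "N \<alpha> x \<in> V (tgt \<alpha>)" if "\<alpha> \<in> arcs Q" "x \<in> C (src \<alpha>)" for \<alpha> x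
    using acts_closed[OF N' that(1)] C_in[OF src_in[OF that(1)] that(2)] by blast
  have NV: "N \<alpha> x \<in> V (tgt \<alpha>)" if "\<alpha> \<in> arcs Q" "x \<in> V (src \<alpha>)" for \<alpha> x
    using acts_closed[OF N' that] .
  have pN: "p (tgt \<alpha>) (N \<alpha> (p (src \<alpha>) x)) = p (tgt \<alpha>) (N \<alpha> x)"
    if a: "\<alpha> \<in> arcs Q" and x: "x \<in> V (src \<alpha>)" for \<alpha> x
  proof -
    note vs = vert_facts[OF src_in[OF a]] and vt = vert_facts[OF tgt_in[OF a]]
    have l: "(\<lambda>x\<in>V (src \<alpha>). p (tgt \<alpha>) (N \<alpha> x)) \<in> lin (V (src \<alpha>)) (V (tgt \<alpha>))"
      by (rule lin_compose_restrict[OF actsD[OF N' a] projection_lin[OF vt] vs(1)])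
    have "(\<lambda>x\<in>V (src \<alpha>). p (tgt \<alpha>) (N \<alpha> x)) (p (src \<alpha>) x) = (\<lambda>x\<in>V (src \<alpha>). p (tgt \<alpha>) (N \<alpha> x)) x"
    proof (rule lin_vanishing_projection[OF vs l vt(1) _ x])
      fix w assume w: "w \<in> W (src \<alpha>)"
      then have "w \<in> V (src \<alpha>)" "N \<alpha> w \<in> W (tgt \<alpha>)" "N \<alpha> w \<in> V (tgt \<alpha>)"
        using vs(4) vt(4) stableD[OF N(2) a w] w by auto
      then show "(\<lambda>x\<in>V (src \<alpha>). p (tgt \<alpha>) (N \<alpha> x)) w = \<zero>\<^bsub>A\<^esub>"
        using projection_kernel[OF vt] by simp
    qed
    then show ?thesis using x projection_closed[OF vs x] by simp
  qed
  show ?thesis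
    unfolding S_def[symmetric]
  proof
    assume ext_zero: "ext_zero V W N"
    show "ext_zero C zero_fam S"
    proof (rule ext_zeroI)
      fix \<psi> assume \<psi>: "\<And>\<alpha>. \<alpha> \<in> arcs Q \<Longrightarrow> \<psi> \<alpha> \<in> lin (C (src \<alpha>)) (M (tgt \<alpha>))"
      define \<psi>' where "\<psi>' = (\<lambda>\<alpha>. \<lambda>x\<in>V (src \<alpha>). \<psi> \<alpha> (p (src \<alpha>) x))"
      have 1: "\<psi>' \<alpha> \<in> lin (V (src \<alpha>)) (M (tgt \<alpha>))" if "\<alpha> \<in> arcs Q" for \<alpha>
        unfolding \<psi>'_def by (rule lin_projection[OF vert_facts[OF src_in[OF that]] \<psi>[OF that]])
      have 2: "\<psi>' \<alpha> x = \<zero>\<^bsub>A\<^esub>" if "\<alpha> \<in> arcs Q" "x \<in> W (src \<alpha>)" for \<alpha> x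
      proof -
        note v = vert_facts[OF src_in[OF that(1)]]
        have "x \<in> V (src \<alpha>)" "p (src \<alpha>) x = \<zero>\<^bsub>A\<^esub>" using v(4) that projection_kernel[OF v] by auto
        then show ?thesis
          using lin_zero[OF \<psi>[OF that(1)]] subspace_complement[OF v] that(1) by (simp add: \<psi>'_def M_spaceD)
      qed
      obtain \<phi> where \<phi>: "\<And>i. i \<in> verts Q \<Longrightarrow> \<phi> i \<in> lin (V i) (M i)"
        "\<And>i x. i \<in> verts Q \<Longrightarrow> x \<in> W i \<Longrightarrow> \<phi> i x = \<zero>\<^bsub>A\<^esub>"
        "\<And>\<alpha> x. \<alpha> \<in> arcs Q \<Longrightarrow> x \<in> V (src \<alpha>) \<Longrightarrow> delta N \<phi> \<alpha> x = \<psi>' \<alpha> x"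
        by (rule ext_zeroE[OF ext_zero 1 2]) (assumption | rule that)+
      define \<theta> where "\<theta> = (\<lambda>i. restrict (\<phi> i) (C i))"
      have "\<theta> i \<in> lin (C i) (M i)" if "i \<in> verts Q" for i
        unfolding \<theta>_def
        by (rule lin_restrict[OF \<phi>(1)[OF that] subspace_complement[OF vert_facts[OF that]]
            complement_subset[OF vert_facts[OF that]]])
      moreover have "\<theta> i x = \<zero>\<^bsub>A\<^esub>" if "i \<in> verts Q" "x \<in> zero_fam i" for i x
        using that gspaceD(1)[OF gspace_C that(1)] lin_zero[OF \<phi>(1)[OF that(1)]] vert_facts(1)[OF that(1)]
        by (simp add: \<theta>_def subspace_zero M_spaceD)
      moreover have "delta S \<theta> \<alpha> x = \<psi> \<alpha> x" if a: "\<alpha> \<in> arcs Q" and x: "x \<in> C (src \<alpha>)" for \<alpha> x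
      proof -
        note vs = vert_facts[OF src_in[OF a]] and vt = vert_facts[OF tgt_in[OF a]]
        have "\<phi> (tgt \<alpha>) (p (tgt \<alpha>) (N \<alpha> x)) = \<phi> (tgt \<alpha>) (N \<alpha> x)"
          by (rule lin_vanishing_projection[OF vt \<phi>(1) _ \<phi>(2) NC[OF a x]]) (use a M_spaceD in auto)
        then have "delta S \<theta> \<alpha> x = delta N \<phi> \<alpha> x"
          using a x NC[OF a x] by (simp add: delta_def \<theta>_def S)
        also have "\<dots> = \<psi>' \<alpha> x" using \<phi>(3)[OF a] C_in a x by simp
        also have "\<dots> = \<psi> \<alpha> x"
          using C_in[OF src_in[OF a] x] projection_fixes[OF vs x] by (simp add: \<psi>'_def)
        finally show ?thesis .
      qed
      ultimately show "\<exists>\<phi>. (\<forall>i\<in>verts Q. \<phi> i \<in> lin (C i) (M i) \<and> (\<forall>x\<in>zero_fam i. \<phi> i x = \<zero>\<^bsub>A\<^esub>)) \<and>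
         (\<forall>\<alpha>\<in>arcs Q. \<forall>x\<in>C (src \<alpha>). delta S \<phi> \<alpha> x = \<psi> \<alpha> x)" by blast
    qed
  next
    assume ext_zero: "ext_zero C zero_fam S"
    show "ext_zero V W N"
    proof (rule ext_zeroI)
      fix \<psi> assume \<psi>: "\<And>\<alpha>. \<alpha> \<in> arcs Q \<Longrightarrow> \<psi> \<alpha> \<in> lin (V (src \<alpha>)) (M (tgt \<alpha>))"
        "\<And>\<alpha> x. \<alpha> \<in> arcs Q \<Longrightarrow> x \<in> W (src \<alpha>) \<Longrightarrow> \<psi> \<alpha> x = \<zero>\<^bsub>A\<^esub>"
      have 1: "restrict (\<psi> \<alpha>) (C (src \<alpha>)) \<in> lin (C (src \<alpha>)) (M (tgt \<alpha>))" if "\<alpha> \<in> arcs Q" for \<alpha>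
        by (rule lin_restrict[OF \<psi>(1)[OF that] subspace_complement[OF vert_facts[OF src_in[OF that]]]
            complement_subset[OF vert_facts[OF src_in[OF that]]]])
      have 2: "restrict (\<psi> \<alpha>) (C (src \<alpha>)) x = \<zero>\<^bsub>A\<^esub>" if "\<alpha> \<in> arcs Q" "x \<in> zero_fam (src \<alpha>)" for \<alpha> x
        using lin_zero[OF 1[OF that(1)]] that gspaceD(1)[OF gspace_C src_in[OF that(1)]] by (simp add: M_spaceD)
      obtain \<phi> where \<phi>: "\<And>i. i \<in> verts Q \<Longrightarrow> \<phi> i \<in> lin (C i) (M i)"
        "\<And>i x. i \<in> verts Q \<Longrightarrow> x \<in> zero_fam i \<Longrightarrow> \<phi> i x = \<zero>\<^bsub>A\<^esub>"
        "\<And>\<alpha> x. \<alpha> \<in> arcs Q \<Longrightarrow> x \<in> C (src \<alpha>) \<Longrightarrow> delta S \<phi> \<alpha> x = restrict (\<psi> \<alpha>) (C (src \<alpha>)) x"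
        by (rule ext_zeroE[OF ext_zero 1 2]) (assumption | rule that)+
      define \<theta> where "\<theta> = (\<lambda>i. \<lambda>x\<in>V i. \<phi> i (p i x))"
      have "\<theta> i \<in> lin (V i) (M i)" if "i \<in> verts Q" for i
        unfolding \<theta>_def by (rule lin_projection[OF vert_facts[OF that] \<phi>(1)[OF that]])
      moreover have "\<theta> i x = \<zero>\<^bsub>A\<^esub>" if "i \<in> verts Q" "x \<in> W i" for i x
      proof -
        note v = vert_facts[OF that(1)]
        have "x \<in> V i" "p i x = \<zero>\<^bsub>A\<^esub>" using v(4) that projection_kernel[OF v] by auto
        then show ?thesis
          using lin_zero[OF \<phi>(1)[OF that(1)]] subspace_complement[OF v] that(1) by (simp add: \<theta>_def M_spaceD)
      qed
      moreover have "delta N \<theta> \<alpha> x = \<psi> \<alpha> x" if a: "\<alpha> \<in> arcs Q" and x: "x \<in> V (src \<alpha>)" for \<alpha> x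
      proof -
        note vs = vert_facts[OF src_in[OF a]] and vt = vert_facts[OF tgt_in[OF a]]
        have px: "p (src \<alpha>) x \<in> C (src \<alpha>)" using x by blast
        have "\<psi> \<alpha> x = \<psi> \<alpha> (p (src \<alpha>) x)"
          by (rule lin_vanishing_projection[OF vs \<psi>(1)[OF a] _ \<psi>(2)[OF a] x, symmetric]) (use a M_spaceD in auto)
        also have "\<dots> = delta S \<phi> \<alpha> (p (src \<alpha>) x)" using \<phi>(3)[OF a px] px by simp
        also have "\<dots> = delta N \<theta> \<alpha> x"
          using a x px NV[OF a x] by (simp add: delta_def \<theta>_def S pN)
        finally show ?thesis by simp
      qed
      ultimately show "\<exists>\<phi>. (\<forall>i\<in>verts Q. \<phi> i \<in> lin (V i) (M i) \<and> (\<forall>x\<in>W i. \<phi> i x = \<zero>\<^bsub>A\<^esub>)) \<and>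
         (\<forall>\<alpha>\<in>arcs Q. \<forall>x\<in>V (src \<alpha>). delta N \<phi> \<alpha> x = \<psi> \<alpha> x)" by blast
    qed
  qed
qed

text \<open>Whether \<open>W\<close> is the torsion part depends on the two diagonal blocks only.\<close>

lemma card_torsion_stratum:
  "card {N \<in> structures V. stable W N \<and> ext_zero V W N \<and> torsion W N} =
     card (torsion_structures W) * card (ext_zero_structures C) *
       q ^ (\<Sum>\<alpha>\<in>arcs Q. dim (C (src \<alpha>)) * dim (W (tgt \<alpha>)))"
proof -
  let ?T = "structures W \<times> structures C \<times> arc_maps C W"
  have "bij_betw blocks {N \<in> {N \<in> structures V. stable W N}. ext_zero V W N \<and> torsion W N}
     {z \<in> ?T. ext_zero C zero_fam (fst (snd z)) \<and> torsion W (fst z)}"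
  proof (rule bij_betw_Collect[OF bij_blocks])
    fix N assume N: "N \<in> {N \<in> structures V. stable W N}"
    have "torsion W N \<longleftrightarrow> torsion W (fst (blocks N))"
      by (rule torsion_cong) (simp add: blocks_def)
    then show "ext_zero V W N \<and> torsion W N \<longleftrightarrow> ext_zero C zero_fam (fst (snd (blocks N))) \<and> torsion W (fst (blocks N))"
      using ext_zero_quotient_iff N by simp
  qed
  then have "card {N \<in> structures V. stable W N \<and> ext_zero V W N \<and> torsion W N} =
     card {z \<in> ?T. ext_zero C zero_fam (fst (snd z)) \<and> torsion W (fst z)}"
    using bij_betw_same_card by (simp add: conj_assoc)
  also have "{z \<in> ?T. ext_zero C zero_fam (fst (snd z)) \<and> torsion W (fst z)} =
     torsion_structures W \<times> ext_zero_structures C \<times> arc_maps C W"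
    by (auto simp: torsion_structures_def ext_zero_structures_def)
  finally show ?thesis
    by (simp add: card_cartesian_product card_arc_maps[OF gspace_C subfam_gspace[OF W V]])
qed

text \<open>If \<open>h\<close> is a homomorphism for \<open>N\<close>, it identifies \<open>V/W\<close> with its image in \<open>M\<close>, which determines
  the structure on the quotient. The structure on \<open>W\<close> and the cocycle remain free, up to
  \<open>Ext\<^sup>1(W, M) = 0\<close>; the latter is equivalent to \<open>Ext\<^sup>1(V, M) = 0\<close> because the image of \<open>h\<close> is a
  subrepresentation of \<open>M\<close>.\<close>

lemma card_hom_stratum:
  assumes h: "h \<in> vert_maps V" and kernel: "\<And>i. i \<in> verts Q \<Longrightarrow> W i = ker V h i"
    and image: "stable (\<lambda>i. h i ` V i) m"
  shows "card {N \<in> ext_zero_structures V. h \<in> homs V N} =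
    card (ext_zero_structures W) * q ^ (\<Sum>\<alpha>\<in>arcs Q. dim (C (src \<alpha>)) * dim (W (tgt \<alpha>)))"
proof -
  have hl: "h i \<in> lin (V i) (M i)" if "i \<in> verts Q" for i using h that by auto
  define U where "U = (\<lambda>i. h i ` V i)"
  have hp: "h i (p i x) = h i x" if i: "i \<in> verts Q" and x: "x \<in> V i" for i x
    by (rule lin_vanishing_projection[OF vert_facts[OF i] hl[OF i] M_spaceD(1)[OF i] _ x]) (simp add: kernel i)
  define hC where "hC = (\<lambda>i. restrict (h i) (C i))"
  have hC: "hC i \<in> lin (C i) (M i)" if i: "i \<in> verts Q" for i
    unfolding hC_def by (rule lin_restrict[OF hl[OF i] subspace_complement[OF vert_facts[OF i]]
        complement_subset[OF vert_facts[OF i]]])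
  have inj: "inj_on (hC i) (C i)" if i: "i \<in> verts Q" for i
    unfolding lin_inj_on_iff[OF hC[OF i] gspaceD(1)[OF gspace_C i] M_spaceD(1)[OF i]]
  proof (intro ballI impI)
    fix x assume x: "x \<in> C i" "hC i x = \<zero>\<^bsub>A\<^esub>"
    then have "x \<in> W i" using C_in[OF i] kernel[OF i] by (simp add: hC_def)
    then have "p i x = \<zero>\<^bsub>A\<^esub>" using projection_kernel[OF vert_facts[OF i]] C_in[OF i x(1)] by blast
    then show "x = \<zero>\<^bsub>A\<^esub>" using projection_fixes[OF vert_facts[OF i] x(1)] by simp
  qed
  have im: "hC i ` C i = U i" if i: "i \<in> verts Q" for i
  proof
    show "hC i ` C i \<subseteq> U i" using C_in[OF i] by (auto simp: U_def hC_def)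
    show "U i \<subseteq> hC i ` C i"
    proof
      fix y assume "y \<in> U i"
      then obtain x where x: "x \<in> V i" "y = h i x" by (auto simp: U_def)
      then have "y = hC i (p i x)" using hp[OF i x(1)] by (simp add: hC_def)
      with x(1) show "y \<in> hC i ` C i" by blast
    qed
  qed
  define g where "g = (\<lambda>i. \<lambda>y\<in>U i. the_inv_into (C i) (hC i) y)"
  have g: "g i \<in> lin (U i) (C i)" if i: "i \<in> verts Q" for i
    using lin_inverse[OF hC[OF i] inj[OF i] gspaceD(1)[OF gspace_C i]] unfolding im[OF i] g_def .
  have gh: "g i (h i x) = x" if i: "i \<in> verts Q" and x: "x \<in> C i" for i x
    using the_inv_into_f_f[OF inj[OF i] x] x C_in[OF i x] by (simp add: g_def U_def hC_def)
  have hg: "h i (g i y) = y" if i: "i \<in> verts Q" and y: "y \<in> U i" for i y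
  proof -
    have "y \<in> hC i ` C i" unfolding im[OF i] by (rule y)
    then obtain x where x: "x \<in> C i" "y = hC i x" by (rule imageE)
    then have "y = h i x" by (simp add: hC_def)
    then show ?thesis using gh[OF i x(1)] by simp
  qed
  have mU: "m \<alpha> y \<in> U (tgt \<alpha>)" if "\<alpha> \<in> arcs Q" "y \<in> U (src \<alpha>)" for \<alpha> y
    using stableD[OF image that(1)] that(2) unfolding U_def by blast
  define S where "S = (\<lambda>\<alpha>\<in>arcs Q. \<lambda>x\<in>C (src \<alpha>). g (tgt \<alpha>) (m \<alpha> (h (src \<alpha>) x)))"
  have S: "S \<in> structures C"
  proof -
    have "(\<lambda>x\<in>C (src \<alpha>). g (tgt \<alpha>) (m \<alpha> (h (src \<alpha>) x))) \<in> lin (C (src \<alpha>)) (C (tgt \<alpha>))"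
      if a: "\<alpha> \<in> arcs Q" for \<alpha>
    proof -
      note Cs = gspaceD(1)[OF gspace_C src_in[OF a]]
      have "(\<lambda>x\<in>C (src \<alpha>). m \<alpha> (hC (src \<alpha>) x)) \<in> lin (C (src \<alpha>)) (M (tgt \<alpha>))"
        by (rule lin_compose[OF hC[OF src_in[OF a]] m_lin[OF a] Cs])
      then have "(\<lambda>x\<in>C (src \<alpha>). m \<alpha> (hC (src \<alpha>) x)) \<in> lin (C (src \<alpha>)) (U (tgt \<alpha>))"
      proof (rule lin_codomain)
        fix x assume x: "x \<in> C (src \<alpha>)"
        then have "hC (src \<alpha>) x \<in> U (src \<alpha>)" using im[OF src_in[OF a]] by blast
        then show "(\<lambda>x\<in>C (src \<alpha>). m \<alpha> (hC (src \<alpha>) x)) x \<in> U (tgt \<alpha>)" using mU[OF a] x by simp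
      qed
      from lin_compose[OF this g[OF tgt_in[OF a]] Cs]
      have "(\<lambda>x\<in>C (src \<alpha>). g (tgt \<alpha>) ((\<lambda>x\<in>C (src \<alpha>). m \<alpha> (hC (src \<alpha>) x)) x)) \<in> lin (C (src \<alpha>)) (C (tgt \<alpha>))" .
      also have "(\<lambda>x\<in>C (src \<alpha>). g (tgt \<alpha>) ((\<lambda>x\<in>C (src \<alpha>). m \<alpha> (hC (src \<alpha>) x)) x)) =
         (\<lambda>x\<in>C (src \<alpha>). g (tgt \<alpha>) (m \<alpha> (h (src \<alpha>) x)))"
        by (rule restrict_ext) (simp add: hC_def)
      finally show ?thesis .
    qed
    then show ?thesis unfolding S_def by (intro restrict_PiE_iff[THEN iffD2] ballI)
  qed
  let ?T = "structures W \<times> structures C \<times> arc_maps C W"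
  have key: "h \<in> homs V N \<and> ext_zero V zero_fam N \<longleftrightarrow>
      stable W N \<and> fst (snd (blocks N)) = S \<and> ext_zero W zero_fam N" (is "?L \<longleftrightarrow> ?R")
    if N: "N \<in> structures V" for N
  proof
    note N' = structures_acts[OF N]
    assume L: ?L
    have stab: "stable W N" using ker_stable[OF N'] L stable_fam_cong[of W "ker V h" N, OF kernel] by blast
    have "fst (snd (blocks N)) = S"
    proof (rule PiE_ext[OF _ S])
      show "fst (snd (blocks N)) \<in> structures C" using bij_betwE[OF bij_blocks] N stab by (force simp: mem_Times_iff)
      fix \<alpha> assume a: "\<alpha> \<in> arcs Q"
      have "p (tgt \<alpha>) (N \<alpha> x) = g (tgt \<alpha>) (m \<alpha> (h (src \<alpha>) x))" if x: "x \<in> C (src \<alpha>)" for x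
      proof -
        have xV: "x \<in> V (src \<alpha>)" using C_in[OF src_in[OF a] x] .
        have NV: "N \<alpha> x \<in> V (tgt \<alpha>)" by (rule acts_closed[OF N' a xV])
        have "m \<alpha> (h (src \<alpha>) x) = h (tgt \<alpha>) (p (tgt \<alpha>) (N \<alpha> x))"
          using L homsD(2)[of h V N \<alpha> x] a xV hp[OF tgt_in[OF a] NV] by simp
        then show ?thesis using gh[OF tgt_in[OF a], of "p (tgt \<alpha>) (N \<alpha> x)"] NV by simp
      qed
      then show "fst (snd (blocks N)) \<alpha> = S \<alpha>" using a by (auto simp: blocks_def S_def intro: restrict_ext)
    qed
    with stab L ext_zero_sub[OF V N' W] show ?R by blast
  next
    note N' = structures_acts[OF N]
    assume R: ?R
    have "h (tgt \<alpha>) (N \<alpha> x) = m \<alpha> (h (src \<alpha>) x)" if a: "\<alpha> \<in> arcs Q" and x: "x \<in> V (src \<alpha>)" for \<alpha> x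
    proof -
      note vs = vert_facts[OF src_in[OF a]]
      have l: "(\<lambda>x\<in>V (src \<alpha>). h (tgt \<alpha>) (N \<alpha> x)) \<in> lin (V (src \<alpha>)) (M (tgt \<alpha>))"
        by (rule lin_compose_restrict[OF actsD[OF N' a] hl[OF tgt_in[OF a]] vs(1)])
      have px: "p (src \<alpha>) x \<in> C (src \<alpha>)" "p (src \<alpha>) x \<in> V (src \<alpha>)"
        using x projection_closed[OF vs x] by auto
      have NV: "N \<alpha> (p (src \<alpha>) x) \<in> V (tgt \<alpha>)" by (rule acts_closed[OF N' a px(2)])
      have "(\<lambda>x\<in>V (src \<alpha>). h (tgt \<alpha>) (N \<alpha> x)) (p (src \<alpha>) x) = (\<lambda>x\<in>V (src \<alpha>). h (tgt \<alpha>) (N \<alpha> x)) x"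
      proof (rule lin_vanishing_projection[OF vs l _ _ x])
        fix w assume w: "w \<in> W (src \<alpha>)"
        then have "N \<alpha> w \<in> W (tgt \<alpha>)" "w \<in> V (src \<alpha>)" using R stableD[of W N \<alpha> w] a vs(4) w by auto
        then show "(\<lambda>x\<in>V (src \<alpha>). h (tgt \<alpha>) (N \<alpha> x)) w = \<zero>\<^bsub>A\<^esub>" using kernel[OF tgt_in[OF a]] by simp
      qed (use a M_spaceD in auto)
      then have "h (tgt \<alpha>) (N \<alpha> x) = h (tgt \<alpha>) (N \<alpha> (p (src \<alpha>) x))" using x px(2) by simp
      also have "\<dots> = h (tgt \<alpha>) (p (tgt \<alpha>) (N \<alpha> (p (src \<alpha>) x)))" using hp[OF tgt_in[OF a] NV] by simp
      also have "p (tgt \<alpha>) (N \<alpha> (p (src \<alpha>) x)) = fst (snd (blocks N)) \<alpha> (p (src \<alpha>) x)"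
        using a px(1) by (simp add: blocks_def)
      also have "\<dots> = g (tgt \<alpha>) (m \<alpha> (h (src \<alpha>) (p (src \<alpha>) x)))"
        using R a px(1) by (simp add: S_def)
      also have "h (tgt \<alpha>) \<dots> = m \<alpha> (h (src \<alpha>) (p (src \<alpha>) x))"
        by (rule hg[OF tgt_in[OF a] mU[OF a]]) (use px(2) in \<open>simp add: U_def\<close>)
      also have "\<dots> = m \<alpha> (h (src \<alpha>) x)" using hp[OF src_in[OF a] x] by simp
      finally show ?thesis .
    qed
    then have hN: "h \<in> homs V N" using h by (simp add: homs_def)
    have "ext_zero V W N" using ext_zero_ker[OF V N' hN] ext_zero_fam_cong[of W "ker V h" V N, OF kernel] by blast
    then have "ext_zero V zero_fam N"
      using ext_zero_trans[OF V N' W _ subfam_zero[OF subfam_gspace[OF W V]]] R by blast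
    with hN show ?L by blast
  qed
  have bij: "bij_betw blocks {N \<in> {N \<in> structures V. stable W N}. fst (snd (blocks N)) = S \<and> ext_zero W zero_fam N}
     {z \<in> ?T. fst (snd z) = S \<and> ext_zero W zero_fam (fst z)}"
  proof (rule bij_betw_Collect[OF bij_blocks])
    fix N assume N: "N \<in> {N \<in> structures V. stable W N}"
    have "ext_zero W zero_fam N \<longleftrightarrow> ext_zero W zero_fam (fst (blocks N))"
      by (rule ext_zero_cong) (simp add: blocks_def)
    then show "fst (snd (blocks N)) = S \<and> ext_zero W zero_fam N \<longleftrightarrow>
      fst (snd (blocks N)) = S \<and> ext_zero W zero_fam (fst (blocks N))" by simp
  qed
  have eq1: "{N \<in> {N \<in> structures V. stable W N}. fst (snd (blocks N)) = S \<and> ext_zero W zero_fam N} =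
      {N \<in> ext_zero_structures V. h \<in> homs V N}"
    using key by (auto simp: ext_zero_structures_def)
  have eq2: "{z \<in> ?T. fst (snd z) = S \<and> ext_zero W zero_fam (fst z)} = ext_zero_structures W \<times> {S} \<times> arc_maps C W"
    using S by (auto simp: ext_zero_structures_def)
  have "card {N \<in> ext_zero_structures V. h \<in> homs V N} = card (ext_zero_structures W \<times> {S} \<times> arc_maps C W)"
    using bij_betw_same_card[OF bij] unfolding eq1 eq2 .
  then show ?thesis
    by (simp add: card_cartesian_product card_arc_maps[OF gspace_C subfam_gspace[OF W V]])
qed

end

end

context rigid_rep
begin

section \<open>Two counting identities\<close>

definition subfams :: "('v \<Rightarrow> 'b set) \<Rightarrow> ('v \<Rightarrow> 'b set) set" where
  "subfams V = PiE (verts Q) (\<lambda>i. {W. subspace W \<and> W \<subseteq> V i})"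

text \<open>Dimension vectors are extensional, so that they can be compared by equality.\<close>

definition dims :: "('v \<Rightarrow> 'b set) \<Rightarrow> 'v \<Rightarrow> nat" where
  "dims V = (\<lambda>i\<in>verts Q. dim (V i))"

lemma subfams_subfam: "W \<in> subfams V \<Longrightarrow> subfam W V"
  by (auto simp: subfams_def subfam_def)

lemma finite_subfams: "gspace V \<Longrightarrow> finite (subfams V)"
  unfolding subfams_def by (rule finite_PiE) (auto simp: gspaceD)

lemma sum_subfams:
  fixes f :: "('v \<Rightarrow> nat) \<Rightarrow> int"
  assumes V: "gspace V"
  shows "(\<Sum>W\<in>subfams V. f (dims W)) =
    (\<Sum>t\<in>PiE (verts Q) (\<lambda>i. {..dim (V i)}).
      (\<Prod>i\<in>verts Q. poly (gauss_binomial (dim (V i)) (t i)) (int q)) * f t)"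
proof -
  let ?T = "PiE (verts Q) (\<lambda>i. {..dim (V i)})"
  have "(\<Sum>W\<in>subfams V. f (dims W)) = (\<Sum>t\<in>?T. \<Sum>W\<in>{W \<in> subfams V. dims W = t}. f (dims W))"
  proof (rule sum.group[symmetric])
    show "dims ` subfams V \<subseteq> ?T"
    proof (rule image_subsetI)
      fix W assume "W \<in> subfams V"
      then show "dims W \<in> ?T"
        using V subfams_subfam[of W V] by (auto simp: dims_def gspaceD subfamD intro!: dim_mono dest: subfam_in)
    qed
  qed (auto simp: finite_subfams V intro!: finite_PiE)
  also have "\<dots> = (\<Sum>t\<in>?T. (\<Prod>i\<in>verts Q. poly (gauss_binomial (dim (V i)) (t i)) (int q)) * f t)"
  proof (rule sum.cong)
    fix t assume t: "t \<in> ?T"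
    have "{W \<in> subfams V. dims W = t} = PiE (verts Q) (\<lambda>i. grass (V i) (t i))"
    proof (rule Set.set_eqI, rule iffI)
      fix W assume "W \<in> {W \<in> subfams V. dims W = t}"
      then show "W \<in> PiE (verts Q) (\<lambda>i. grass (V i) (t i))"
        by (auto simp: subfams_def grass_def dims_def PiE_iff)
    next
      fix W assume W: "W \<in> PiE (verts Q) (\<lambda>i. grass (V i) (t i))"
      have "dims W = t"
        by (rule extensionalityI[of _ "verts Q"]) (use W t in \<open>auto simp: dims_def grass_def PiE_iff\<close>)
      then show "W \<in> {W \<in> subfams V. dims W = t}"
        using W by (auto simp: subfams_def grass_def PiE_iff)
    qed
    then have "(\<Sum>W\<in>{W \<in> subfams V. dims W = t}. f (dims W)) =
        (\<Sum>W\<in>PiE (verts Q) (\<lambda>i. grass (V i) (t i)). f t)"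
      by (intro sum.cong) auto
    also have "\<dots> = (\<Prod>i\<in>verts Q. int (card (grass (V i) (t i)))) * f t"
      by (simp add: card_PiE)
    also have "\<dots> = (\<Prod>i\<in>verts Q. poly (gauss_binomial (dim (V i)) (t i)) (int q)) * f t"
      using V by (simp add: card_grass gspaceD cong: prod.cong)
    finally show "(\<Sum>W\<in>{W \<in> subfams V. dims W = t}. f (dims W)) =
      (\<Prod>i\<in>verts Q. poly (gauss_binomial (dim (V i)) (t i)) (int q)) * f t" .
  qed simp
  finally show ?thesis .
qed

lemma finite_structures: "gspace V \<Longrightarrow> finite (structures V)"
  by (rule finite_arc_maps)

lemma torsion_fam_cong:
  assumes "\<And>i. i \<in> verts Q \<Longrightarrow> W i = W' i"
  shows "torsion W N \<longleftrightarrow> torsion W' N"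
proof -
  have "subfam U W \<longleftrightarrow> subfam U W'" for U using assms by (simp add: subfam_def)
  moreover have "ext_zero W U N \<longleftrightarrow> ext_zero W' U N" for U unfolding ext_zero_def using assms by simp
  ultimately show ?thesis unfolding torsion_def using assms by simp
qed

lemma ex_projections:
  assumes "subfam W V" "gspace V"
  shows "\<exists>p. \<forall>i\<in>verts Q. projection (V i) (W i) (p i)"
proof (rule bchoice, rule ballI)
  fix i assume i: "i \<in> verts Q"
  show "\<exists>p. projection (V i) (W i) p"
    by (rule ex_projection[OF subfamD[OF assms(1) i] gspaceD[OF assms(2) i]])
qed

text \<open>Every structure is counted at its torsion part. The spaces \<open>C W\<close> are complements of \<open>W\<close>, on which
  the torsion-free quotients live.\<close>

lemma structures_by_torsion:
  assumes V: "gspace V"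
  obtains C where "\<And>W. W \<in> subfams V \<Longrightarrow> gspace (C W)"
    "\<And>W i. W \<in> subfams V \<Longrightarrow> i \<in> verts Q \<Longrightarrow> C W i \<subseteq> V i"
    "\<And>W i. W \<in> subfams V \<Longrightarrow> i \<in> verts Q \<Longrightarrow> dim (W i) + dim (C W i) = dim (V i)"
    "q ^ (\<Sum>\<alpha>\<in>arcs Q. dim (V (src \<alpha>)) * dim (V (tgt \<alpha>))) =
      (\<Sum>W\<in>subfams V. card (torsion_structures W) * card (ext_zero_structures (C W)) *
         q ^ (\<Sum>\<alpha>\<in>arcs Q. dim (C W (src \<alpha>)) * dim (W (tgt \<alpha>))))"
proof -
  let ?P = "\<lambda>W N. stable W N \<and> ext_zero V W N \<and> torsion W N"
  have "\<exists>p. \<forall>i\<in>verts Q. projection (V i) (W i) (p i)" if "W \<in> subfams V" for W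
    by (rule ex_projections[OF subfams_subfam[OF that] V])
  then obtain p where p: "\<And>W i. W \<in> subfams V \<Longrightarrow> i \<in> verts Q \<Longrightarrow> projection (V i) (W i) (p W i)" by metis
  define C where "C W = (\<lambda>i. p W i ` V i)" for W
  have "q ^ (\<Sum>\<alpha>\<in>arcs Q. dim (V (src \<alpha>)) * dim (V (tgt \<alpha>))) = card (structures V)"
    by (simp add: card_arc_maps[OF V V])
  also have "structures V = (\<Union>W\<in>subfams V. {N \<in> structures V. ?P W N})"
  proof (intro equalityI subsetI)
    fix N assume N: "N \<in> structures V"
    obtain W where W: "subfam W V" "stable W N" "ext_zero V W N" "torsion W N"
      using ex_torsion_sub[OF V structures_acts[OF N]] by blast
    define W' where "W' = restrict W (verts Q)"
    have eq: "W' i = W i" if "i \<in> verts Q" for i using that by (simp add: W'_def)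
    have "?P W' N"
      using W stable_fam_cong[of W' W N, OF eq] ext_zero_fam_cong[of W' W V N, OF eq] torsion_fam_cong[of W' W N, OF eq]
      by blast
    moreover have "W' \<in> subfams V" using W(1) by (auto simp: W'_def subfams_def subfam_def)
    ultimately show "N \<in> (\<Union>W\<in>subfams V. {N \<in> structures V. ?P W N})" using N by blast
  qed blast
  also have "card \<dots> = (\<Sum>W\<in>subfams V. card {N \<in> structures V. ?P W N})"
  proof (rule card_UN_disjoint)
    show "\<forall>W\<in>subfams V. \<forall>W'\<in>subfams V. W \<noteq> W' \<longrightarrow>
      {N \<in> structures V. ?P W N} \<inter> {N \<in> structures V. ?P W' N} = {}"
    proof (intro ballI impI, rule ccontr)
      fix W W' assume W: "W \<in> subfams V" "W' \<in> subfams V" "W \<noteq> W'"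
        and "{N \<in> structures V. ?P W N} \<inter> {N \<in> structures V. ?P W' N} \<noteq> {}"
      then obtain N where N: "N \<in> structures V" "?P W N" "?P W' N" by blast
      have "W i = W' i" if "i \<in> verts Q" for i
        using torsion_sub_unique[OF V structures_acts[OF N(1)], of W W' i] subfams_subfam W N that by blast
      then have "W = W'" using W(1,2) unfolding subfams_def by (intro PiE_ext)
      with W(3) show False by simp
    qed
  qed (use V finite_subfams finite_structures in auto)
  also have "\<dots> = (\<Sum>W\<in>subfams V. card (torsion_structures W) * card (ext_zero_structures (C W)) *
         q ^ (\<Sum>\<alpha>\<in>arcs Q. dim (C W (src \<alpha>)) * dim (W (tgt \<alpha>))))"
    unfolding C_def by (intro sum.cong refl card_torsion_stratum V subfams_subfam p)
  finally have "q ^ (\<Sum>\<alpha>\<in>arcs Q. dim (V (src \<alpha>)) * dim (V (tgt \<alpha>))) =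
      (\<Sum>W\<in>subfams V. card (torsion_structures W) * card (ext_zero_structures (C W)) *
         q ^ (\<Sum>\<alpha>\<in>arcs Q. dim (C W (src \<alpha>)) * dim (W (tgt \<alpha>))))" .
  moreover have "gspace (C W)" if "W \<in> subfams V" for W
    unfolding C_def by (rule gspace_C[OF V subfams_subfam[OF that] p[OF that]])
  moreover have "dim (W i) + dim (C W i) = dim (V i)" if "W \<in> subfams V" "i \<in> verts Q" for W i
    unfolding C_def by (rule dim_C[OF V subfams_subfam[OF that(1)] p[OF that(1)] that(2)])
  moreover have "C W i \<subseteq> V i" if "W \<in> subfams V" "i \<in> verts Q" for W i
    unfolding C_def using C_in[OF V subfams_subfam[OF that(1)] p[OF that(1)] that(2)] by blast
  ultimately show ?thesis using that by blast
qed

definition quiver_grass :: "('v \<Rightarrow> nat) \<Rightarrow> ('v \<Rightarrow> 'b set) set" where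
  "quiver_grass f = {U \<in> PiE (verts Q) (\<lambda>i. grass (M i) (f i)). stable U m}"

lemma finite_quiver_grass: "finite (quiver_grass f)"
  unfolding quiver_grass_def
  by (rule finite_subset[of _ "PiE (verts Q) (\<lambda>i. grass (M i) (f i))"])
    (auto intro!: finite_PiE finite_grass simp: M_spaceD)

definition image_fam :: "('v \<Rightarrow> 'b set) \<Rightarrow> ('v \<Rightarrow> 'b \<Rightarrow> 'b) \<Rightarrow> 'v \<Rightarrow> 'b set" where
  "image_fam V h = (\<lambda>i\<in>verts Q. h i ` V i)"

lemma card_maps_with_image:
  assumes V: "gspace V" and f: "f \<in> extensional (verts Q)"
  shows "int (card {h \<in> vert_maps V. stable (image_fam V h) m \<and> dims (image_fam V h) = f}) =
    int (card (quiver_grass f)) * (\<Prod>i\<in>verts Q. poly (surjection_poly (dim (V i)) (f i)) (int q))"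
proof -
  let ?H = "{h \<in> vert_maps V. stable (image_fam V h) m \<and> dims (image_fam V h) = f}"
  have finH: "finite ?H" using finite_vert_maps[OF V] by simp
  have "card ?H = (\<Sum>h\<in>?H. 1)" by simp
  also have "\<dots> = (\<Sum>U\<in>quiver_grass f. \<Sum>h\<in>{h \<in> ?H. image_fam V h = U}. 1)"
  proof (rule sum.group[symmetric, OF finH finite_quiver_grass])
    show "image_fam V ` ?H \<subseteq> quiver_grass f"
    proof (rule image_subsetI)
      fix h assume h: "h \<in> ?H"
      have "image_fam V h i \<in> grass (M i) (f i)" if i: "i \<in> verts Q" for i
      proof -
        have l: "h i \<in> lin (V i) (M i)" using h i by auto
        have "dim (h i ` V i) = f i" using h i by (auto simp: dims_def image_fam_def)
        then show ?thesis
          using subspace_image[OF l] lin_closed[OF l] i V by (auto simp: image_fam_def grass_def gspaceD M_spaceD)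
      qed
      then show "image_fam V h \<in> quiver_grass f"
        using h by (auto simp: quiver_grass_def image_fam_def)
    qed
  qed
  also have "\<dots> = (\<Sum>U\<in>quiver_grass f. \<Prod>i\<in>verts Q. card {g \<in> lin (V i) (U i). g ` V i = U i})"
  proof (rule sum.cong)
    fix U assume U: "U \<in> quiver_grass f"
    have UM: "U i \<subseteq> M i" "dim (U i) = f i" if "i \<in> verts Q" for i
      using U that by (auto simp: quiver_grass_def grass_def)
    have ext: "U \<in> extensional (verts Q)" using U by (auto simp: quiver_grass_def PiE_def)
    have "{h \<in> ?H. image_fam V h = U} = PiE (verts Q) (\<lambda>i. {g \<in> lin (V i) (U i). g ` V i = U i})"
    proof (rule Set.set_eqI, rule iffI)
      fix h assume h: "h \<in> {h \<in> ?H. image_fam V h = U}"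
      have "h i \<in> lin (V i) (U i) \<and> h i ` V i = U i" if i: "i \<in> verts Q" for i
      proof -
        have im: "h i ` V i = U i" using h i by (auto simp: image_fam_def)
        moreover have "h i \<in> lin (V i) (M i)" using h i by auto
        then have "h i \<in> lin (V i) (U i)" using im lin_codomain by blast
        ultimately show ?thesis by blast
      qed
      then show "h \<in> PiE (verts Q) (\<lambda>i. {g \<in> lin (V i) (U i). g ` V i = U i})" using h by (auto simp: PiE_iff)
    next
      fix h assume h: "h \<in> PiE (verts Q) (\<lambda>i. {g \<in> lin (V i) (U i). g ` V i = U i})"
      have im: "image_fam V h = U"
        by (rule extensionalityI[OF _ ext]) (use h in \<open>auto simp: image_fam_def\<close>)
      have "dims U = f"
        by (rule extensionalityI[OF _ f]) (auto simp: dims_def UM)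
      moreover have "h \<in> vert_maps V"
        using h UM(1) by (auto simp: PiE_iff intro: lin_mono)
      ultimately show "h \<in> {h \<in> ?H. image_fam V h = U}"
        using im U by (auto simp: quiver_grass_def)
    qed
    then show "(\<Sum>h\<in>{h \<in> ?H. image_fam V h = U}. 1) = (\<Prod>i\<in>verts Q. card {g \<in> lin (V i) (U i). g ` V i = U i})"
      by (simp add: card_PiE)
  qed simp
  finally have "int (card ?H) = (\<Sum>U\<in>quiver_grass f. \<Prod>i\<in>verts Q. int (card {g \<in> lin (V i) (U i). g ` V i = U i}))"
    by simp
  also have "\<dots> = (\<Sum>U\<in>quiver_grass f. \<Prod>i\<in>verts Q. poly (surjection_poly (dim (V i)) (f i)) (int q))"
  proof (intro sum.cong prod.cong refl)
    fix U i assume U: "U \<in> quiver_grass f" and i: "i \<in> verts Q"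
    have "subspace (U i)" "U i \<subseteq> M i" "dim (U i) = f i" using U i by (auto simp: quiver_grass_def grass_def)
    then show "int (card {g \<in> lin (V i) (U i). g ` V i = U i}) = poly (surjection_poly (dim (V i)) (f i)) (int q)"
      using card_surjective_lin[of "V i" "U i"] V i finite_subset[of "U i" "M i"] by (simp add: gspaceD M_spaceD)
  qed
  finally show ?thesis by simp
qed

text \<open>Double count of the pairs of a torsion-free structure \<open>N\<close> and a homomorphism \<open>h : N \<rightarrow> M\<close>: for
  fixed \<open>N\<close> through the Euler form, for fixed \<open>h\<close> through the kernel and image of \<open>h\<close>. The Euler
  form is split into its two parts to avoid negative exponents.\<close>

lemma count_homs_by_image:
  fixes x :: "('v \<Rightarrow> nat) \<Rightarrow> int"
  assumes V: "gspace V" and x: "\<And>W. gspace W \<Longrightarrow> int (card (ext_zero_structures W)) = x (dims W)"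
  shows "x (dims V) * int q ^ vert_form V = int q ^ arc_form V *
    (\<Sum>f\<in>PiE (verts Q) (\<lambda>i. {..dim (V i)}). int (card (quiver_grass f)) *
      (\<Prod>i\<in>verts Q. poly (surjection_poly (dim (V i)) (f i)) (int q)) *
      (x (\<lambda>i\<in>verts Q. dim (V i) - f i) * int q ^ (\<Sum>\<alpha>\<in>arcs Q. f (src \<alpha>) * (dim (V (tgt \<alpha>)) - f (tgt \<alpha>)))))"
proof -
  let ?G = "ext_zero_structures V" and ?T = "PiE (verts Q) (\<lambda>i. {..dim (V i)})"
  let ?F = "\<lambda>f. x (\<lambda>i\<in>verts Q. dim (V i) - f i) * int q ^ (\<Sum>\<alpha>\<in>arcs Q. f (src \<alpha>) * (dim (V (tgt \<alpha>)) - f (tgt \<alpha>)))"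
  let ?S = "{h \<in> vert_maps V. stable (image_fam V h) m}"
  have finG: "finite ?G" using finite_structures[OF V] by (simp add: ext_zero_structures_def)
  have finT: "finite ?T" by (intro finite_PiE) auto
  have finV: "finite (vert_maps V)" by (rule finite_vert_maps[OF V])
  have stratum: "int (card {N \<in> ?G. h \<in> homs V N}) =
      (if stable (image_fam V h) m then ?F (dims (image_fam V h)) else 0)"
    if h: "h \<in> vert_maps V" for h
  proof (cases "stable (image_fam V h) m")
    case False
    have "h \<notin> homs V N" if N: "N \<in> ?G" for N
    proof
      assume hN: "h \<in> homs V N"
      have "stable (image_fam V h) m"
        unfolding stable_def
      proof (intro ballI image_subsetI)
        fix \<alpha> y assume a: "\<alpha> \<in> arcs Q" and "y \<in> image_fam V h (src \<alpha>)"
        then obtain z where z: "z \<in> V (src \<alpha>)" "y = h (src \<alpha>) z" by (auto simp: image_fam_def)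
        have "N \<alpha> z \<in> V (tgt \<alpha>)"
          using acts_closed[of V N \<alpha> z] structures_acts[of N V] a z(1) N by (simp add: ext_zero_structures_def)
        moreover have "m \<alpha> y = h (tgt \<alpha>) (N \<alpha> z)" using homsD(2)[OF hN a z(1)] z(2) by simp
        ultimately show "m \<alpha> y \<in> image_fam V h (tgt \<alpha>)" using a by (simp add: image_fam_def)
      qed
      with False show False by simp
    qed
    then have empty: "{N \<in> ?G. h \<in> homs V N} = {}" by blast
    show ?thesis unfolding empty using False by simp
  next
    case True
    have hl: "h i \<in> lin (V i) (M i)" if "i \<in> verts Q" for i using h that by auto
    let ?K = "ker V h"
    have K: "subfam ?K V" by (rule ker_subfam[OF V hl])
    have "\<exists>p. \<forall>i\<in>verts Q. projection (V i) (?K i) (p i)"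
      by (rule ex_projections[OF K V])
    then obtain p where p: "\<And>i. i \<in> verts Q \<Longrightarrow> projection (V i) (?K i) (p i)" by blast
    have st: "stable (\<lambda>i. h i ` V i) m"
      using True stable_fam_cong[of "image_fam V h" "\<lambda>i. h i ` V i" m] by (simp add: image_fam_def)
    have card: "card {N \<in> ?G. h \<in> homs V N} = card (ext_zero_structures ?K) *
        q ^ (\<Sum>\<alpha>\<in>arcs Q. dim (p (src \<alpha>) ` V (src \<alpha>)) * dim (?K (tgt \<alpha>)))"
      by (rule card_hom_stratum[OF V K p h refl st])
    have d: "dim (?K i) + dim (h i ` V i) = dim (V i)" if i: "i \<in> verts Q" for i
      by (rule rank_nullity[OF hl[OF i]]) (use V i in \<open>auto simp: gspaceD M_spaceD\<close>)
    have d': "dim (?K i) + dim (p i ` V i) = dim (V i)" if i: "i \<in> verts Q" for i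
      by (rule dim_C[OF V K p i])
    have e: "dim (p i ` V i) = dims (image_fam V h) i" "dim (?K i) = dim (V i) - dims (image_fam V h) i"
      if i: "i \<in> verts Q" for i
      using d[OF i] d'[OF i] i by (simp_all add: dims_def image_fam_def)
    have "dims ?K = (\<lambda>i\<in>verts Q. dim (V i) - dims (image_fam V h) i)"
      unfolding dims_def[of ?K] by (rule restrict_ext) (rule e(2))
    then have "int (card {N \<in> ?G. h \<in> homs V N}) = ?F (dims (image_fam V h))"
      unfolding card using x[OF subfam_gspace[OF K V]] e by simp
    with True show ?thesis by simp
  qed
  have "x (dims V) * int q ^ vert_form V = (\<Sum>N\<in>?G. int (q ^ vert_form V))"
    using x[OF V] by simp
  also have "\<dots> = (\<Sum>N\<in>?G. int q ^ arc_form V * int (card (homs V N)))"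
  proof (rule sum.cong)
    fix N assume "N \<in> ?G"
    then have "q ^ vert_form V = q ^ arc_form V * card (homs V N)"
      by (intro ext_zero_card_homs[OF V] structures_acts) (auto simp: ext_zero_structures_def)
    then show "int (q ^ vert_form V) = int q ^ arc_form V * int (card (homs V N))"
      by (simp only: of_nat_mult of_nat_power)
  qed simp
  also have "\<dots> = int q ^ arc_form V * (\<Sum>N\<in>?G. int (card (homs V N)))"
    by (simp add: sum_distrib_left)
  also have "(\<Sum>N\<in>?G. int (card (homs V N))) = (\<Sum>N\<in>?G. \<Sum>h\<in>vert_maps V. if h \<in> homs V N then 1 else 0)"
  proof (rule sum.cong)
    fix N assume "N \<in> ?G"
    have "homs V N = {h \<in> vert_maps V. h \<in> homs V N}" by (auto simp: homs_def)
    then show "int (card (homs V N)) = (\<Sum>h\<in>vert_maps V. if h \<in> homs V N then 1 else 0)"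
      using finV by (simp add: sum.If_cases Int_def)
  qed simp
  also have "\<dots> = (\<Sum>h\<in>vert_maps V. \<Sum>N\<in>?G. if h \<in> homs V N then 1 else 0)"
    by (rule sum.swap)
  also have "\<dots> = (\<Sum>h\<in>vert_maps V. int (card {N \<in> ?G. h \<in> homs V N}))"
    using finG by (intro sum.cong refl) (simp add: sum.If_cases Int_def)
  also have "\<dots> = (\<Sum>h\<in>vert_maps V. if stable (image_fam V h) m then ?F (dims (image_fam V h)) else 0)"
    by (rule sum.cong[OF refl stratum])
  also have "\<dots> = (\<Sum>h\<in>?S. ?F (dims (image_fam V h)))"
    using finV by (simp add: sum.inter_filter)
  also have "\<dots> = (\<Sum>f\<in>?T. \<Sum>h\<in>{h \<in> ?S. dims (image_fam V h) = f}. ?F (dims (image_fam V h)))"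
  proof (rule sum.group[symmetric])
    show "(\<lambda>h. dims (image_fam V h)) ` ?S \<subseteq> ?T"
    proof (rule image_subsetI)
      fix h assume h: "h \<in> ?S"
      have "dim (h i ` V i) \<le> dim (V i)" if i: "i \<in> verts Q" for i
      proof -
        have "h i \<in> lin (V i) (M i)" using h i by auto
        from rank_nullity[OF this] show ?thesis using V i by (simp add: gspaceD M_spaceD)
      qed
      then show "dims (image_fam V h) \<in> ?T" by (auto simp: dims_def image_fam_def)
    qed
  qed (use finV finT in auto)
  also have "\<dots> = (\<Sum>f\<in>?T. int (card (quiver_grass f)) *
      (\<Prod>i\<in>verts Q. poly (surjection_poly (dim (V i)) (f i)) (int q)) * ?F f)"
  proof (rule sum.cong)
    fix f assume f: "f \<in> ?T"
    have "(\<Sum>h\<in>{h \<in> ?S. dims (image_fam V h) = f}. ?F (dims (image_fam V h))) =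
        (\<Sum>h\<in>{h \<in> ?S. dims (image_fam V h) = f}. ?F f)"
      by (rule sum.cong) auto
    also have "\<dots> = int (card {h \<in> vert_maps V. stable (image_fam V h) m \<and> dims (image_fam V h) = f}) * ?F f"
      by (simp add: conj_assoc)
    finally show "(\<Sum>h\<in>{h \<in> ?S. dims (image_fam V h) = f}. ?F (dims (image_fam V h))) =
        int (card (quiver_grass f)) * (\<Prod>i\<in>verts Q. poly (surjection_poly (dim (V i)) (f i)) (int q)) * ?F f"
      using card_maps_with_image[OF V, of f] f by (simp add: PiE_iff)
  qed simp
  finally show ?thesis .
qed

end

section \<open>Polynomiality\<close>

lemma gauss_binomial_eq_0: "n < t \<Longrightarrow> gauss_binomial n t = 0"
  by (induction n t rule: gauss_binomial.induct) auto

lemma gauss_binomial_self: "gauss_binomial n n = 1"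
  by (induction n) (simp_all add: gauss_binomial_eq_0)

text \<open>The equation for \<open>x e + y e\<close> that results from the sum over the torsion parts, whose terms at
  \<open>t = e\<close> and \<open>t = 0\<close> are \<open>y e\<close> and \<open>x e\<close>.\<close>

definition structure_poly ::
  "('v, 'e) pre_digraph \<Rightarrow> ('v \<Rightarrow> nat) \<Rightarrow> (('v \<Rightarrow> nat) \<Rightarrow> int poly) \<Rightarrow> (('v \<Rightarrow> nat) \<Rightarrow> int poly) \<Rightarrow> int poly" where
  "structure_poly Q e x y =
    Polynomial.monom 1 (\<Sum>\<alpha>\<in>arcs Q. e (tail Q \<alpha>) * e (head Q \<alpha>)) -
    (\<Sum>t\<in>PiE (verts Q) (\<lambda>i. {..e i}) - {e, \<lambda>i\<in>verts Q. 0}.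
      (\<Prod>i\<in>verts Q. gauss_binomial (e i) (t i)) *
      (y t * x (\<lambda>i\<in>verts Q. e i - t i) *
        Polynomial.monom 1 (\<Sum>\<alpha>\<in>arcs Q. (e (tail Q \<alpha>) - t (tail Q \<alpha>)) * t (head Q \<alpha>))))"

text \<open>The value of \<open>|Gr\<^sub>e(M)| * (\<Prod>i. |GL(e i, q)|)\<close> obtained from the count of homomorphisms, whose term
  at \<open>f = e\<close> it is. If the Euler form is negative, then \<open>x e\<close> vanishes, and the first summand is
  replaced by zero.\<close>

definition grass_poly ::
  "('v, 'e) pre_digraph \<Rightarrow> ('v \<Rightarrow> nat) \<Rightarrow> ('v \<Rightarrow> nat) \<Rightarrow> (('v \<Rightarrow> nat) \<Rightarrow> int poly) \<Rightarrow> (('v \<Rightarrow> nat) \<Rightarrow> int poly) \<Rightarrow> int poly" where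
  "grass_poly Q d e x g =
    (let a = (\<Sum>\<alpha>\<in>arcs Q. e (tail Q \<alpha>) * d (head Q \<alpha>)); b = (\<Sum>i\<in>verts Q. e i * d i)
     in if a \<le> b then x e * Polynomial.monom 1 (b - a) else 0) -
    (\<Sum>f\<in>PiE (verts Q) (\<lambda>i. {..e i}) - {e}.
      g f * (\<Prod>i\<in>verts Q. surjection_poly (e i) (f i)) *
      (x (\<lambda>i\<in>verts Q. e i - f i) *
        Polynomial.monom 1 (\<Sum>\<alpha>\<in>arcs Q. f (tail Q \<alpha>) * (e (head Q \<alpha>) - f (head Q \<alpha>)))))"

context rigid_rep
begin

lemma zero_structures:
  assumes V: "gspace V" and z: "\<And>i. i \<in> verts Q \<Longrightarrow> dim (V i) = 0"
  shows "card (ext_zero_structures V) = 1" "card (torsion_structures V) = 1"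
proof -
  have V0: "V i = {\<zero>\<^bsub>A\<^esub>}" if "i \<in> verts Q" for i
    using dim_zero_iff[of "V i"] z V that by (simp add: gspaceD)
  have 1: "card (structures V) = 1" using z by (simp add: card_arc_maps[OF V V])
  have "ext_zero V zero_fam N" if "N \<in> structures V" for N
    using ext_zero_self[OF V structures_acts[OF that]] ext_zero_fam_cong[of V zero_fam V N] V0 by blast
  then have "ext_zero_structures V = structures V" by (auto simp: ext_zero_structures_def)
  with 1 show "card (ext_zero_structures V) = 1" by simp
  have "torsion V N" for N
    unfolding torsion_def
  proof (intro allI impI ballI, elim conjE)
    fix U i assume U: "subfam U V" and i: "i \<in> verts Q"
    have "\<zero>\<^bsub>A\<^esub> \<in> U i" by (rule subspace_zero[OF subfamD(1)[OF U i]])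
    then show "U i = V i" using subfamD(2)[OF U i] unfolding V0[OF i] by blast
  qed
  then have "torsion_structures V = structures V" by (auto simp: torsion_structures_def)
  with 1 show "card (torsion_structures V) = 1" by simp
qed

lemma structures_fam_cong:
  assumes eq: "\<And>i. i \<in> verts Q \<Longrightarrow> V i = W i"
  shows "torsion_structures V = torsion_structures W" "ext_zero_structures V = ext_zero_structures W"
proof -
  have s: "structures V = structures W" using eq by (intro PiE_cong) simp
  show "torsion_structures V = torsion_structures W"
    unfolding torsion_structures_def s using torsion_fam_cong[of V W, OF eq] by simp
  have "ext_zero V zero_fam N \<longleftrightarrow> ext_zero W zero_fam N" for N unfolding ext_zero_def using eq by simp
  then show "ext_zero_structures V = ext_zero_structures W" unfolding ext_zero_structures_def s by simp
qed

text \<open>The torsion part is the whole space or zero in the two terms that are separated; in all other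
  terms, the torsion part and the quotient are both of smaller dimension.\<close>

lemma structure_recursion:
  assumes V: "gspace V" and e: "dims V = e" and nz: "i0 \<in> verts Q" "e i0 \<noteq> 0"
    and x: "\<And>W. gspace W \<Longrightarrow> sum (dims W) (verts Q) < sum e (verts Q) \<Longrightarrow>
        int (card (ext_zero_structures W)) = poly (x (dims W)) (int q)"
    and y: "\<And>W. gspace W \<Longrightarrow> sum (dims W) (verts Q) < sum e (verts Q) \<Longrightarrow>
        int (card (torsion_structures W)) = poly (y (dims W)) (int q)"
  shows "int (card (ext_zero_structures V)) + int (card (torsion_structures V)) = poly (structure_poly Q e x y) (int q)"
proof -
  let ?z = "\<lambda>i\<in>verts Q. 0 :: nat" and ?T = "PiE (verts Q) (\<lambda>i. {..e i})"
  have ev: "dim (V i) = e i" if "i \<in> verts Q" for i using e that by (auto simp: dims_def)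
  have e_ext: "e \<in> extensional (verts Q)" using e by (auto simp: dims_def)
  have ez: "e \<noteq> ?z" using nz by auto
  obtain C where C: "\<And>W. W \<in> subfams V \<Longrightarrow> gspace (C W)"
    "\<And>W i. W \<in> subfams V \<Longrightarrow> i \<in> verts Q \<Longrightarrow> C W i \<subseteq> V i"
    "\<And>W i. W \<in> subfams V \<Longrightarrow> i \<in> verts Q \<Longrightarrow> dim (W i) + dim (C W i) = dim (V i)"
    "q ^ (\<Sum>\<alpha>\<in>arcs Q. dim (V (src \<alpha>)) * dim (V (tgt \<alpha>))) =
      (\<Sum>W\<in>subfams V. card (torsion_structures W) * card (ext_zero_structures (C W)) *
         q ^ (\<Sum>\<alpha>\<in>arcs Q. dim (C W (src \<alpha>)) * dim (W (tgt \<alpha>))))"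
    using structures_by_torsion[OF V] by blast
  define w :: "('v \<Rightarrow> nat) \<Rightarrow> int" where
    "w t = int q ^ (\<Sum>\<alpha>\<in>arcs Q. (e (src \<alpha>) - t (src \<alpha>)) * t (tgt \<alpha>))" for t
  define f where "f t = (if t = e then int (card (torsion_structures V))
     else if t = ?z then int (card (ext_zero_structures V))
     else poly (y t * x (\<lambda>i\<in>verts Q. e i - t i)) (int q) * w t)" for t
  have summand: "int (card (torsion_structures W) * card (ext_zero_structures (C W)) *
         q ^ (\<Sum>\<alpha>\<in>arcs Q. dim (C W (src \<alpha>)) * dim (W (tgt \<alpha>)))) = f (dims W)"
    if W: "W \<in> subfams V" for W
  proof -
    have sW: "subfam W V" by (rule subfams_subfam[OF W])
    have gW: "gspace W" by (rule subfam_gspace[OF sW V])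
    have dC: "dim (C W i) = e i - dims W i" "dim (W i) = dims W i" "dims W i \<le> e i" if "i \<in> verts Q" for i
      using C(3)[OF W that] ev[OF that] that by (simp_all add: dims_def)
    have ww: "int (q ^ (\<Sum>\<alpha>\<in>arcs Q. dim (C W (src \<alpha>)) * dim (W (tgt \<alpha>)))) = w (dims W)"
      by (simp add: w_def dC)
    consider (top) "dims W = e" | (bot) "dims W = ?z" "dims W \<noteq> e" | (mid) "dims W \<noteq> e" "dims W \<noteq> ?z" by blast
    then show ?thesis
    proof cases
      case top
      have "W i = V i" if "i \<in> verts Q" for i
        using dim_eq_imp_eq[of "V i" "W i"] V sW that ev dC(2) top by (simp add: gspaceD subfamD)
      then have "torsion_structures W = torsion_structures V" by (rule structures_fam_cong)
      moreover have "card (ext_zero_structures (C W)) = 1"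
        by (rule zero_structures[OF C(1)[OF W]]) (simp add: dC top)
      moreover have "w e = 1" by (simp add: w_def)
      ultimately show ?thesis using ww top by (simp add: f_def)
    next
      case bot
      have "C W i = V i" if "i \<in> verts Q" for i
        using dim_eq_imp_eq[of "V i" "C W i"] V C(1,2)[OF W] that ev dC(1) bot by (simp add: gspaceD)
      then have "ext_zero_structures (C W) = ext_zero_structures V" by (rule structures_fam_cong)
      moreover have "card (torsion_structures W) = 1"
        by (rule zero_structures[OF gW]) (simp add: dC bot)
      moreover have "w ?z = 1" by (simp add: w_def)
      ultimately show ?thesis using ww bot by (simp add: f_def)
    next
      case mid
      have dCW: "dims (C W) = (\<lambda>i\<in>verts Q. e i - dims W i)"
        unfolding dims_def[of "C W"] by (rule restrict_ext) (rule dC(1))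
      have "\<exists>i\<in>verts Q. dims W i \<noteq> e i"
      proof (rule ccontr)
        assume "\<not> (\<exists>i\<in>verts Q. dims W i \<noteq> e i)"
        then have "dims W = e" by (intro extensionalityI[OF _ e_ext]) (auto simp: dims_def)
        with mid show False by simp
      qed
      then have "sum (dims W) (verts Q) < sum e (verts Q)"
        using dC(3) by (intro sum_strict_mono_ex1) (auto simp: le_less)
      moreover have "\<exists>i\<in>verts Q. dims W i \<noteq> 0"
      proof (rule ccontr)
        assume "\<not> (\<exists>i\<in>verts Q. dims W i \<noteq> 0)"
        then have "dims W = ?z" by (intro extensionalityI[of _ "verts Q"]) (auto simp: dims_def)
        with mid show False by simp
      qed
      then obtain i where i: "i \<in> verts Q" "dims W i \<noteq> 0" by blast
      have "sum (dims (C W)) (verts Q) < sum e (verts Q)"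
        by (rule sum_strict_mono_ex1) (use i dC(3)[OF i(1)] in \<open>auto simp: dCW intro!: bexI[of _ i]\<close>)
      ultimately show ?thesis
        using x[OF C(1)[OF W]] y[OF gW] ww mid dCW by (simp add: f_def)
    qed
  qed
  have "int q ^ (\<Sum>\<alpha>\<in>arcs Q. e (src \<alpha>) * e (tgt \<alpha>)) =
      int (q ^ (\<Sum>\<alpha>\<in>arcs Q. dim (V (src \<alpha>)) * dim (V (tgt \<alpha>))))"
    by (simp add: ev)
  also have "\<dots> = (\<Sum>W\<in>subfams V. f (dims W))"
    unfolding C(4) of_nat_sum by (rule sum.cong[OF refl summand])
  also have "\<dots> = (\<Sum>t\<in>?T. (\<Prod>i\<in>verts Q. poly (gauss_binomial (e i) (t i)) (int q)) * f t)" (is "_ = sum ?g ?T")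
    unfolding sum_subfams[OF V] by (intro sum.cong prod.cong PiE_cong) (auto simp: ev cong: prod.cong)
  also have "\<dots> = sum ?g (?T - {e, ?z}) + (?g e + ?g ?z)"
  proof -
    have "?z \<in> ?T" "e \<in> ?T" using e_ext by (auto simp: PiE_iff)
    moreover have "finite ?T" by (intro finite_PiE) auto
    ultimately show ?thesis using ez by (subst sum.subset_diff[of "{e, ?z}"]) auto
  qed
  also have "?g e = int (card (torsion_structures V))" by (simp add: gauss_binomial_self f_def)
  also have "?g ?z = int (card (ext_zero_structures V))" using ez by (auto simp: f_def cong: prod.cong)
  also have "sum ?g (?T - {e, ?z}) = poly (\<Sum>t\<in>?T - {e, ?z}.
      (\<Prod>i\<in>verts Q. gauss_binomial (e i) (t i)) * (y t * x (\<lambda>i\<in>verts Q. e i - t i) *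
        Polynomial.monom 1 (\<Sum>\<alpha>\<in>arcs Q. (e (src \<alpha>) - t (src \<alpha>)) * t (tgt \<alpha>)))) (int q)"
    unfolding poly_sum by (rule sum.cong) (auto simp: f_def w_def poly_prod poly_monom)
  finally show ?thesis by (simp add: structure_poly_def poly_monom)
qed

lemma vert_form_dims: "vert_form V = (\<Sum>i\<in>verts Q. dims V i * dims M i)"
  by (simp add: vert_form_def dims_def)

lemma arc_form_dims: "arc_form V = (\<Sum>\<alpha>\<in>arcs Q. dims V (src \<alpha>) * dims M (tgt \<alpha>))"
  by (simp add: arc_form_def dims_def)

lemma ext_zero_structures_empty:
  assumes "gspace V" "vert_form V < arc_form V" shows "card (ext_zero_structures V) = 0"
proof -
  have "ext_zero_structures V = {}"
    using ext_zero_euler_nonneg[OF assms(1) structures_acts] assms(2)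
    by (fastforce simp: ext_zero_structures_def)
  then show ?thesis by simp
qed

lemma torsion_structures_empty:
  assumes "gspace V" "arc_form V \<le> vert_form V" "i \<in> verts Q" "dims V i \<noteq> 0"
  shows "card (torsion_structures V) = 0"
proof -
  have "V i \<noteq> {\<zero>\<^bsub>A\<^esub>}" using assms by (auto simp: dims_def)
  then have "torsion_structures V = {}"
    using torsion_euler_neg[OF assms(1) structures_acts _ assms(3)] assms(2)
    by (fastforce simp: torsion_structures_def)
  then show ?thesis by simp
qed

lemma surjection_poly_self:
  assumes "subspace V" "finite V"
  shows "poly (surjection_poly (dim V) (dim V)) (int q) = poly (injection_poly (dim V) (dim V)) (int q)"
proof -
  have "f ` V = V \<longleftrightarrow> inj_on f V" if "f \<in> lin V V" for f
  proof
    assume "f ` V = V"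
    then have "card (f ` V) = card V" by simp
    then show "inj_on f V" by (rule eq_card_imp_inj_on[OF assms(2)])
  next
    assume "inj_on f V"
    then show "f ` V = V" by (rule injective_lin_surj[OF that _ assms assms refl])
  qed
  then have "{f \<in> lin V V. f ` V = V} = {f \<in> lin V V. inj_on f V}" by blast
  then show ?thesis
    using card_surjective_lin[OF assms assms] card_injective_lin[OF assms assms] by simp
qed

lemma grass_recursion:
  assumes e: "e \<in> extensional (verts Q)" "\<And>i. i \<in> verts Q \<Longrightarrow> e i \<le> dims M i"
    and x: "\<And>W. gspace W \<Longrightarrow> int (card (ext_zero_structures W)) = poly (x (dims W)) (int q)"
    and g: "\<And>f. f \<in> PiE (verts Q) (\<lambda>i. {..e i}) \<Longrightarrow> f \<noteq> e \<Longrightarrow>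
        int (card (quiver_grass f)) = poly (g f) (int q)"
  shows "int (card (quiver_grass e)) * poly (\<Prod>i\<in>verts Q. injection_poly (e i) (e i)) (int q) =
    poly (grass_poly Q (dims M) e x g) (int q)"
proof -
  have "\<exists>W. subspace W \<and> W \<subseteq> M i \<and> dim W = e i" if "i \<in> verts Q" for i
  proof -
    have "e i \<le> dim (M i)" using e(2)[OF that] that by (simp add: dims_def)
    then show ?thesis by (rule ex_subspace_dim[OF M_spaceD[OF that]]) blast
  qed
  then obtain V where V: "\<And>i. i \<in> verts Q \<Longrightarrow> subspace (V i) \<and> V i \<subseteq> M i \<and> dim (V i) = e i" by metis
  have gV: "gspace V" using V M_spaceD finite_subset unfolding gspace_def by metis
  have ev: "dim (V i) = e i" if "i \<in> verts Q" for i using V that by blast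
  have dV: "dims V = e" by (rule extensionalityI[OF _ e(1)]) (auto simp: dims_def V)
  let ?T = "PiE (verts Q) (\<lambda>i. {..e i})"
  define s where "s f = (\<Prod>i\<in>verts Q. poly (surjection_poly (e i) (f i)) (int q)) *
      (poly (x (\<lambda>i\<in>verts Q. e i - f i)) (int q) *
        int q ^ (\<Sum>\<alpha>\<in>arcs Q. f (src \<alpha>) * (e (tgt \<alpha>) - f (tgt \<alpha>))))" for f
  define S where "S = (\<Sum>f\<in>?T. int (card (quiver_grass f)) * s f)"
  have "poly (x (dims V)) (int q) * int q ^ vert_form V = int q ^ arc_form V *
    (\<Sum>f\<in>PiE (verts Q) (\<lambda>i. {..dim (V i)}). int (card (quiver_grass f)) *
      (\<Prod>i\<in>verts Q. poly (surjection_poly (dim (V i)) (f i)) (int q)) *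
      (poly (x (\<lambda>i\<in>verts Q. dim (V i) - f i)) (int q) *
         int q ^ (\<Sum>\<alpha>\<in>arcs Q. f (src \<alpha>) * (dim (V (tgt \<alpha>)) - f (tgt \<alpha>)))))"
    by (rule count_homs_by_image[OF gV x])
  also have "\<dots> = int q ^ arc_form V * S"
  proof -
    have "(\<lambda>i\<in>verts Q. dim (V i) - f i) = (\<lambda>i\<in>verts Q. e i - f i)" for f
      by (rule restrict_ext) (simp add: ev)
    moreover have "PiE (verts Q) (\<lambda>i. {..dim (V i)}) = ?T" by (rule PiE_cong) (simp add: ev)
    ultimately show ?thesis by (simp add: S_def s_def ev mult.assoc cong: prod.cong)
  qed
  finally have key: "poly (x e) (int q) * int q ^ vert_form V = int q ^ arc_form V * S" unfolding dV .
  have qpos: "int q > 0" using q_ge_2 by simp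
  have S: "S = (if arc_form V \<le> vert_form V then poly (x e * Polynomial.monom 1 (vert_form V - arc_form V)) (int q) else 0)"
  proof (cases "arc_form V \<le> vert_form V")
    case True
    then have "int q ^ vert_form V = int q ^ arc_form V * int q ^ (vert_form V - arc_form V)"
      by (simp flip: power_add)
    with key have "int q ^ arc_form V * S = int q ^ arc_form V * (poly (x e) (int q) * int q ^ (vert_form V - arc_form V))"
      by auto
    then have "S = poly (x e) (int q) * int q ^ (vert_form V - arc_form V)" using qpos by simp
    with True show ?thesis by (simp add: poly_monom)
  next
    case False
    then have "poly (x e) (int q) = 0" using x[OF gV] ext_zero_structures_empty[OF gV] dV by simp
    then have "S = 0" using key qpos by simp
    with False show ?thesis by simp
  qed
  have s_e: "s e = poly (\<Prod>i\<in>verts Q. injection_poly (e i) (e i)) (int q)"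
  proof -
    have gz: "gspace zero_fam" using subspace_singleton_zero by (simp add: gspace_def)
    have "poly (x (dims zero_fam)) (int q) = 1"
      using x[OF gz] zero_structures(1)[OF gz] by simp
    then have "poly (x (\<lambda>i\<in>verts Q. e i - e i)) (int q) = 1" by (simp add: dims_def)
    moreover have "poly (surjection_poly (e i) (e i)) (int q) = poly (injection_poly (e i) (e i)) (int q)"
      if "i \<in> verts Q" for i
      using surjection_poly_self[of "V i"] gspaceD[OF gV that] ev[OF that] by simp
    ultimately show ?thesis by (simp add: s_def poly_prod)
  qed
  have "S = int (card (quiver_grass e)) * s e + (\<Sum>f\<in>?T - {e}. int (card (quiver_grass f)) * s f)"
    unfolding S_def by (rule sum.remove) (use e(1) in \<open>auto simp: PiE_iff intro!: finite_PiE\<close>)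
  also have "(\<Sum>f\<in>?T - {e}. int (card (quiver_grass f)) * s f) =
     poly (\<Sum>f\<in>?T - {e}. g f * (\<Prod>i\<in>verts Q. surjection_poly (e i) (f i)) *
      (x (\<lambda>i\<in>verts Q. e i - f i) * Polynomial.monom 1 (\<Sum>\<alpha>\<in>arcs Q. f (src \<alpha>) * (e (tgt \<alpha>) - f (tgt \<alpha>))))) (int q)"
    (is "_ = poly ?R _")
    unfolding poly_sum by (rule sum.cong) (auto simp: g s_def poly_prod poly_monom)
  finally have split: "S = int (card (quiver_grass e)) * s e + poly ?R (int q)" .
  have "grass_poly Q (dims M) e x g =
     (if arc_form V \<le> vert_form V then x e * Polynomial.monom 1 (vert_form V - arc_form V) else 0) - ?R"
    by (simp only: grass_poly_def Let_def vert_form_dims arc_form_dims dV)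
  then have "poly (grass_poly Q (dims M) e x g) (int q) = S - poly ?R (int q)"
    unfolding S by (cases "arc_form V \<le> vert_form V") simp_all
  then show ?thesis unfolding s_e[symmetric] using split by linarith
qed

lemma quiver_grass_empty:
  assumes "i \<in> verts Q" "\<not> e i \<le> dims M i" shows "quiver_grass e = {}"
proof -
  have "grass (M i) (e i) = {}"
    using dim_mono[OF M_spaceD[OF assms(1)]] assms by (fastforce simp: grass_def dims_def)
  then show ?thesis using assms(1) unfolding quiver_grass_def by (auto simp: PiE_iff)
qed

end

text \<open>The polynomials are chosen once for all fields, ambient modules and rigid representations of
  dimension vector \<open>d\<close>. This is possible because the sign of the Euler form, which decides whether
  \<open>x e\<close> or \<open>y e\<close> is zero, depends on \<open>e\<close> and \<open>d\<close> only.\<close>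

lemma ex_structure_polys:
  fixes Q :: "('v, 'e) pre_digraph" and d :: "'v \<Rightarrow> nat"
  shows "\<exists>x y :: ('v \<Rightarrow> nat) \<Rightarrow> int poly. \<forall>(F :: ('f, 'g) ring_scheme) (A :: ('f, 'b, 'h) module_scheme) M m V.
    rigid_rep F A Q M m \<and> rigid_rep.dims F Q M = d \<and> rigid_rep.gspace F A Q V \<longrightarrow>
      int (card (rigid_rep.ext_zero_structures F A Q M m V)) = poly (x (rigid_rep.dims F Q V)) (int (card (carrier F))) \<and>
      int (card (rigid_rep.torsion_structures F A Q M m V)) = poly (y (rigid_rep.dims F Q V)) (int (card (carrier F)))"
proof -
  define R where "R e x y \<longleftrightarrow> (\<forall>(F :: ('f, 'g) ring_scheme) (A :: ('f, 'b, 'h) module_scheme) M m V.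
    rigid_rep F A Q M m \<and> rigid_rep.dims F Q M = d \<and> rigid_rep.gspace F A Q V \<and> rigid_rep.dims F Q V = e \<longrightarrow>
      int (card (rigid_rep.ext_zero_structures F A Q M m V)) = poly x (int (card (carrier F))) \<and>
      int (card (rigid_rep.torsion_structures F A Q M m V)) = poly y (int (card (carrier F))))"
    for e and x y :: "int poly"
  have "\<exists>x y. R e x y" for e
  proof (induction "sum e (verts Q)" arbitrary: e rule: less_induct)
    case less
    then have "\<forall>e'. \<exists>x y. sum e' (verts Q) < sum e (verts Q) \<longrightarrow> R e' x y" by blast
    then obtain x y where xy: "\<And>e'. sum e' (verts Q) < sum e (verts Q) \<Longrightarrow> R e' (x e') (y e')" by metis
    show ?case
    proof (cases "\<exists>i\<in>verts Q. e i \<noteq> 0")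
      case False
      have "R e 1 1"
        unfolding R_def
      proof (intro allI impI, elim conjE)
        fix F :: "('f, 'g) ring_scheme" and A :: "('f, 'b, 'h) module_scheme" and M m V
        assume *: "rigid_rep F A Q M m" "rigid_rep.gspace F A Q V" "rigid_rep.dims F Q V = e"
        interpret rigid_rep F A Q M m by fact
        have "dim (V i) = 0" if "i \<in> verts Q" for i using *(3) False that by (auto simp: dims_def)
        then show "int (card (ext_zero_structures V)) = poly 1 (int q) \<and> int (card (torsion_structures V)) = poly 1 (int q)"
          using zero_structures[OF *(2)] by simp
      qed
      then show ?thesis by blast
    next
      case True
      then obtain i0 where i0: "i0 \<in> verts Q" "e i0 \<noteq> 0" by blast
      let ?P = "structure_poly Q e x y"
      let ?c = "(\<Sum>\<alpha>\<in>arcs Q. e (tail Q \<alpha>) * d (head Q \<alpha>)) \<le> (\<Sum>i\<in>verts Q. e i * d i)"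
      have "R e (if ?c then ?P else 0) (if ?c then 0 else ?P)"
        unfolding R_def
      proof (intro allI impI, elim conjE)
        fix F :: "('f, 'g) ring_scheme" and A :: "('f, 'b, 'h) module_scheme" and M m V
        assume *: "rigid_rep F A Q M m" "rigid_rep.dims F Q M = d" "rigid_rep.gspace F A Q V" "rigid_rep.dims F Q V = e"
        interpret rigid_rep F A Q M m by fact
        have sum: "int (card (ext_zero_structures V)) + int (card (torsion_structures V)) = poly ?P (int q)"
        proof (rule structure_recursion[OF *(3,4) i0])
          fix W assume W: "gspace W" "sum (dims W) (verts Q) < sum e (verts Q)"
          show "int (card (ext_zero_structures W)) = poly (x (dims W)) (int q)"
            "int (card (torsion_structures W)) = poly (y (dims W)) (int q)"
            using xy[OF W(2)] *(1,2) W(1) unfolding R_def by blast+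
        qed
        have c: "?c \<longleftrightarrow> arc_form V \<le> vert_form V"
          by (simp add: vert_form_dims arc_form_dims *)
        show "int (card (ext_zero_structures V)) = poly (if ?c then ?P else 0) (int q) \<and>
          int (card (torsion_structures V)) = poly (if ?c then 0 else ?P) (int q)"
        proof (cases ?c)
          case True
          then have "card (torsion_structures V) = 0"
            using torsion_structures_empty[OF *(3) _ i0(1)] i0(2) *(4) c by blast
          with sum True show ?thesis by simp
        next
          case False
          then have "card (ext_zero_structures V) = 0" using ext_zero_structures_empty[OF *(3)] c by simp
          with sum False show ?thesis by simp
        qed
      qed
      then show ?thesis by blast
    qed
  qed
  then obtain x y where "\<And>e. R e (x e) (y e)" by metis
  then show ?thesis unfolding R_def by blast
qed

subsection \<open>Division by monic polynomials\<close>

text \<open>The remainder of the division by \<open>D\<close> has integral quotients by \<open>D\<close> at infinitely many places,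
  while these quotients tend to zero; so the remainder has infinitely many zeros.\<close>

lemma integral_quotient_polynomial:
  fixes D P :: "int poly"
  assumes monic: "lead_coeff D = 1"
    and eq: "\<And>q c. (q, c) \<in> S \<Longrightarrow> c * poly D (int q) = poly P (int q)"
    and nz: "\<And>q c. (q, c) \<in> S \<Longrightarrow> poly D (int q) \<noteq> 0"
    and inf: "infinite (fst ` S)"
  shows "\<exists>G. \<forall>(q, c)\<in>S. c = poly G (int q)"
proof -
  have D0: "D \<noteq> 0" using monic by auto
  obtain G R where GR: "pseudo_divmod P D = (G, R)" by fastforce
  have P: "P = D * G + R" using pseudo_divmod(1)[OF D0 GR] monic by simp
  have rem: "(c - poly G (int q)) * poly D (int q) = poly R (int q)" if "(q, c) \<in> S" for q c
    using eq[OF that] by (simp add: P algebra_simps)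
  have "R = 0"
  proof (rule ccontr)
    assume "R \<noteq> 0"
    then have deg: "Polynomial.degree (map_poly real_of_int R) < Polynomial.degree (map_poly real_of_int D)"
      using pseudo_divmod(2)[OF D0 GR] by (simp add: degree_map_poly)
    have "((\<lambda>x. poly (map_poly real_of_int R) x / poly (map_poly real_of_int D) x) \<longlongrightarrow> 0) at_infinity"
      by (rule poly_divide_tendsto_0_at_infinity[OF deg])
    then have "((\<lambda>n. poly (map_poly real_of_int R) (real n) / poly (map_poly real_of_int D) (real n)) \<longlongrightarrow> 0) sequentially"
      by (rule filterlim_compose) (rule tendsto_of_nat)
    then have "\<forall>\<^sub>F n in sequentially. \<bar>poly (map_poly real_of_int R) (real n) / poly (map_poly real_of_int D) (real n)\<bar> < 1"
      using order_tendstoD(2)[OF tendsto_rabs, of _ 0 sequentially 1] by fastforce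
    then obtain N where N: "\<And>n. n \<ge> N \<Longrightarrow>
        \<bar>poly (map_poly real_of_int R) (real n) / poly (map_poly real_of_int D) (real n)\<bar> < 1"
      unfolding eventually_sequentially by blast
    have ev: "poly (map_poly real_of_int p) (real n) = real_of_int (poly p (int n))" for p n
      by (induction p) (simp_all add: map_poly_pCons)
    have "poly R (int q) = 0" if "(q, c) \<in> S" "q \<ge> N" for q c
    proof -
      have "\<bar>poly R (int q)\<bar> < \<bar>poly D (int q)\<bar>"
        using N[OF that(2)] nz[OF that(1)] unfolding ev
        by (simp add: abs_divide divide_less_eq flip: of_int_abs)
      then have "\<bar>c - poly G (int q)\<bar> * \<bar>poly D (int q)\<bar> < 1 * \<bar>poly D (int q)\<bar>"
        using rem[OF that(1)] by (simp flip: abs_mult)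
      then have "\<bar>c - poly G (int q)\<bar> < 1" by (rule mult_right_less_imp_less) simp
      then show ?thesis using rem[OF that(1)] by simp
    qed
    then have "int ` {q \<in> fst ` S. q \<ge> N} \<subseteq> {x. poly R x = 0}" by auto
    moreover have "finite {x. poly R x = 0}" using poly_roots_finite \<open>R \<noteq> 0\<close> by blast
    ultimately have "finite (int ` {q \<in> fst ` S. q \<ge> N})" using finite_subset by blast
    then have "finite {q \<in> fst ` S. q \<ge> N}" by (rule finite_imageD) simp
    moreover have "fst ` S \<subseteq> {q \<in> fst ` S. q \<ge> N} \<union> {..<N}" by auto
    ultimately show False using inf finite_subset by blast
  qed
  then have "c = poly G (int q)" if "(q, c) \<in> S" for q c
    using rem[OF that] nz[OF that] by simp
  then show ?thesis by blast
qed

lemma lead_coeff_injection_poly: "lead_coeff (injection_poly n n) = 1"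
proof -
  have "lead_coeff (Polynomial.monom 1 n - Polynomial.monom 1 i :: int poly) = 1" if "i < n" for i
  proof -
    have "Polynomial.degree (Polynomial.monom 1 n - Polynomial.monom 1 i :: int poly) = n"
      using that by (intro antisym degree_diff_le le_degree) (auto simp: degree_monom_eq)
    then show ?thesis using that by simp
  qed
  then show ?thesis by (simp add: injection_poly_def lead_coeff_prod)
qed

text \<open>For each field, \<open>grass_recursion\<close> gives the product of \<open>|Gr\<^sub>e(M)|\<close> with a monic polynomial.
  Infinitely many fields are needed for the division.\<close>

lemma quiver_grass_polynomial:
  fixes Q :: "('v, 'e) pre_digraph" and d :: "'v \<Rightarrow> nat"
  assumes inf: "infinite {card (carrier F) | (F :: ('f, 'g) ring_scheme) (A :: ('f, 'b, 'h) module_scheme) M m.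
      rigid_rep F A Q M m \<and> rigid_rep.dims F Q M = d}"
    and e: "e \<in> extensional (verts Q)"
  shows "\<exists>P. \<forall>(F :: ('f, 'g) ring_scheme) (A :: ('f, 'b, 'h) module_scheme) M m.
    rigid_rep F A Q M m \<and> rigid_rep.dims F Q M = d \<longrightarrow>
      int (card (rigid_rep.quiver_grass F A Q M m e)) = poly P (int (card (carrier F)))"
proof -
  define R where "R e P \<longleftrightarrow> (\<forall>(F :: ('f, 'g) ring_scheme) (A :: ('f, 'b, 'h) module_scheme) M m.
    rigid_rep F A Q M m \<and> rigid_rep.dims F Q M = d \<longrightarrow>
      int (card (rigid_rep.quiver_grass F A Q M m e)) = poly P (int (card (carrier F))))"
    for e and P :: "int poly"
  obtain x y :: "('v \<Rightarrow> nat) \<Rightarrow> int poly" where x: "\<forall>(F :: ('f, 'g) ring_scheme) (A :: ('f, 'b, 'h) module_scheme) M m V.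
    rigid_rep F A Q M m \<and> rigid_rep.dims F Q M = d \<and> rigid_rep.gspace F A Q V \<longrightarrow>
      int (card (rigid_rep.ext_zero_structures F A Q M m V)) = poly (x (rigid_rep.dims F Q V)) (int (card (carrier F))) \<and>
      int (card (rigid_rep.torsion_structures F A Q M m V)) = poly (y (rigid_rep.dims F Q V)) (int (card (carrier F)))"
    using ex_structure_polys[of Q d, where 'f='f and 'g='g and 'b='b and 'h='h] by blast
  from e have "\<exists>P. R e P"
  proof (induction "sum e (verts Q)" arbitrary: e rule: less_induct)
    case less
    show ?case
    proof (cases "\<forall>i\<in>verts Q. e i \<le> d i")
      case False
      then obtain i where i: "i \<in> verts Q" "\<not> e i \<le> d i" by blast
      have "R e 0"
        unfolding R_def
      proof (intro allI impI, elim conjE)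
        fix F :: "('f, 'g) ring_scheme" and A :: "('f, 'b, 'h) module_scheme" and M m
        assume *: "rigid_rep F A Q M m" "rigid_rep.dims F Q M = d"
        then have "rigid_rep.quiver_grass F A Q M m e = {}"
          using rigid_rep.quiver_grass_empty[OF *(1) i(1), of e] i(2) by metis
        then show "int (card (rigid_rep.quiver_grass F A Q M m e)) = poly 0 (int (card (carrier F)))" by simp
      qed
      then show ?thesis by blast
    next
      case True
      have "\<forall>f. \<exists>P. f \<in> extensional (verts Q) \<and> sum f (verts Q) < sum e (verts Q) \<longrightarrow> R f P"
        using less.hyps by blast
      then obtain g where g: "\<And>f. f \<in> extensional (verts Q) \<Longrightarrow> sum f (verts Q) < sum e (verts Q) \<Longrightarrow> R f (g f)"
        by metis
      let ?D = "\<Prod>i\<in>verts Q. injection_poly (e i) (e i)"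
      let ?S = "{(card (carrier F), int (card (rigid_rep.quiver_grass F A Q M m e))) |
          (F :: ('f, 'g) ring_scheme) (A :: ('f, 'b, 'h) module_scheme) M m.
          rigid_rep F A Q M m \<and> rigid_rep.dims F Q M = d}"
      have key: "int (card (rigid_rep.quiver_grass F A Q M m e)) * poly ?D (int (card (carrier F))) =
            poly (grass_poly Q d e x g) (int (card (carrier F))) \<and> poly ?D (int (card (carrier F))) \<noteq> 0"
        if *: "rigid_rep F A Q M m" "rigid_rep.dims F Q M = d"
        for F :: "('f, 'g) ring_scheme" and A :: "('f, 'b, 'h) module_scheme" and M m
      proof -
        interpret rigid_rep F A Q M m by fact
        have "int (card (quiver_grass e)) * poly ?D (int q) = poly (grass_poly Q (dims M) e x g) (int q)"
        proof (rule grass_recursion[OF less.prems])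
          show "e i \<le> dims M i" if "i \<in> verts Q" for i using True that *(2) by simp
          show "int (card (ext_zero_structures W)) = poly (x (dims W)) (int q)" if "gspace W" for W
            using x * that by blast
          fix f assume f: "f \<in> PiE (verts Q) (\<lambda>i. {..e i})" "f \<noteq> e"
          have "\<exists>i\<in>verts Q. f i \<noteq> e i"
          proof (rule ccontr)
            assume "\<not> (\<exists>i\<in>verts Q. f i \<noteq> e i)"
            then have "f = e" using f(1) less.prems by (intro extensionalityI[of _ "verts Q"]) (auto simp: PiE_iff)
            with f(2) show False by simp
          qed
          then have "sum f (verts Q) < sum e (verts Q)"
            using f(1) by (intro sum_strict_mono_ex1) (auto simp: PiE_iff le_less)
          then have "R f (g f)" using g f(1) by (simp add: PiE_iff)
          then show "int (card (quiver_grass f)) = poly (g f) (int q)" using * unfolding R_def by blast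
        qed
        moreover have "poly ?D (int q) > 0"
          unfolding poly_prod poly_injection_poly using q_ge_2 by (intro prod_pos prod_diff_power_pos) simp
        ultimately show ?thesis using *(2) by simp
      qed
      have "\<exists>G. \<forall>(q, c)\<in>?S. c = poly G (int q)"
      proof (rule integral_quotient_polynomial)
        show "lead_coeff ?D = 1" by (simp add: lead_coeff_prod lead_coeff_injection_poly)
        have "fst ` ?S = {card (carrier F) | (F :: ('f, 'g) ring_scheme) (A :: ('f, 'b, 'h) module_scheme) M m.
            rigid_rep F A Q M m \<and> rigid_rep.dims F Q M = d}" by force
        with inf show "infinite (fst ` ?S)" by simp
        fix q c assume "(q, c) \<in> ?S"
        then obtain F :: "('f, 'g) ring_scheme" and A :: "('f, 'b, 'h) module_scheme" and M m
          where *: "rigid_rep F A Q M m" "rigid_rep.dims F Q M = d"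
            "q = card (carrier F)" "c = int (card (rigid_rep.quiver_grass F A Q M m e))" by blast
        show "c * poly ?D (int q) = poly (grass_poly Q d e x g) (int q)" "poly ?D (int q) \<noteq> 0"
          using key[OF *(1,2)] *(3,4) by simp_all
      qed
      then obtain G where "\<forall>(q, c)\<in>?S. c = poly G (int q)" by blast
      then have "R e G" unfolding R_def by blast
      then show ?thesis by blast
    qed
  qed
  then show ?thesis unfolding R_def .
qed

section \<open>The number of elements of a base change\<close>

text \<open>That \<open>\<int>\<^sup>n \<otimes> F\<close> has as many elements as \<open>F\<^sup>n\<close>, for the tensor product by generators and
  relators. The section \<open>c \<mapsto> \<Sum>i. b i \<otimes> c i\<close> is surjective by biadditivity, and injective because the
  coordinates extend to the tensor product.\<close>

locale free_base_change =
  fixes V :: "(int, 'm) module" and F :: "'f ring" and n :: nat and b :: "nat \<Rightarrow> 'm"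
  assumes V_module: "module \<Z> V" and F_cring: "cring F" and basis: "is_basis \<Z> V n b"
begin

sublocale V: module \<Z> V by (rule V_module)
sublocale F: cring F by (rule F_cring)

abbreviation G where "G \<equiv> tensor_free V F"
abbreviation S where "S \<equiv> carrier V \<times> carrier F"
abbreviation H where "H \<equiv> generate G (tensor_relators V F)"

lemma b_closed: "i < n \<Longrightarrow> b i \<in> carrier V"
  using basis by (auto simp: is_basis_def)

definition comb :: "nat \<Rightarrow> (nat \<Rightarrow> int) \<Rightarrow> 'm" where
  "comb k c = (\<Oplus>\<^bsub>V\<^esub>i\<in>{..<k}. c i \<odot>\<^bsub>V\<^esub> b i)"

lemma comb_closed: "k \<le> n \<Longrightarrow> comb k c \<in> carrier V"
  unfolding comb_def using b_closed by (intro V.finsum_closed) auto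

lemma comb_0 [simp]: "comb 0 c = \<zero>\<^bsub>V\<^esub>"
  by (simp add: comb_def)

lemma comb_Suc: "Suc k \<le> n \<Longrightarrow> comb (Suc k) c = comb k c \<oplus>\<^bsub>V\<^esub> c k \<odot>\<^bsub>V\<^esub> b k"
  unfolding comb_def lessThan_Suc using b_closed
  by (subst V.finsum_insert) (auto intro: V.M.a_comm V.finsum_closed)

lemma comb_add: "k \<le> n \<Longrightarrow> comb k (\<lambda>i. c i + d i) = comb k c \<oplus>\<^bsub>V\<^esub> comb k d"
proof (induction k)
  case (Suc k)
  have "(c k + d k) \<odot>\<^bsub>V\<^esub> b k = c k \<odot>\<^bsub>V\<^esub> b k \<oplus>\<^bsub>V\<^esub> d k \<odot>\<^bsub>V\<^esub> b k"
    using V.smult_l_distr[of "c k" "d k" "b k"] b_closed Suc.prems by simp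
  then show ?case
    using Suc comb_closed[of k] b_closed[of k] by (simp add: comb_Suc V.M.a_ac)
qed simp

lemma comb_unit: "k \<le> n \<Longrightarrow> j < n \<Longrightarrow> comb k (\<lambda>i. if i = j then 1 else 0) = (if j < k then b j else \<zero>\<^bsub>V\<^esub>)"
proof (induction k)
  case (Suc k)
  have "(1::int) \<odot>\<^bsub>V\<^esub> b k = b k" "(0::int) \<odot>\<^bsub>V\<^esub> b k = \<zero>\<^bsub>V\<^esub>"
    using V.smult_one[of "b k"] V.smult_l_null[of "b k"] b_closed Suc.prems by simp_all
  then show ?case
    using Suc comb_closed[of k] b_closed[of k] b_closed[of j] by (auto simp: comb_Suc less_Suc_eq)
qed simp

definition coord :: "'m \<Rightarrow> nat \<Rightarrow> int" where
  "coord v = (THE c. c \<in> {..<n} \<rightarrow>\<^sub>E UNIV \<and> v = comb n c)"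

lemma ex1_coord: "v \<in> carrier V \<Longrightarrow> \<exists>!c. c \<in> {..<n} \<rightarrow>\<^sub>E (UNIV :: int set) \<and> v = comb n c"
  using basis by (simp add: is_basis_def comb_def)

lemma coord: "v \<in> carrier V \<Longrightarrow> v = comb n (coord v)"
  using theI'[OF ex1_coord] unfolding coord_def by blast

lemma comb_cong: "(\<And>i. i < k \<Longrightarrow> c i = d i) \<Longrightarrow> k \<le> n \<Longrightarrow> comb k c = comb k d"
  by (induction k) (auto simp: comb_Suc)

lemma coordI:
  assumes "v = comb n c" "i < n" shows "coord v i = c i"
proof -
  have v: "v \<in> carrier V" using assms comb_closed by simp
  have "v = comb n (restrict c {..<n})" unfolding assms(1) by (rule comb_cong) auto
  then have "restrict c {..<n} \<in> {..<n} \<rightarrow>\<^sub>E UNIV \<and> v = comb n (restrict c {..<n})" by auto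
  then have "coord v = restrict c {..<n}"
    unfolding coord_def by (rule the1_equality[OF ex1_coord[OF v]])
  with assms(2) show ?thesis by simp
qed

lemma coord_add: "v \<in> carrier V \<Longrightarrow> w \<in> carrier V \<Longrightarrow> i < n \<Longrightarrow> coord (v \<oplus>\<^bsub>V\<^esub> w) i = coord v i + coord w i"
  by (rule coordI) (use comb_add[of n "coord v" "coord w"] coord in auto)

lemma coord_b: "j < n \<Longrightarrow> i < n \<Longrightarrow> coord (b j) i = (if i = j then 1 else 0)"
  by (rule coordI) (auto simp: comb_unit)

lemma tensor_relatorsE:
  assumes "u \<in> tensor_relators V F"
  obtains (left) v w c where "v \<in> carrier V" "w \<in> carrier V" "c \<in> carrier F"
      "u = frag_of (v \<oplus>\<^bsub>V\<^esub> w, c) - frag_of (v, c) - frag_of (w, c)"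
    | (right) v c d where "v \<in> carrier V" "c \<in> carrier F" "d \<in> carrier F"
      "u = frag_of (v, c \<oplus>\<^bsub>F\<^esub> d) - frag_of (v, c) - frag_of (v, d)"
  using assms unfolding tensor_relators_def by blast

lemma relators_in: "tensor_relators V F \<subseteq> carrier G"
proof -
  have k: "Poly_Mapping.keys (frag_of x - frag_of y - frag_of z) \<subseteq> S" if "x \<in> S" "y \<in> S" "z \<in> S" for x y z
    using that keys_diff[of "frag_of x - frag_of y" "frag_of z"] keys_diff[of "frag_of x" "frag_of y"] by auto
  show ?thesis
  proof
    fix u assume "u \<in> tensor_relators V F"
    then obtain x y z where "x \<in> S" "y \<in> S" "z \<in> S" "u = frag_of x - frag_of y - frag_of z"
    proof (cases rule: tensor_relatorsE)
      case (left v w c)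
      then show thesis by (intro that[of "(v \<oplus>\<^bsub>V\<^esub> w, c)" "(v, c)" "(w, c)"]) simp_all
    next
      case (right v c d)
      then show thesis by (intro that[of "(v, c \<oplus>\<^bsub>F\<^esub> d)" "(v, c)" "(v, d)"]) simp_all
    qed
    then show "u \<in> carrier G" using k by simp
  qed
qed

lemma subgroup_H: "subgroup H G"
  using group.generate_is_subgroup[OF group_free_Abelian_group relators_in] .

lemma H_in: "u \<in> H \<Longrightarrow> Poly_Mapping.keys u \<subseteq> S"
  using subgroup.mem_carrier[OF subgroup_H] by simp

lemma H_zero: "0 \<in> H"
  using subgroup.one_closed[OF subgroup_H] by simp

lemma H_add: "u \<in> H \<Longrightarrow> v \<in> H \<Longrightarrow> u + v \<in> H"
  using subgroup.m_closed[OF subgroup_H] by simp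

lemma H_minus: "u \<in> H \<Longrightarrow> - u \<in> H"
  using subgroup.m_inv_closed[OF subgroup_H, of u] H_in[of u] by simp

lemma H_diff: "u \<in> H \<Longrightarrow> v \<in> H \<Longrightarrow> u - v \<in> H"
  using H_add[of u "- v"] H_minus[of v] by simp

definition cong :: "('m \<times> 'f \<Rightarrow>\<^sub>0 int) \<Rightarrow> ('m \<times> 'f \<Rightarrow>\<^sub>0 int) \<Rightarrow> bool" where
  "cong u v \<longleftrightarrow> u - v \<in> H"

lemma cong_refl: "cong u u" by (simp add: cong_def H_zero)
lemma cong_sym: "cong u v \<Longrightarrow> cong v u" using H_minus[of "u - v"] by (simp add: cong_def)
lemma cong_trans: "cong u v \<Longrightarrow> cong v w \<Longrightarrow> cong u w" using H_add[of "u - v" "v - w"] by (simp add: cong_def)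
lemma cong_plus: "cong u v \<Longrightarrow> cong u' v' \<Longrightarrow> cong (u + u') (v + v')"
  using H_add[of "u - v" "u' - v'"] by (simp add: cong_def algebra_simps)
lemma cong_diff: "cong u v \<Longrightarrow> cong u' v' \<Longrightarrow> cong (u - u') (v - v')"
  using H_diff[of "u - v" "u' - v'"] by (simp add: cong_def algebra_simps)

lemma relator_l:
  assumes "v \<in> carrier V" "w \<in> carrier V" "c \<in> carrier F"
  shows "cong (frag_of (v \<oplus>\<^bsub>V\<^esub> w, c)) (frag_of (v, c) + frag_of (w, c))"
proof -
  have "frag_of (v \<oplus>\<^bsub>V\<^esub> w, c) - frag_of (v, c) - frag_of (w, c) \<in> H"
    by (rule generate.incl) (use assms in \<open>auto simp: tensor_relators_def\<close>)
  then show ?thesis by (simp add: cong_def algebra_simps)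
qed

lemma relator_r:
  assumes "v \<in> carrier V" "c \<in> carrier F" "d \<in> carrier F"
  shows "cong (frag_of (v, c \<oplus>\<^bsub>F\<^esub> d)) (frag_of (v, c) + frag_of (v, d))"
proof -
  have "frag_of (v, c \<oplus>\<^bsub>F\<^esub> d) - frag_of (v, c) - frag_of (v, d) \<in> H"
    by (rule generate.incl) (use assms in \<open>auto simp: tensor_relators_def\<close>)
  then show ?thesis by (simp add: cong_def algebra_simps)
qed

lemma frag_zero_l: "c \<in> carrier F \<Longrightarrow> cong (frag_of (\<zero>\<^bsub>V\<^esub>, c)) 0"
  using relator_l[of "\<zero>\<^bsub>V\<^esub>" "\<zero>\<^bsub>V\<^esub>" c] H_minus[of "- frag_of (\<zero>\<^bsub>V\<^esub>, c)"] by (simp add: cong_def)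

lemma frag_zero_r: "v \<in> carrier V \<Longrightarrow> cong (frag_of (v, \<zero>\<^bsub>F\<^esub>)) 0"
  using relator_r[of v "\<zero>\<^bsub>F\<^esub>" "\<zero>\<^bsub>F\<^esub>"] H_minus[of "- frag_of (v, \<zero>\<^bsub>F\<^esub>)"] by (simp add: cong_def)

lemma frag_minus_r:
  assumes "v \<in> carrier V" "c \<in> carrier F" "d \<in> carrier F"
  shows "cong (frag_of (v, c \<ominus>\<^bsub>F\<^esub> d)) (frag_of (v, c) - frag_of (v, d))"
proof -
  have "c \<ominus>\<^bsub>F\<^esub> d \<oplus>\<^bsub>F\<^esub> d = c" using assms by (simp add: F.minus_eq F.a_assoc F.l_neg)
  then have "cong (frag_of (v, c)) (frag_of (v, c \<ominus>\<^bsub>F\<^esub> d) + frag_of (v, d))"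
    using relator_r[of v "c \<ominus>\<^bsub>F\<^esub> d" d] assms by simp
  then show ?thesis using cong_sym by (fastforce simp: cong_def algebra_simps)
qed

lemma add_pow_zero: "add_pow F (0 :: int) c = \<zero>\<^bsub>F\<^esub>"
  by (simp add: add_pow_def int_pow_def)

text \<open>Integers can be moved across the tensor sign by biadditivity alone.\<close>

lemma frag_int_smult:
  assumes v: "v \<in> carrier V" and c: "c \<in> carrier F"
  shows "cong (frag_of ((k::int) \<odot>\<^bsub>V\<^esub> v, c)) (frag_of (v, add_pow F (k) c))"
proof -
  have cl: "k \<odot>\<^bsub>V\<^esub> v \<in> carrier V" for k using V.smult_closed[of k v] v by simp
  have fl: "add_pow F (k) c \<in> carrier F" for k :: int using c by simp
  have Suc_l: "(k + 1) \<odot>\<^bsub>V\<^esub> v = k \<odot>\<^bsub>V\<^esub> v \<oplus>\<^bsub>V\<^esub> v" for k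
    using V.smult_l_distr[of k 1 v] V.smult_one[of v] v by simp
  have Suc_r: "add_pow F (k + 1) c = add_pow F (k) c \<oplus>\<^bsub>F\<^esub> c" for k :: int
    using F.add.int_pow_mult[of c k 1] c by simp
  have step: "cong (frag_of ((k + 1) \<odot>\<^bsub>V\<^esub> v, c) - frag_of (v, add_pow F (k + 1) c))
      (frag_of (k \<odot>\<^bsub>V\<^esub> v, c) - frag_of (v, add_pow F (k) c))" for k
    unfolding Suc_l Suc_r using cong_diff[OF relator_l[OF cl v c] relator_r[OF v fl c]]
    by (simp add: algebra_simps)
  have iff: "cong (frag_of ((k + 1) \<odot>\<^bsub>V\<^esub> v, c)) (frag_of (v, add_pow F (k + 1) c)) \<longleftrightarrow>
     cong (frag_of (k \<odot>\<^bsub>V\<^esub> v, c)) (frag_of (v, add_pow F (k) c))" for k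
    using cong_trans[OF cong_sym[OF step[of k]], of 0] cong_trans[OF step[of k], of 0] by (auto simp: cong_def)
  show ?thesis
  proof (induction k rule: int_induct[where k = 0])
    case base
    have "(0::int) \<odot>\<^bsub>V\<^esub> v = \<zero>\<^bsub>V\<^esub>" using V.smult_l_null[of v] v by simp
    moreover have "add_pow F (0::int) c = \<zero>\<^bsub>F\<^esub>" by (rule add_pow_zero)
    ultimately show ?case
      using cong_trans[OF frag_zero_l[OF c] cong_sym[OF frag_zero_r[OF v]]] by simp
  next
    case (step1 i)
    then show ?case using iff by blast
  next
    case (step2 i)
    then show ?case using iff[of "i - 1"] by simp
  qed
qed

definition section_map :: "(nat \<Rightarrow> 'f) \<Rightarrow> ('m \<times> 'f \<Rightarrow>\<^sub>0 int)" where
  "section_map c = (\<Sum>i<n. frag_of (b i, c i))"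

lemma cong_sum: "(\<And>i. i \<in> I \<Longrightarrow> cong (f i) (g i)) \<Longrightarrow> cong (sum f I) (sum g I)"
  by (induction I rule: infinite_finite_induct) (auto intro: cong_plus cong_refl)

lemma frag_comb:
  "k \<le> n \<Longrightarrow> c \<in> carrier F \<Longrightarrow> cong (frag_of (comb k a, c)) (\<Sum>i<k. frag_of (b i, add_pow F (a i) c))"
proof (induction k)
  case 0
  then show ?case using frag_zero_l by simp
next
  case (Suc k)
  have cl: "a k \<odot>\<^bsub>V\<^esub> b k \<in> carrier V" using V.smult_closed[of "a k" "b k"] b_closed Suc.prems by simp
  have 1: "cong (frag_of (comb (Suc k) a, c)) (frag_of (comb k a, c) + frag_of (a k \<odot>\<^bsub>V\<^esub> b k, c))"
    using relator_l[OF comb_closed cl] Suc.prems by (simp add: comb_Suc)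
  have 2: "cong (frag_of (comb k a, c) + frag_of (a k \<odot>\<^bsub>V\<^esub> b k, c))
     ((\<Sum>i<k. frag_of (b i, add_pow F (a i) c)) + frag_of (b k, add_pow F (a k) c))"
    using Suc b_closed by (intro cong_plus frag_int_smult) auto
  show ?case using cong_trans[OF 1 2] by simp
qed

lemma section_map_surj:
  assumes "Poly_Mapping.keys u \<subseteq> S"
  shows "\<exists>c\<in>{..<n} \<rightarrow>\<^sub>E carrier F. cong u (section_map c)"
  using assms
proof (induction u rule: frag_induction)
  case zero
  have "cong (section_map (\<lambda>i\<in>{..<n}. \<zero>\<^bsub>F\<^esub>)) (\<Sum>i<n. 0)"
    unfolding section_map_def using b_closed frag_zero_r by (intro cong_sum) auto
  from cong_sym[OF this] have "cong 0 (section_map (\<lambda>i\<in>{..<n}. \<zero>\<^bsub>F\<^esub>))" by simp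
  moreover have "(\<lambda>i\<in>{..<n}. \<zero>\<^bsub>F\<^esub>) \<in> {..<n} \<rightarrow>\<^sub>E carrier F" by auto
  ultimately show ?case by blast
next
  case (one p)
  obtain v c where p: "p = (v, c)" "v \<in> carrier V" "c \<in> carrier F" using one by auto
  have "cong (frag_of p) (section_map (\<lambda>i\<in>{..<n}. add_pow F (coord v i) c))"
    using frag_comb[of n c "coord v"] coord[OF p(2)] p by (simp add: section_map_def)
  moreover have "(\<lambda>i\<in>{..<n}. add_pow F (coord v i) c) \<in> {..<n} \<rightarrow>\<^sub>E carrier F" using p(3) by auto
  ultimately show ?case by blast
next
  case (diff u u')
  then obtain c c' where c: "c \<in> {..<n} \<rightarrow>\<^sub>E carrier F" "cong u (section_map c)"
    "c' \<in> {..<n} \<rightarrow>\<^sub>E carrier F" "cong u' (section_map c')" by blast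
  have "cong (section_map (\<lambda>i\<in>{..<n}. c i \<ominus>\<^bsub>F\<^esub> c' i)) (\<Sum>i<n. frag_of (b i, c i) - frag_of (b i, c' i))"
    unfolding section_map_def using b_closed c by (intro cong_sum) (auto intro!: frag_minus_r)
  from cong_sym[OF this]
  have "cong (section_map c - section_map c') (section_map (\<lambda>i\<in>{..<n}. c i \<ominus>\<^bsub>F\<^esub> c' i))"
    by (simp add: section_map_def sum_subtractf)
  from cong_trans[OF cong_diff[OF c(2,4)] this]
  have "cong (u - u') (section_map (\<lambda>i\<in>{..<n}. c i \<ominus>\<^bsub>F\<^esub> c' i))" .
  moreover have "(\<lambda>i\<in>{..<n}. c i \<ominus>\<^bsub>F\<^esub> c' i) \<in> {..<n} \<rightarrow>\<^sub>E carrier F" using c by auto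
  ultimately show ?case by blast
qed

text \<open>The map \<open>v \<otimes> c \<mapsto> coord v j * c\<close> respects the relators and recovers the \<open>j\<close>-th coefficient.\<close>

lemma section_map_inj:
  assumes c: "c \<in> {..<n} \<rightarrow>\<^sub>E carrier F" and d: "d \<in> {..<n} \<rightarrow>\<^sub>E carrier F"
    and eq: "cong (section_map c) (section_map d)"
  shows "c = d"
proof (rule PiE_ext[OF c d])
  fix j assume "j \<in> {..<n}"
  then have j: "j < n" by simp
  let ?f = "\<lambda>p. add_pow F (coord (fst p) j) (snd p)"
  have "?f ` S \<subseteq> carrier (add_monoid F)" by auto
  then obtain h where h: "h \<in> hom G (add_monoid F)" "\<And>p. p \<in> S \<Longrightarrow> h (frag_of p) = ?f p"
    by (rule comm_group.free_Abelian_group_universal[OF F.a_comm_group]) blast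
  have h_add: "h (u + v) = h u \<oplus>\<^bsub>F\<^esub> h v" "h u \<in> carrier F"
    if "Poly_Mapping.keys u \<subseteq> S" "Poly_Mapping.keys v \<subseteq> S" for u v
    using hom_mult[OF h(1), of u v] hom_in_carrier[OF h(1), of u] that by simp_all
  have h_zero: "h 0 = \<zero>\<^bsub>F\<^esub>"
    using hom_one[OF h(1) group_free_Abelian_group F.a_group] by simp
  have h_diff: "h (u - v) = h u \<ominus>\<^bsub>F\<^esub> h v" if uv: "Poly_Mapping.keys u \<subseteq> S" "Poly_Mapping.keys v \<subseteq> S" for u v
  proof -
    have k: "Poly_Mapping.keys (u - v) \<subseteq> S" using uv keys_diff[of u v] by auto
    have "h u = h (u - v) \<oplus>\<^bsub>F\<^esub> h v" using h_add(1)[OF k uv(2)] by simp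
    then show ?thesis using h_add(2)[OF k k] h_add(2)[OF uv(2,2)]
      by (simp add: F.minus_eq F.a_assoc F.r_neg)
  qed
  have kf: "Poly_Mapping.keys (frag_of p) \<subseteq> S" if "p \<in> S" for p using that by simp
  have rel: "h (frag_of x - frag_of y - frag_of z) = ?f x \<ominus>\<^bsub>F\<^esub> ?f y \<ominus>\<^bsub>F\<^esub> ?f z"
    if xyz: "x \<in> S" "y \<in> S" "z \<in> S" for x y z
  proof -
    have k: "Poly_Mapping.keys (frag_of x - frag_of y) \<subseteq> S"
      using xyz keys_diff[of "frag_of x" "frag_of y"] by auto
    show ?thesis
      by (simp only: h_diff[OF k kf[OF xyz(3)]] h_diff[OF kf[OF xyz(1)] kf[OF xyz(2)]] h(2)[OF xyz(1)] h(2)[OF xyz(2)] h(2)[OF xyz(3)])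
  qed
  have sum_diff: "(a \<oplus>\<^bsub>F\<^esub> a') \<ominus>\<^bsub>F\<^esub> a \<ominus>\<^bsub>F\<^esub> a' = \<zero>\<^bsub>F\<^esub>" if "a \<in> carrier F" "a' \<in> carrier F" for a a'
    using that F.a_comm[of a a'] by (simp add: F.minus_eq F.a_assoc F.r_neg)
  have "tensor_relators V F \<subseteq> kernel G (add_monoid F) h"
  proof
    fix u assume u: "u \<in> tensor_relators V F"
    then have "h u = \<zero>\<^bsub>F\<^esub>"
    proof (cases rule: tensor_relatorsE)
      case (left v w c)
      then show ?thesis
        using rel[of "(v \<oplus>\<^bsub>V\<^esub> w, c)" "(v, c)" "(w, c)"] j
        by (simp add: coord_add F.add.int_pow_mult sum_diff)
    next
      case (right v c d)
      then show ?thesis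
        using rel[of "(v, c \<oplus>\<^bsub>F\<^esub> d)" "(v, c)" "(v, d)"]
        by (simp add: F.add.int_pow_distrib sum_diff)
    qed
    then show "u \<in> kernel G (add_monoid F) h" using subsetD[OF relators_in u] by (simp add: kernel_def)
  qed
  moreover have "subgroup (kernel G (add_monoid F) h) G"
    by (rule group_hom.subgroup_kernel) (unfold group_hom_def group_hom_axioms_def, intro conjI group_free_Abelian_group F.a_group h(1))
  ultimately have H_ker: "H \<subseteq> kernel G (add_monoid F) h"
    using group.generate_subgroup_incl[OF group_free_Abelian_group] by blast
  have part: "h (\<Sum>i<k. frag_of (b i, c i)) = (if j < k then c j else \<zero>\<^bsub>F\<^esub>) \<and>
      Poly_Mapping.keys (\<Sum>i<k. frag_of (b i, c i)) \<subseteq> S"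
    if "k \<le> n" "c \<in> {..<n} \<rightarrow>\<^sub>E carrier F" for c k
    using that(1)
  proof (induction k)
    case (Suc k)
    have p: "(b k, c k) \<in> S" using b_closed Suc.prems that(2) by auto
    have hk: "h (frag_of (b k, c k)) = (if j = k then c k else \<zero>\<^bsub>F\<^esub>)"
      using h(2)[OF p] coord_b[of k j] j Suc.prems p by (simp add: add_pow_zero)
    have ks: "Poly_Mapping.keys (\<Sum>i<k. frag_of (b i, c i)) \<subseteq> S" using Suc by simp
    have "h (\<Sum>i<Suc k. frag_of (b i, c i)) = (if j < k then c j else \<zero>\<^bsub>F\<^esub>) \<oplus>\<^bsub>F\<^esub> (if j = k then c k else \<zero>\<^bsub>F\<^esub>)"
      using h_add(1)[OF ks kf[OF p]] Suc hk by simp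
    moreover have "c j \<in> carrier F" using that(2) j by auto
    moreover have "Poly_Mapping.keys (\<Sum>i<Suc k. frag_of (b i, c i)) \<subseteq> S"
      using keys_add[of "\<Sum>i<k. frag_of (b i, c i)" "frag_of (b k, c k)"] ks kf[OF p] by auto
    ultimately show ?case by auto
  qed (simp add: h_zero)
  have "h (section_map c - section_map d) = \<zero>\<^bsub>F\<^esub>"
    using eq H_ker unfolding cong_def by (auto simp: kernel_def)
  then have "c j \<ominus>\<^bsub>F\<^esub> d j = \<zero>\<^bsub>F\<^esub>"
    using h_diff part[OF le_refl c] part[OF le_refl d] j by (simp add: section_map_def)
  moreover have "c j \<in> carrier F" "d j \<in> carrier F" using c d j by auto
  ultimately show "c j = d j" by (metis F.add.inv_solve_right F.l_zero F.minus_eq F.zero_closed)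
qed

lemma card_tensor: "card (carrier (tensor_module V F)) = card (carrier F) ^ n"
proof -
  have "bij_betw (\<lambda>c. H #>\<^bsub>G\<^esub> section_map c) ({..<n} \<rightarrow>\<^sub>E carrier F) (rcosets\<^bsub>G\<^esub> H)"
  proof (rule bij_betw_imageI)
    have coset: "H #>\<^bsub>G\<^esub> u = {v. cong v u}" for u
    proof -
      have "v \<in> H #>\<^bsub>G\<^esub> u \<longleftrightarrow> (\<exists>h\<in>H. v = h + u)" for v by (simp add: r_coset_def)
      moreover have "(\<exists>h\<in>H. v = h + u) \<longleftrightarrow> cong v u" for v
        unfolding cong_def by (metis add_diff_cancel_right' diff_add_cancel)
      ultimately show ?thesis by blast
    qed
    have coset_eq: "H #>\<^bsub>G\<^esub> u = H #>\<^bsub>G\<^esub> v \<longleftrightarrow> cong u v" for u v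
      unfolding coset using cong_refl cong_sym cong_trans by blast
    show "inj_on (\<lambda>c. H #>\<^bsub>G\<^esub> section_map c) ({..<n} \<rightarrow>\<^sub>E carrier F)"
      using section_map_inj by (auto simp: inj_on_def coset_eq)
    show "(\<lambda>c. H #>\<^bsub>G\<^esub> section_map c) ` ({..<n} \<rightarrow>\<^sub>E carrier F) = rcosets\<^bsub>G\<^esub> H"
    proof
      have "section_map c \<in> carrier G" if "c \<in> {..<n} \<rightarrow>\<^sub>E carrier F" for c
        unfolding section_map_def
        by (rule sum_closed_free_Abelian_group) (use b_closed that in auto)
      then show "(\<lambda>c. H #>\<^bsub>G\<^esub> section_map c) ` ({..<n} \<rightarrow>\<^sub>E carrier F) \<subseteq> rcosets\<^bsub>G\<^esub> H"
        unfolding RCOSETS_def by blast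
      show "rcosets\<^bsub>G\<^esub> H \<subseteq> (\<lambda>c. H #>\<^bsub>G\<^esub> section_map c) ` ({..<n} \<rightarrow>\<^sub>E carrier F)"
      proof
        fix B assume "B \<in> rcosets\<^bsub>G\<^esub> H"
        then obtain u where u: "Poly_Mapping.keys u \<subseteq> S" "B = H #>\<^bsub>G\<^esub> u" by (auto simp: RCOSETS_def)
        then obtain c where "c \<in> {..<n} \<rightarrow>\<^sub>E carrier F" "cong u (section_map c)"
          using section_map_surj by blast
        then show "B \<in> (\<lambda>c. H #>\<^bsub>G\<^esub> section_map c) ` ({..<n} \<rightarrow>\<^sub>E carrier F)"
          using u(2) coset_eq by blast
      qed
    qed
  qed
  then have "card (rcosets\<^bsub>G\<^esub> H) = card ({..<n} \<rightarrow>\<^sub>E carrier F)"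
    using bij_betw_same_card by metis
  then show ?thesis by (simp add: tensor_module_def tensor_group_def FactGroup_def card_PiE)
qed

end

section \<open>Rank and cardinality\<close>

lemma is_basis_card:
  assumes V: "module F V" and b: "is_basis F V n b"
  shows "card (carrier V) = card (carrier F) ^ n"
proof -
  interpret module F V by fact
  let ?\<Phi> = "\<lambda>c. \<Oplus>\<^bsub>V\<^esub>i\<in>{..<n}. c i \<odot>\<^bsub>V\<^esub> b i"
  have bc: "b i \<in> carrier V" if "i < n" for i using b that by (auto simp: is_basis_def)
  have ex1: "\<exists>!c. c \<in> {..<n} \<rightarrow>\<^sub>E carrier F \<and> v = ?\<Phi> c" if "v \<in> carrier V" for v
    using b that by (auto simp: is_basis_def)
  have cl: "?\<Phi> c \<in> carrier V" if "c \<in> {..<n} \<rightarrow>\<^sub>E carrier F" for c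
    using that bc by (intro finsum_closed) (auto simp: PiE_iff)
  have "bij_betw ?\<Phi> ({..<n} \<rightarrow>\<^sub>E carrier F) (carrier V)"
  proof (rule bij_betw_imageI)
    show "inj_on ?\<Phi> ({..<n} \<rightarrow>\<^sub>E carrier F)"
    proof (rule inj_onI)
      fix c d assume c: "c \<in> {..<n} \<rightarrow>\<^sub>E carrier F" and d: "d \<in> {..<n} \<rightarrow>\<^sub>E carrier F" and "?\<Phi> c = ?\<Phi> d"
      with ex1[OF cl[OF c]] show "c = d" by blast
    qed
    show "?\<Phi> ` ({..<n} \<rightarrow>\<^sub>E carrier F) = carrier V"
    proof
      show "?\<Phi> ` ({..<n} \<rightarrow>\<^sub>E carrier F) \<subseteq> carrier V" using cl by blast
      show "carrier V \<subseteq> ?\<Phi> ` ({..<n} \<rightarrow>\<^sub>E carrier F)"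
      proof
        fix v assume "v \<in> carrier V"
        then obtain c where "c \<in> {..<n} \<rightarrow>\<^sub>E carrier F" "v = ?\<Phi> c" using ex1 by blast
        then show "v \<in> ?\<Phi> ` ({..<n} \<rightarrow>\<^sub>E carrier F)" by blast
      qed
    qed
  qed
  then show ?thesis using bij_betw_same_card by (fastforce simp: card_PiE)
qed

text \<open>A basis is built along the chain of subspaces in which one vector is adjoined at a time.\<close>

lemma ex_basis:
  assumes "finite_field_module F V" and fin: "finite (carrier V)"
  shows "\<exists>n. has_rank F V n"
proof -
  interpret finite_field_module F V by fact
  let ?\<Phi> = "\<lambda>(n :: nat) b c. \<Oplus>\<^bsub>V\<^esub>i\<in>{..<n}. c i \<odot>\<^bsub>V\<^esub> b i"
  have top: "subspace (carrier V)" by (rule subspaceI) auto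
  have "\<exists>(n :: nat) b. b \<in> {..<n} \<rightarrow> carrier V \<and> bij_betw (?\<Phi> n b) ({..<n} \<rightarrow>\<^sub>E carrier F) W"
    if "subspace W" "finite W" for W
    using that
  proof (induction W rule: subspace_zero_induct)
    case zero
    show ?case
    proof (rule exI[where x = 0], rule exI[where x = "\<lambda>_. \<zero>\<^bsub>V\<^esub>"], rule conjI)
      show "bij_betw (?\<Phi> 0 (\<lambda>_. \<zero>\<^bsub>V\<^esub>)) ({..<0} \<rightarrow>\<^sub>E carrier F) {\<zero>\<^bsub>V\<^esub>}"
        by (simp add: bij_betw_def)
    qed simp
  next
    case (adjoin U v)
    then obtain n b where b: "b \<in> {..<n} \<rightarrow> carrier V" "bij_betw (?\<Phi> n b) ({..<n} \<rightarrow>\<^sub>E carrier F) U" by blast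
    define b' where "b' = b(n := v)"
    have bc: "b i \<in> carrier V" if "i < n" for i using b that by auto
    have step: "?\<Phi> (Suc n) b' c = ?\<Phi> n b (restrict c {..<n}) \<oplus>\<^bsub>V\<^esub> c n \<odot>\<^bsub>V\<^esub> v"
      if "c \<in> {..<Suc n} \<rightarrow> carrier F" for c
    proof -
      have cc: "c i \<in> carrier F" if "i \<le> n" for i using that \<open>c \<in> {..<Suc n} \<rightarrow> carrier F\<close> by auto
      have "?\<Phi> (Suc n) b' c = c n \<odot>\<^bsub>V\<^esub> b' n \<oplus>\<^bsub>V\<^esub> ?\<Phi> n b' c"
        unfolding lessThan_Suc using cc bc adjoin by (intro finsum_insert) (auto simp: b'_def)
      also have "?\<Phi> n b' c = ?\<Phi> n b (restrict c {..<n})"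
        using cc bc by (intro finsum_cong') (auto simp: b'_def)
      finally show ?thesis
        using cc bc adjoin by (subst M.a_comm) (auto simp: b'_def intro!: finsum_closed)
    qed
    have UF: "(?\<Phi> n b (restrict c {..<n}), c n) \<in> U \<times> carrier F" "restrict c {..<n} \<in> {..<n} \<rightarrow>\<^sub>E carrier F"
      if "c \<in> {..<Suc n} \<rightarrow>\<^sub>E carrier F" for c
    proof -
      show r: "restrict c {..<n} \<in> {..<n} \<rightarrow>\<^sub>E carrier F" using that by (auto simp: PiE_iff)
      show "(?\<Phi> n b (restrict c {..<n}), c n) \<in> U \<times> carrier F"
        using bspec[OF bij_betwE[OF b(2)] r] that by (intro SigmaI) auto
    qed
    have "bij_betw (?\<Phi> (Suc n) b') ({..<Suc n} \<rightarrow>\<^sub>E carrier F) (adjoin U v)"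
    proof (rule bij_betw_imageI)
      show "inj_on (?\<Phi> (Suc n) b') ({..<Suc n} \<rightarrow>\<^sub>E carrier F)"
      proof (rule inj_onI)
        fix c d assume c: "c \<in> {..<Suc n} \<rightarrow>\<^sub>E carrier F" and d: "d \<in> {..<Suc n} \<rightarrow>\<^sub>E carrier F"
          and eq: "?\<Phi> (Suc n) b' c = ?\<Phi> (Suc n) b' d"
        have "c \<in> {..<Suc n} \<rightarrow> carrier F" "d \<in> {..<Suc n} \<rightarrow> carrier F" using c d by auto
        with eq have "(?\<Phi> n b (restrict c {..<n}), c n) = (?\<Phi> n b (restrict d {..<n}), d n)"
          using inj_onD[OF inj_on_adjoin[OF adjoin(1,6,5)] _ UF(1)[OF c] UF(1)[OF d]] step by simp
        then have eqs: "?\<Phi> n b (restrict c {..<n}) = ?\<Phi> n b (restrict d {..<n})" "c n = d n" by blast+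
        then have "restrict c {..<n} = restrict d {..<n}" "c n = d n"
          using inj_onD[OF bij_betw_imp_inj_on[OF b(2)] eqs(1) UF(2)[OF c] UF(2)[OF d]] by blast+
        then have "c i = d i" if "i < Suc n" for i
          using that by (metis lessThan_iff less_SucE restrict_apply')
        then show "c = d" using c d by (intro PiE_ext[of c _ _ d]) auto
      qed
      show "?\<Phi> (Suc n) b' ` ({..<Suc n} \<rightarrow>\<^sub>E carrier F) = adjoin U v"
      proof
        show "?\<Phi> (Suc n) b' ` ({..<Suc n} \<rightarrow>\<^sub>E carrier F) \<subseteq> adjoin U v"
        proof (rule image_subsetI)
          fix c assume c: "c \<in> {..<Suc n} \<rightarrow>\<^sub>E carrier F"
          then have "c \<in> {..<Suc n} \<rightarrow> carrier F" by auto
          then show "?\<Phi> (Suc n) b' c \<in> adjoin U v"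
            unfolding step[OF \<open>c \<in> {..<Suc n} \<rightarrow> carrier F\<close>] using UF(1)[OF c] by (intro adjoinI) auto
        qed
        show "adjoin U v \<subseteq> ?\<Phi> (Suc n) b' ` ({..<Suc n} \<rightarrow>\<^sub>E carrier F)"
        proof
          fix x assume "x \<in> adjoin U v"
          then obtain u k where x: "u \<in> U" "k \<in> carrier F" "x = u \<oplus>\<^bsub>V\<^esub> k \<odot>\<^bsub>V\<^esub> v" by (auto simp: adjoin_def)
          obtain c where c: "c \<in> {..<n} \<rightarrow>\<^sub>E carrier F" "u = ?\<Phi> n b c"
            using x(1) bij_betw_imp_surj_on[OF b(2)] by blast
          define c' where "c' = c(n := k)"
          have c': "c' \<in> {..<Suc n} \<rightarrow>\<^sub>E carrier F" using c x(2) by (auto simp: c'_def PiE_iff extensional_def)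
          have "restrict c' {..<n} = c" using c(1) by (auto simp: c'_def fun_eq_iff PiE_iff extensional_def)
          moreover have "c' \<in> {..<Suc n} \<rightarrow> carrier F" using c' by auto
          ultimately have "?\<Phi> (Suc n) b' c' = x" using step[of c'] x c by (simp add: c'_def)
          with c' show "x \<in> ?\<Phi> (Suc n) b' ` ({..<Suc n} \<rightarrow>\<^sub>E carrier F)" by blast
        qed
      qed
    qed
    moreover have "b' \<in> {..<Suc n} \<rightarrow> carrier V" using bc adjoin by (auto simp: b'_def less_Suc_eq)
    ultimately show ?case by blast
  qed
  from this[OF top fin] obtain n b
    where b: "b \<in> {..<n} \<rightarrow> carrier V" "bij_betw (?\<Phi> n b) ({..<n} \<rightarrow>\<^sub>E carrier F) (carrier V)" by blast
  have "\<exists>!c. c \<in> {..<n} \<rightarrow>\<^sub>E carrier F \<and> v = ?\<Phi> n b c" if "v \<in> carrier V" for v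
    using b(2) that unfolding bij_betw_def inj_on_def by blast
  then have "is_basis F V n b" unfolding is_basis_def by (intro conjI b(1) ballI)
  then show ?thesis unfolding has_rank_def by (intro exI)
qed

lemma has_rank_iff_card:
  assumes "finite_field_module F V" "finite (carrier V)"
  shows "has_rank F V n \<longleftrightarrow> card (carrier V) = card (carrier F) ^ n"
proof -
  interpret finite_field_module F V by fact
  have *: "card (carrier V) = q ^ k" if "has_rank F V k" for k
    using that is_basis_card[OF module_axioms] unfolding has_rank_def by blast
  obtain k where k: "has_rank F V k" using ex_basis[OF assms] by blast
  show ?thesis using * k q_power_inject by metis
qed

section \<open>What rigidity gives\<close>

text \<open>A structure that is merely the image of a module under a map compatible with the operations
  inherits all the laws.\<close>

lemma (in module) linear_image_module:
  fixes N :: "('a, 'n) module"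
  assumes add: "\<And>x y. x \<in> carrier M \<Longrightarrow> y \<in> carrier M \<Longrightarrow> f (x \<oplus>\<^bsub>M\<^esub> y) = f x \<oplus>\<^bsub>N\<^esub> f y"
    and smult: "\<And>c x. c \<in> carrier R \<Longrightarrow> x \<in> carrier M \<Longrightarrow> f (c \<odot>\<^bsub>M\<^esub> x) = c \<odot>\<^bsub>N\<^esub> f x"
    and surj: "f ` carrier M = carrier N" and zero: "f \<zero>\<^bsub>M\<^esub> = \<zero>\<^bsub>N\<^esub>"
  shows "module R N"
proof -
  have N: "\<exists>x'\<in>carrier M. x = f x'" if "x \<in> carrier N" for x using that surj by blast
  have fc: "f x \<in> carrier N" if "x \<in> carrier M" for x using that surj by blast
  show ?thesis
  proof (rule moduleI)
    show "cring R" by (rule is_cring)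
    show "abelian_group N"
    proof (rule abelian_groupI)
      fix x y assume "x \<in> carrier N" "y \<in> carrier N"
      then obtain x' y' where *: "x' \<in> carrier M" "x = f x'" "y' \<in> carrier M" "y = f y'" using N by blast
      then show "x \<oplus>\<^bsub>N\<^esub> y \<in> carrier N" using fc[of "x' \<oplus>\<^bsub>M\<^esub> y'"] by (simp add: add)
      show "x \<oplus>\<^bsub>N\<^esub> y = y \<oplus>\<^bsub>N\<^esub> x" using * by (simp add: add[symmetric] M.a_comm)
    next
      show "\<zero>\<^bsub>N\<^esub> \<in> carrier N" using fc[of "\<zero>\<^bsub>M\<^esub>"] zero by simp
    next
      fix x y z assume xyz: "x \<in> carrier N" "y \<in> carrier N" "z \<in> carrier N"
      obtain x' where "x' \<in> carrier M" "x = f x'" using N[OF xyz(1)] by blast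
      moreover obtain y' where "y' \<in> carrier M" "y = f y'" using N[OF xyz(2)] by blast
      moreover obtain z' where "z' \<in> carrier M" "z = f z'" using N[OF xyz(3)] by blast
      ultimately show "x \<oplus>\<^bsub>N\<^esub> y \<oplus>\<^bsub>N\<^esub> z = x \<oplus>\<^bsub>N\<^esub> (y \<oplus>\<^bsub>N\<^esub> z)" by (simp add: add[symmetric] M.a_assoc)
    next
      fix x assume "x \<in> carrier N"
      then obtain x' where *: "x' \<in> carrier M" "x = f x'" using N by blast
      then show "\<zero>\<^bsub>N\<^esub> \<oplus>\<^bsub>N\<^esub> x = x" using add[of "\<zero>\<^bsub>M\<^esub>" x'] zero by simp
      have "f (\<ominus>\<^bsub>M\<^esub> x') \<oplus>\<^bsub>N\<^esub> x = \<zero>\<^bsub>N\<^esub>"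
        using * add[of "\<ominus>\<^bsub>M\<^esub> x'" x'] zero by (simp add: M.l_neg)
      then show "\<exists>y\<in>carrier N. y \<oplus>\<^bsub>N\<^esub> x = \<zero>\<^bsub>N\<^esub>" using * fc by blast
    qed
  next
    fix a x assume "a \<in> carrier R" "x \<in> carrier N"
    then obtain x' where "x' \<in> carrier M" "x = f x'" using N by blast
    then show "a \<odot>\<^bsub>N\<^esub> x \<in> carrier N" using fc[of "a \<odot>\<^bsub>M\<^esub> x'"] \<open>a \<in> carrier R\<close> by (simp add: smult)
  next
    fix a b x assume "a \<in> carrier R" "b \<in> carrier R" "x \<in> carrier N"
    then obtain x' where "x' \<in> carrier M" "x = f x'" using N by blast
    then show "(a \<oplus> b) \<odot>\<^bsub>N\<^esub> x = a \<odot>\<^bsub>N\<^esub> x \<oplus>\<^bsub>N\<^esub> b \<odot>\<^bsub>N\<^esub> x" "(a \<otimes> b) \<odot>\<^bsub>N\<^esub> x = a \<odot>\<^bsub>N\<^esub> (b \<odot>\<^bsub>N\<^esub> x)"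
      using \<open>a \<in> carrier R\<close> \<open>b \<in> carrier R\<close>
      by (simp_all add: smult[symmetric] add[symmetric] smult_l_distr smult_assoc1)
  next
    fix a x y assume "a \<in> carrier R" "x \<in> carrier N" "y \<in> carrier N"
    then obtain x' y' where "x' \<in> carrier M" "x = f x'" "y' \<in> carrier M" "y = f y'" using N by blast
    then show "a \<odot>\<^bsub>N\<^esub> (x \<oplus>\<^bsub>N\<^esub> y) = a \<odot>\<^bsub>N\<^esub> x \<oplus>\<^bsub>N\<^esub> a \<odot>\<^bsub>N\<^esub> y"
      using \<open>a \<in> carrier R\<close> by (simp add: smult[symmetric] add[symmetric] smult_r_distr)
  next
    fix x assume "x \<in> carrier N"
    then obtain x' where "x' \<in> carrier M" "x = f x'" using N by blast
    then show "\<one> \<odot>\<^bsub>N\<^esub> x = x" by (simp add: smult[symmetric])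
  qed
qed

lemma linear_mapsD:
  assumes "f \<in> linear_maps R V W"
  shows "x \<in> carrier V \<Longrightarrow> f x \<in> carrier W"
    "x \<in> carrier V \<Longrightarrow> y \<in> carrier V \<Longrightarrow> f (x \<oplus>\<^bsub>V\<^esub> y) = f x \<oplus>\<^bsub>W\<^esub> f y"
    "c \<in> carrier R \<Longrightarrow> x \<in> carrier V \<Longrightarrow> f (c \<odot>\<^bsub>V\<^esub> x) = c \<odot>\<^bsub>W\<^esub> f x"
  using assms by (auto simp: linear_maps_def)

lemma linear_mapsI:
  assumes "\<And>x. x \<in> carrier V \<Longrightarrow> f x \<in> carrier W"
    "\<And>x y. x \<in> carrier V \<Longrightarrow> y \<in> carrier V \<Longrightarrow> f (x \<oplus>\<^bsub>V\<^esub> y) = f x \<oplus>\<^bsub>W\<^esub> f y"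
    "\<And>c x. c \<in> carrier R \<Longrightarrow> x \<in> carrier V \<Longrightarrow> f (c \<odot>\<^bsub>V\<^esub> x) = c \<odot>\<^bsub>W\<^esub> f x"
  shows "f \<in> linear_maps R V W"
  using assms by (auto simp: linear_maps_def)

lemma linear_maps_zero:
  assumes "module R V" "module R W" "f \<in> linear_maps R V W"
  shows "f \<zero>\<^bsub>V\<^esub> = \<zero>\<^bsub>W\<^esub>"
proof -
  interpret V: module R V by fact
  interpret W: module R W by fact
  have "f \<zero>\<^bsub>V\<^esub> \<oplus>\<^bsub>W\<^esub> f \<zero>\<^bsub>V\<^esub> = f \<zero>\<^bsub>V\<^esub>" using linear_mapsD(2)[OF assms(3), of "\<zero>\<^bsub>V\<^esub>" "\<zero>\<^bsub>V\<^esub>"] by simp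
  moreover have "f \<zero>\<^bsub>V\<^esub> \<in> carrier W" using linear_mapsD(1)[OF assms(3)] by simp
  ultimately show ?thesis by simp
qed

text \<open>A self-extension \<open>E\<close> of \<open>M\<close> is a representation that maps onto \<open>M\<close>, so \<open>M\<close> inherits the laws from
  \<open>E\<close>. In this way rigidity of a base change supplies the module laws for the tensor products.\<close>

lemma representation_if_rigid:
  assumes Q: "wf_digraph Q" and rigid: "rigid Q R M"
  shows "representation Q R M"
proof -
  have "Ext1 Q R M M \<noteq> {}" using rigid unfolding rigid_def is_singleton_def by blast
  then have "extensions Q R M M \<noteq> {}" unfolding Ext1_def quotient_def by blast
  then obtain E \<iota> \<pi> where ext: "(E, \<iota>, \<pi>) \<in> extensions Q R M M" by auto
  then have E: "representation Q R E" and \<iota>: "\<iota> \<in> rep_homs Q R M E" and \<pi>: "\<pi> \<in> rep_homs Q R E M"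
    and surj: "\<And>i. i \<in> verts Q \<Longrightarrow> \<pi> i ` carrier (space_at E i) = carrier (space_at M i)"
    and exact: "\<And>i. i \<in> verts Q \<Longrightarrow> \<iota> i ` carrier (space_at M i) = {x \<in> carrier (space_at E i). \<pi> i x = \<zero>\<^bsub>space_at M i\<^esub>}"
    by (auto simp: extensions_def)
  have mod: "module R (space_at M i)" if i: "i \<in> verts Q" for i
  proof -
    interpret E: module R "space_at E i" using E i by (simp add: representation_def)
    have \<pi>i: "\<pi> i \<in> linear_maps R (space_at E i) (space_at M i)" using \<pi> i by (simp add: rep_homs_def)
    have \<iota>i: "\<iota> i \<in> linear_maps R (space_at M i) (space_at E i)" using \<iota> i by (simp add: rep_homs_def)
    \<comment> \<open>That the zero of \<open>E\<close> goes to the zero of \<open>M\<close> follows from exactness: \<open>z\<close> is idempotent, hence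
        mapped to zero by \<open>\<iota>\<close>, so zero lies in the image of \<open>\<iota>\<close>, the kernel of \<open>\<pi>\<close>.\<close>
    define z where "z = \<pi> i \<zero>\<^bsub>space_at E i\<^esub>"
    have z: "z \<in> carrier (space_at M i)" unfolding z_def using linear_mapsD(1)[OF \<pi>i] by simp
    have "z \<oplus>\<^bsub>space_at M i\<^esub> z = z"
      unfolding z_def using linear_mapsD(2)[OF \<pi>i, of "\<zero>\<^bsub>space_at E i\<^esub>" "\<zero>\<^bsub>space_at E i\<^esub>"] by simp
    then have "\<iota> i z \<oplus>\<^bsub>space_at E i\<^esub> \<iota> i z = \<iota> i z" using linear_mapsD(2)[OF \<iota>i z z] by simp
    then have "\<iota> i z = \<zero>\<^bsub>space_at E i\<^esub>" using linear_mapsD(1)[OF \<iota>i z] by simp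
    then have "\<pi> i \<zero>\<^bsub>space_at E i\<^esub> = \<zero>\<^bsub>space_at M i\<^esub>" using exact[OF i] z by (metis (mono_tags, lifting) imageI mem_Collect_eq)
    then show ?thesis
      by (intro E.linear_image_module[of "\<pi> i"]) (use linear_mapsD[OF \<pi>i] surj[OF i] in auto)
  qed
  moreover have "map_at M \<alpha> \<in> linear_maps R (space_at M (tail Q \<alpha>)) (space_at M (head Q \<alpha>))"
    if a: "\<alpha> \<in> arcs Q" for \<alpha>
  proof -
    let ?s = "tail Q \<alpha>" and ?t = "head Q \<alpha>"
    have st: "?s \<in> verts Q" "?t \<in> verts Q" using Q a by (auto simp: wf_digraph_def)
    interpret E: module R "space_at E ?s" using E st by (simp add: representation_def)
    have Ea: "map_at E \<alpha> \<in> linear_maps R (space_at E ?s) (space_at E ?t)" using E a by (simp add: representation_def)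
    have \<pi>s: "\<pi> ?s \<in> linear_maps R (space_at E ?s) (space_at M ?s)" using \<pi> st by (simp add: rep_homs_def)
    have \<pi>t: "\<pi> ?t \<in> linear_maps R (space_at E ?t) (space_at M ?t)" using \<pi> st by (simp add: rep_homs_def)
    have comm: "map_at M \<alpha> (\<pi> ?s x) = \<pi> ?t (map_at E \<alpha> x)" if "x \<in> carrier (space_at E ?s)" for x
      using \<pi> a that by (simp add: rep_homs_def)
    have lift: "\<exists>x'\<in>carrier (space_at E ?s). x = \<pi> ?s x'" if "x \<in> carrier (space_at M ?s)" for x
      using surj[OF st(1)] that by blast
    show ?thesis
    proof (rule linear_mapsI)
      fix x assume "x \<in> carrier (space_at M ?s)"
      then obtain x' where "x' \<in> carrier (space_at E ?s)" "x = \<pi> ?s x'" using lift by blast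
      then show "map_at M \<alpha> x \<in> carrier (space_at M ?t)"
        using comm linear_mapsD(1)[OF Ea] linear_mapsD(1)[OF \<pi>t] by simp
    next
      fix x y assume "x \<in> carrier (space_at M ?s)" "y \<in> carrier (space_at M ?s)"
      then obtain x' y' where *: "x' \<in> carrier (space_at E ?s)" "x = \<pi> ?s x'"
        "y' \<in> carrier (space_at E ?s)" "y = \<pi> ?s y'" using lift by blast
      then have "map_at M \<alpha> (x \<oplus>\<^bsub>space_at M ?s\<^esub> y) = \<pi> ?t (map_at E \<alpha> (x' \<oplus>\<^bsub>space_at E ?s\<^esub> y'))"
        using comm[of "x' \<oplus>\<^bsub>space_at E ?s\<^esub> y'"] linear_mapsD(2)[OF \<pi>s] by simp
      then show "map_at M \<alpha> (x \<oplus>\<^bsub>space_at M ?s\<^esub> y) = map_at M \<alpha> x \<oplus>\<^bsub>space_at M ?t\<^esub> map_at M \<alpha> y"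
        using * comm linear_mapsD(1,2)[OF Ea] linear_mapsD(2)[OF \<pi>t] by simp
    next
      fix c x assume c: "c \<in> carrier R" and "x \<in> carrier (space_at M ?s)"
      then obtain x' where *: "x' \<in> carrier (space_at E ?s)" "x = \<pi> ?s x'" using lift by blast
      then have "map_at M \<alpha> (c \<odot>\<^bsub>space_at M ?s\<^esub> x) = \<pi> ?t (map_at E \<alpha> (c \<odot>\<^bsub>space_at E ?s\<^esub> x'))"
        using comm[of "c \<odot>\<^bsub>space_at E ?s\<^esub> x'"] linear_mapsD(3)[OF \<pi>s c] c by simp
      then show "map_at M \<alpha> (c \<odot>\<^bsub>space_at M ?s\<^esub> x) = c \<odot>\<^bsub>space_at M ?t\<^esub> map_at M \<alpha> x"
        using * c comm linear_mapsD(1,3)[OF Ea] linear_mapsD(3)[OF \<pi>t] by simp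
    qed
  qed
  ultimately show ?thesis by (simp add: representation_def)
qed

text \<open>The spaces of the extensions that are trivial as extensions of vector spaces.\<close>

definition square_module :: "('k, 'm) module \<Rightarrow> ('k, 'm \<times> 'm) module" where
  "square_module V = \<lparr>carrier = carrier V \<times> carrier V, monoid.mult = undefined, monoid.one = undefined,
     ring.zero = (\<zero>\<^bsub>V\<^esub>, \<zero>\<^bsub>V\<^esub>), ring.add = (\<lambda>x y. (fst x \<oplus>\<^bsub>V\<^esub> fst y, snd x \<oplus>\<^bsub>V\<^esub> snd y)),
     module.smult = (\<lambda>c x. (c \<odot>\<^bsub>V\<^esub> fst x, c \<odot>\<^bsub>V\<^esub> snd x))\<rparr>"

lemma square_module_simps [simp]:
  "carrier (square_module V) = carrier V \<times> carrier V"
  "\<zero>\<^bsub>square_module V\<^esub> = (\<zero>\<^bsub>V\<^esub>, \<zero>\<^bsub>V\<^esub>)"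
  "x \<oplus>\<^bsub>square_module V\<^esub> y = (fst x \<oplus>\<^bsub>V\<^esub> fst y, snd x \<oplus>\<^bsub>V\<^esub> snd y)"
  "c \<odot>\<^bsub>square_module V\<^esub> x = (c \<odot>\<^bsub>V\<^esub> fst x, c \<odot>\<^bsub>V\<^esub> snd x)"
  by (simp_all add: square_module_def)

lemma module_square:
  assumes "module R V" shows "module R (square_module V)"
proof -
  interpret module R V by fact
  show ?thesis
  proof (rule moduleI)
    show "cring R" by (rule is_cring)
    show "abelian_group (square_module V)"
    proof (rule abelian_groupI)
      fix x assume x: "x \<in> carrier (square_module V)"
      show "\<exists>y\<in>carrier (square_module V). y \<oplus>\<^bsub>square_module V\<^esub> x = \<zero>\<^bsub>square_module V\<^esub>"
        by (rule bexI[of _ "(\<ominus>\<^bsub>V\<^esub> fst x, \<ominus>\<^bsub>V\<^esub> snd x)"]) (use x in \<open>auto simp: M.l_neg\<close>)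
    qed (auto simp: M.a_ac)
  qed (auto simp: smult_l_distr smult_r_distr smult_assoc1)
qed

text \<open>A family \<open>\<psi>\<close> along the arrows is the cocycle of the extension with maps
  \<open>(b, a) \<mapsto> (M\<^sub>\<alpha> b + \<psi>\<^sub>\<alpha> a, M\<^sub>\<alpha> a)\<close>. An equivalence from the split extension to this one has the form
  \<open>(b, a) \<mapsto> (b + \<phi> a, a)\<close>, and its compatibility with the maps says that \<open>\<psi>\<close> is the coboundary of \<open>\<phi>\<close>.\<close>

lemma rigid_surjective:
  fixes Q :: "('v, 'e) pre_digraph" and M :: "('v, 'e, 'k, 'm) rep"
  assumes Q: "wf_digraph Q" and rigid: "rigid Q R M"
    and \<psi>: "\<And>\<alpha>. \<alpha> \<in> arcs Q \<Longrightarrow> \<psi> \<alpha> \<in> linear_maps R (space_at M (tail Q \<alpha>)) (space_at M (head Q \<alpha>))"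
  shows "\<exists>\<phi>. (\<forall>i\<in>verts Q. \<phi> i \<in> linear_maps R (space_at M i) (space_at M i)) \<and>
    (\<forall>\<alpha>\<in>arcs Q. \<forall>x\<in>carrier (space_at M (tail Q \<alpha>)).
      \<psi> \<alpha> x \<oplus>\<^bsub>space_at M (head Q \<alpha>)\<^esub> map_at M \<alpha> (\<phi> (tail Q \<alpha>) x) = \<phi> (head Q \<alpha>) (map_at M \<alpha> x))"
proof -
  have rep: "representation Q R M" by (rule representation_if_rigid[OF Q rigid])
  have mod: "module R (space_at M i)" if "i \<in> verts Q" for i using rep that by (simp add: representation_def)
  have st: "tail Q \<alpha> \<in> verts Q" "head Q \<alpha> \<in> verts Q" if "\<alpha> \<in> arcs Q" for \<alpha>
    using Q that by (auto simp: wf_digraph_def)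
  have map: "map_at M \<alpha> \<in> linear_maps R (space_at M (tail Q \<alpha>)) (space_at M (head Q \<alpha>))" if "\<alpha> \<in> arcs Q" for \<alpha>
    using rep that by (simp add: representation_def)
  \<comment> \<open>The first component is the subobject, the second one the quotient.\<close>
  define E where "E \<psi> = \<lparr>space_at = (\<lambda>i. square_module (space_at M i)),
    map_at = (\<lambda>\<alpha> x. (map_at M \<alpha> (fst x) \<oplus>\<^bsub>space_at M (head Q \<alpha>)\<^esub> \<psi> \<alpha> (snd x), map_at M \<alpha> (snd x)))\<rparr>"
    for \<psi> :: "'e \<Rightarrow> 'm \<Rightarrow> 'm"
  define \<iota> where "\<iota> i x = (x, \<zero>\<^bsub>space_at M i\<^esub>)" for i and x :: 'm
  define \<pi> :: "'v \<Rightarrow> 'm \<times> 'm \<Rightarrow> 'm" where "\<pi> i = snd" for i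
  have ext: "(E \<psi>, \<iota>, \<pi>) \<in> extensions Q R M M"
    if \<psi>: "\<And>\<alpha>. \<alpha> \<in> arcs Q \<Longrightarrow> \<psi> \<alpha> \<in> linear_maps R (space_at M (tail Q \<alpha>)) (space_at M (head Q \<alpha>))" for \<psi>
  proof -
    have "map_at (E \<psi>) \<alpha> \<in> linear_maps R (space_at (E \<psi>) (tail Q \<alpha>)) (space_at (E \<psi>) (head Q \<alpha>))"
      if a: "\<alpha> \<in> arcs Q" for \<alpha>
    proof -
      interpret s: module R "space_at M (tail Q \<alpha>)" using mod st a by blast
      interpret t: module R "space_at M (head Q \<alpha>)" using mod st a by blast
      note m = linear_mapsD[OF map[OF a]] linear_mapsD[OF \<psi>[OF a]]
      show ?thesis
        by (rule linear_mapsI) (auto simp: E_def m t.M.a_ac t.smult_r_distr)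
    qed
    then have 1: "representation Q R (E \<psi>)"
      using module_square mod by (auto simp: representation_def E_def)
    have 2: "\<iota> \<in> rep_homs Q R M (E \<psi>)"
    proof -
      have "\<iota> i \<in> linear_maps R (space_at M i) (space_at (E \<psi>) i)" if "i \<in> verts Q" for i
      proof -
        interpret module R "space_at M i" using mod that by blast
        show ?thesis by (rule linear_mapsI) (auto simp: E_def \<iota>_def)
      qed
      moreover have "\<iota> (head Q \<alpha>) (map_at M \<alpha> x) = map_at (E \<psi>) \<alpha> (\<iota> (tail Q \<alpha>) x)"
        if a: "\<alpha> \<in> arcs Q" and x: "x \<in> carrier (space_at M (tail Q \<alpha>))" for \<alpha> x
      proof -
        interpret t: module R "space_at M (head Q \<alpha>)" using mod st a by blast
        note ms = mod[OF st(1)[OF a]] and mt = mod[OF st(2)[OF a]]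
        show ?thesis
          using linear_maps_zero[OF ms mt map[OF a]] linear_maps_zero[OF ms mt \<psi>[OF a]]
            linear_mapsD(1)[OF map[OF a] x] by (simp add: E_def \<iota>_def)
      qed
      ultimately show ?thesis by (simp add: rep_homs_def)
    qed
    have 3: "\<pi> \<in> rep_homs Q R (E \<psi>) M"
      by (auto simp: rep_homs_def linear_maps_def E_def \<pi>_def)
    have 4: "inj_on (\<iota> i) (carrier (space_at M i)) \<and>
        \<pi> i ` carrier (space_at (E \<psi>) i) = carrier (space_at M i) \<and>
        \<iota> i ` carrier (space_at M i) = {x \<in> carrier (space_at (E \<psi>) i). \<pi> i x = \<zero>\<^bsub>space_at M i\<^esub>}"
      if "i \<in> verts Q" for i
    proof -
      interpret module R "space_at M i" using mod that by blast
      show ?thesis by (force simp: inj_on_def E_def \<iota>_def \<pi>_def image_iff)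
    qed
    show ?thesis using 1 2 3 4 by (simp add: extensions_def)
  qed
  have \<psi>0: "(\<lambda>_. \<zero>\<^bsub>space_at M (head Q \<alpha>)\<^esub>) \<in> linear_maps R (space_at M (tail Q \<alpha>)) (space_at M (head Q \<alpha>))"
    if "\<alpha> \<in> arcs Q" for \<alpha>
  proof -
    interpret module R "space_at M (head Q \<alpha>)" using mod st that by blast
    show ?thesis by (rule linear_mapsI) auto
  qed
  \<comment> \<open>The cocycle zero gives the split extension.\<close>
  define E0 where "E0 = E (\<lambda>\<alpha> _. \<zero>\<^bsub>space_at M (head Q \<alpha>)\<^esub>)"
  let ?r = "extension_equiv Q R M M"
  have e0: "(E0, \<iota>, \<pi>) \<in> extensions Q R M M" unfolding E0_def by (rule ext[OF \<psi>0])
  have e1: "(E \<psi>, \<iota>, \<pi>) \<in> extensions Q R M M" by (rule ext[OF \<psi>])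
  have refl: "((E \<psi>, \<iota>, \<pi>), (E \<psi>, \<iota>, \<pi>)) \<in> ?r"
  proof -
    have "(\<lambda>_ x. x) \<in> rep_isos Q R (E \<psi>) (E \<psi>)"
      by (auto simp: rep_isos_def rep_homs_def linear_maps_def bij_betw_def)
    then show ?thesis using e1 unfolding extension_equiv_def by fast
  qed
  have "?r `` {(E0, \<iota>, \<pi>)} \<in> Ext1 Q R M M" "?r `` {(E \<psi>, \<iota>, \<pi>)} \<in> Ext1 Q R M M"
    using e0 e1 by (auto simp: Ext1_def quotient_def)
  then have "?r `` {(E0, \<iota>, \<pi>)} = ?r `` {(E \<psi>, \<iota>, \<pi>)}"
    using rigid unfolding rigid_def is_singleton_def by auto
  with refl have "((E0, \<iota>, \<pi>), (E \<psi>, \<iota>, \<pi>)) \<in> ?r" by blast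
  then obtain \<theta> where \<theta>: "\<theta> \<in> rep_isos Q R E0 (E \<psi>)"
    "\<And>i x. i \<in> verts Q \<Longrightarrow> x \<in> carrier (space_at M i) \<Longrightarrow> \<theta> i (\<iota> i x) = \<iota> i x"
    "\<And>i x. i \<in> verts Q \<Longrightarrow> x \<in> carrier (space_at E0 i) \<Longrightarrow> \<pi> i (\<theta> i x) = \<pi> i x"
    unfolding extension_equiv_def by fast
  define \<phi> where "\<phi> i x = fst (\<theta> i (\<zero>\<^bsub>space_at M i\<^esub>, x))" for i x
  have \<theta>lin: "\<theta> i \<in> linear_maps R (square_module (space_at M i)) (square_module (space_at M i))" if "i \<in> verts Q" for i
    using \<theta>(1) that by (simp add: rep_isos_def rep_homs_def E0_def E_def)
  have \<theta>0: "\<theta> i (\<zero>\<^bsub>space_at M i\<^esub>, x) = (\<phi> i x, x)" if i: "i \<in> verts Q" and x: "x \<in> carrier (space_at M i)" for i x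
  proof -
    interpret module R "space_at M i" using mod i by blast
    have "snd (\<theta> i (\<zero>\<^bsub>space_at M i\<^esub>, x)) = x"
      using \<theta>(3)[OF i, of "(\<zero>\<^bsub>space_at M i\<^esub>, x)"] x by (simp add: \<pi>_def E0_def E_def)
    then show ?thesis by (simp add: \<phi>_def prod_eq_iff)
  qed
  have "\<phi> i \<in> linear_maps R (space_at M i) (space_at M i)" if i: "i \<in> verts Q" for i
  proof -
    interpret module R "space_at M i" using mod i by blast
    note l = linear_mapsD[OF \<theta>lin[OF i]]
    show ?thesis
    proof (rule linear_mapsI)
      show "\<phi> i x \<in> carrier (space_at M i)" if "x \<in> carrier (space_at M i)" for x
        using l(1)[of "(\<zero>\<^bsub>space_at M i\<^esub>, x)"] that \<theta>0[OF i that] by simp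
      show "\<phi> i (x \<oplus>\<^bsub>space_at M i\<^esub> y) = \<phi> i x \<oplus>\<^bsub>space_at M i\<^esub> \<phi> i y"
        if "x \<in> carrier (space_at M i)" "y \<in> carrier (space_at M i)" for x y
        using l(2)[of "(\<zero>\<^bsub>space_at M i\<^esub>, x)" "(\<zero>\<^bsub>space_at M i\<^esub>, y)"] that \<theta>0[OF i] by simp
      show "\<phi> i (c \<odot>\<^bsub>space_at M i\<^esub> x) = c \<odot>\<^bsub>space_at M i\<^esub> \<phi> i x"
        if "c \<in> carrier R" "x \<in> carrier (space_at M i)" for c x
        using l(3)[of c "(\<zero>\<^bsub>space_at M i\<^esub>, x)"] that \<theta>0[OF i] by simp
    qed
  qed
  moreover have "\<psi> \<alpha> x \<oplus>\<^bsub>space_at M (head Q \<alpha>)\<^esub> map_at M \<alpha> (\<phi> (tail Q \<alpha>) x) = \<phi> (head Q \<alpha>) (map_at M \<alpha> x)"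
    if a: "\<alpha> \<in> arcs Q" and x: "x \<in> carrier (space_at M (tail Q \<alpha>))" for \<alpha> x
  proof -
    interpret s: module R "space_at M (tail Q \<alpha>)" using mod st a by blast
    interpret t: module R "space_at M (head Q \<alpha>)" using mod st a by blast
    have Mx: "map_at M \<alpha> x \<in> carrier (space_at M (head Q \<alpha>))" using linear_mapsD(1)[OF map[OF a] x] .
    have mz: "map_at M \<alpha> \<zero>\<^bsub>space_at M (tail Q \<alpha>)\<^esub> = \<zero>\<^bsub>space_at M (head Q \<alpha>)\<^esub>"
      using linear_maps_zero[OF mod[OF st(1)[OF a]] mod[OF st(2)[OF a]] map[OF a]] .
    have \<phi>x: "\<phi> (tail Q \<alpha>) x \<in> carrier (space_at M (tail Q \<alpha>))"
      using linear_mapsD(1)[OF \<theta>lin[OF st(1)[OF a]], of "(\<zero>\<^bsub>space_at M (tail Q \<alpha>)\<^esub>, x)"] \<theta>0[OF st(1)[OF a] x] x by simp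
    have "\<theta> (head Q \<alpha>) (map_at E0 \<alpha> (\<zero>\<^bsub>space_at M (tail Q \<alpha>)\<^esub>, x)) =
        map_at (E \<psi>) \<alpha> (\<theta> (tail Q \<alpha>) (\<zero>\<^bsub>space_at M (tail Q \<alpha>)\<^esub>, x))"
      using \<theta>(1) a x by (simp add: rep_isos_def rep_homs_def E0_def E_def)
    then have "(\<phi> (head Q \<alpha>) (map_at M \<alpha> x), map_at M \<alpha> x) =
        (map_at M \<alpha> (\<phi> (tail Q \<alpha>) x) \<oplus>\<^bsub>space_at M (head Q \<alpha>)\<^esub> \<psi> \<alpha> x, map_at M \<alpha> x)"
      using \<theta>0[OF st(1)[OF a] x] \<theta>0[OF st(2)[OF a] Mx] by (simp add: E0_def E_def mz)
    then show ?thesis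
      using linear_mapsD(1)[OF \<psi>[OF a] x] linear_mapsD(1)[OF map[OF a] \<phi>x] by (simp add: t.M.a_comm)
  qed
  ultimately show ?thesis by blast
qed

section \<open>All spaces inside one module\<close>

text \<open>The ambient module: the spaces of a representation are embedded as the factors of their product.\<close>

definition product_module :: "'v set \<Rightarrow> ('v \<Rightarrow> ('k, 'm) module) \<Rightarrow> ('k, 'v \<Rightarrow> 'm) module" where
  "product_module I V = \<lparr>carrier = PiE I (\<lambda>i. carrier (V i)), monoid.mult = undefined, monoid.one = undefined,
     ring.zero = (\<lambda>i\<in>I. \<zero>\<^bsub>V i\<^esub>), ring.add = (\<lambda>x y. \<lambda>i\<in>I. x i \<oplus>\<^bsub>V i\<^esub> y i),
     module.smult = (\<lambda>c x. \<lambda>i\<in>I. c \<odot>\<^bsub>V i\<^esub> x i)\<rparr>"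

lemma product_module_simps [simp]:
  "carrier (product_module I V) = PiE I (\<lambda>i. carrier (V i))"
  "\<zero>\<^bsub>product_module I V\<^esub> = (\<lambda>i\<in>I. \<zero>\<^bsub>V i\<^esub>)"
  "x \<oplus>\<^bsub>product_module I V\<^esub> y = (\<lambda>i\<in>I. x i \<oplus>\<^bsub>V i\<^esub> y i)"
  "c \<odot>\<^bsub>product_module I V\<^esub> x = (\<lambda>i\<in>I. c \<odot>\<^bsub>V i\<^esub> x i)"
  by (simp_all add: product_module_def)

lemma module_product:
  assumes R: "cring R" and V: "\<And>i. i \<in> I \<Longrightarrow> module R (V i)"
  shows "module R (product_module I V)"
proof -
  interpret R: cring R by fact
  have ab: "abelian_group (V i)" if "i \<in> I" for i using V[OF that] by (simp add: module_def)
  have closed: "x \<oplus>\<^bsub>V i\<^esub> y \<in> carrier (V i)" if "i \<in> I" "x \<in> carrier (V i)" "y \<in> carrier (V i)" for i x y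
    using abelian_monoid.a_closed[OF abelian_group.axioms(1)[OF ab[OF that(1)]]] that by blast
  have assoc: "x \<oplus>\<^bsub>V i\<^esub> y \<oplus>\<^bsub>V i\<^esub> z = x \<oplus>\<^bsub>V i\<^esub> (y \<oplus>\<^bsub>V i\<^esub> z)"
    if "i \<in> I" "x \<in> carrier (V i)" "y \<in> carrier (V i)" "z \<in> carrier (V i)" for i x y z
    using abelian_monoid.a_assoc[OF abelian_group.axioms(1)[OF ab[OF that(1)]]] that by blast
  have comm: "x \<oplus>\<^bsub>V i\<^esub> y = y \<oplus>\<^bsub>V i\<^esub> x" if "i \<in> I" "x \<in> carrier (V i)" "y \<in> carrier (V i)" for i x y
    using abelian_monoid.a_comm[OF abelian_group.axioms(1)[OF ab[OF that(1)]]] that by blast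
  have zero: "\<zero>\<^bsub>V i\<^esub> \<in> carrier (V i)" if "i \<in> I" for i
    using abelian_monoid.zero_closed[OF abelian_group.axioms(1)[OF ab[OF that(1)]]] .
  have l_zero: "\<zero>\<^bsub>V i\<^esub> \<oplus>\<^bsub>V i\<^esub> x = x" if "i \<in> I" "x \<in> carrier (V i)" for i x
    using abelian_monoid.l_zero[OF abelian_group.axioms(1)[OF ab[OF that(1)]] that(2)] .
  have neg: "\<ominus>\<^bsub>V i\<^esub> x \<in> carrier (V i)" "\<ominus>\<^bsub>V i\<^esub> x \<oplus>\<^bsub>V i\<^esub> x = \<zero>\<^bsub>V i\<^esub>" if "i \<in> I" "x \<in> carrier (V i)" for i x
    using abelian_group.a_inv_closed[OF ab[OF that(1)] that(2)] abelian_group.l_neg[OF ab[OF that(1)] that(2)] .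
  note mods = module.smult_closed[OF V] module.smult_l_distr[OF V] module.smult_r_distr[OF V]
    module.smult_assoc1[OF V] module.smult_one[OF V]
  show ?thesis
  proof (rule moduleI)
    show "cring R" by fact
    show "abelian_group (product_module I V)"
    proof (rule abelian_groupI)
      fix x assume x: "x \<in> carrier (product_module I V)"
      show "\<exists>y\<in>carrier (product_module I V). y \<oplus>\<^bsub>product_module I V\<^esub> x = \<zero>\<^bsub>product_module I V\<^esub>"
        by (rule bexI[of _ "\<lambda>i\<in>I. \<ominus>\<^bsub>V i\<^esub> x i"]) (use x neg in \<open>auto simp: PiE_iff intro!: restrict_ext\<close>)
      show "\<zero>\<^bsub>product_module I V\<^esub> \<oplus>\<^bsub>product_module I V\<^esub> x = x"
        using x l_zero by (auto simp: PiE_iff extensional_def fun_eq_iff)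
    next
      fix x y assume "x \<in> carrier (product_module I V)" "y \<in> carrier (product_module I V)"
      then show "x \<oplus>\<^bsub>product_module I V\<^esub> y \<in> carrier (product_module I V)"
        "x \<oplus>\<^bsub>product_module I V\<^esub> y = y \<oplus>\<^bsub>product_module I V\<^esub> x"
        using closed comm by (auto simp: PiE_iff intro!: restrict_ext)
    next
      fix x y z assume "x \<in> carrier (product_module I V)" "y \<in> carrier (product_module I V)"
        "z \<in> carrier (product_module I V)"
      then show "x \<oplus>\<^bsub>product_module I V\<^esub> y \<oplus>\<^bsub>product_module I V\<^esub> z =
          x \<oplus>\<^bsub>product_module I V\<^esub> (y \<oplus>\<^bsub>product_module I V\<^esub> z)"
        using assoc by (auto simp: PiE_iff intro!: restrict_ext)
    qed (use zero in auto)
  next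
    fix x assume "x \<in> carrier (product_module I V)"
    then show "\<one>\<^bsub>R\<^esub> \<odot>\<^bsub>product_module I V\<^esub> x = x"
      using mods(5) by (auto simp: PiE_iff extensional_def fun_eq_iff)
  qed (auto simp: PiE_iff mods intro!: restrict_ext)
qed

declare product_module_simps [simp del]

locale finite_rigid =
  fixes Q :: "('v, 'e) pre_digraph" and F :: "'f ring" and M :: "('v, 'e, 'f, 'm) rep"
  assumes Q: "fin_digraph Q" and F_field: "field F" and F_finite: "finite (carrier F)"
    and M_rigid: "rigid Q F M" and M_finite: "i \<in> verts Q \<Longrightarrow> finite (carrier (space_at M i))"
begin

lemma wf: "wf_digraph Q"
  using Q by (simp add: fin_digraph_def)

lemma tail_in [simp]: "\<alpha> \<in> arcs Q \<Longrightarrow> tail Q \<alpha> \<in> verts Q"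
  and head_in [simp]: "\<alpha> \<in> arcs Q \<Longrightarrow> head Q \<alpha> \<in> verts Q"
  using wf by (auto simp: wf_digraph_def)

lemma M_representation: "representation Q F M"
  by (rule representation_if_rigid[OF wf M_rigid])

lemma M_module: "i \<in> verts Q \<Longrightarrow> module F (space_at M i)"
  using M_representation by (simp add: representation_def)

lemma M_map: "\<alpha> \<in> arcs Q \<Longrightarrow> map_at M \<alpha> \<in> linear_maps F (space_at M (tail Q \<alpha>)) (space_at M (head Q \<alpha>))"
  using M_representation by (simp add: representation_def)

abbreviation A where "A \<equiv> product_module (verts Q) (space_at M)"
abbreviation car where "car i \<equiv> carrier (space_at M i)"

sublocale A: finite_field_module F A
proof -
  have "cring F" using F_field by (simp add: field_def domain_def)
  then have "module F A" using M_module by (rule module_product)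
  then show "finite_field_module F A"
    by (simp add: finite_field_module_def finite_field_module_axioms_def F_field F_finite)
qed

definition emb :: "'v \<Rightarrow> 'm \<Rightarrow> 'v \<Rightarrow> 'm" where
  "emb i x = (\<lambda>j\<in>verts Q. if j = i then x else \<zero>\<^bsub>space_at M j\<^esub>)"

lemma emb_at [simp]: "i \<in> verts Q \<Longrightarrow> emb i x i = x"
  by (simp add: emb_def)

lemma emb_closed: 
  assumes "i \<in> verts Q" "x \<in> car i" shows "emb i x \<in> carrier A"
proof -
  have "\<zero>\<^bsub>space_at M j\<^esub> \<in> car j" if "j \<in> verts Q" for j
  proof -
    interpret module F "space_at M j" using M_module that by blast
    show ?thesis by simp
  qed
  then show ?thesis using assms by (simp add: emb_def product_module_simps)
qed

lemma emb_add:
  assumes "i \<in> verts Q" "x \<in> car i" "y \<in> car i"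
  shows "emb i (x \<oplus>\<^bsub>space_at M i\<^esub> y) = emb i x \<oplus>\<^bsub>A\<^esub> emb i y"
proof -
  have "\<zero>\<^bsub>space_at M j\<^esub> = \<zero>\<^bsub>space_at M j\<^esub> \<oplus>\<^bsub>space_at M j\<^esub> \<zero>\<^bsub>space_at M j\<^esub>" if "j \<in> verts Q" for j
  proof -
    interpret module F "space_at M j" using M_module that by blast
    show ?thesis by simp
  qed
  then show ?thesis by (auto simp: emb_def product_module_simps intro!: restrict_ext)
qed

lemma emb_smult:
  assumes "i \<in> verts Q" "c \<in> carrier F" "x \<in> car i"
  shows "emb i (c \<odot>\<^bsub>space_at M i\<^esub> x) = c \<odot>\<^bsub>A\<^esub> emb i x"
proof -
  have "\<zero>\<^bsub>space_at M j\<^esub> = c \<odot>\<^bsub>space_at M j\<^esub> \<zero>\<^bsub>space_at M j\<^esub>" if "j \<in> verts Q" for j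
  proof -
    interpret module F "space_at M j" using M_module that by blast
    show ?thesis using assms by simp
  qed
  then show ?thesis by (auto simp: emb_def product_module_simps intro!: restrict_ext)
qed

lemma emb_zero: "emb i \<zero>\<^bsub>space_at M i\<^esub> = \<zero>\<^bsub>A\<^esub>"
  by (auto simp: emb_def product_module_simps intro!: restrict_ext)

lemma emb_inject: "i \<in> verts Q \<Longrightarrow> emb i x = emb i y \<longleftrightarrow> x = y"
  using emb_at by metis

lemma inj_emb: "i \<in> verts Q \<Longrightarrow> inj_on (emb i) W"
  by (simp add: inj_on_def emb_inject)

definition space :: "'v \<Rightarrow> ('v \<Rightarrow> 'm) set" where
  "space i = emb i ` car i"

definition arrow :: "'e \<Rightarrow> ('v \<Rightarrow> 'm) \<Rightarrow> 'v \<Rightarrow> 'm" where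
  "arrow \<alpha> = (\<lambda>y\<in>space (tail Q \<alpha>). emb (head Q \<alpha>) (map_at M \<alpha> (y (tail Q \<alpha>))))"

lemma arrow_emb:
  "\<alpha> \<in> arcs Q \<Longrightarrow> x \<in> car (tail Q \<alpha>) \<Longrightarrow> arrow \<alpha> (emb (tail Q \<alpha>) x) = emb (head Q \<alpha>) (map_at M \<alpha> x)"
  by (simp add: arrow_def space_def)

lemma submodule_iff_emb:
  assumes i: "i \<in> verts Q" and W: "W \<subseteq> car i"
  shows "submodule W F (space_at M i) \<longleftrightarrow> A.subspace (emb i ` W)"
proof -
  interpret Mi: module F "space_at M i" by (rule M_module[OF i])
  have mem: "emb i x \<in> emb i ` W \<longleftrightarrow> x \<in> W" for x using emb_inject[OF i] by (auto simp: image_iff)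
  show ?thesis
  proof
    assume sub: "submodule W F (space_at M i)"
    note E = Mi.submoduleE[OF sub]
    have z: "\<zero>\<^bsub>space_at M i\<^esub> \<in> W" using subgroup.one_closed[OF submodule.axioms(1)[OF sub]] by simp
    show "A.subspace (emb i ` W)"
    proof (rule A.subspaceI)
      show "emb i ` W \<subseteq> carrier A" using emb_closed[OF i] W by blast
      show "\<zero>\<^bsub>A\<^esub> \<in> emb i ` W" using z emb_zero[of i] by (metis imageI)
      fix x y assume "x \<in> emb i ` W" "y \<in> emb i ` W"
      then obtain x' y' where *: "x' \<in> W" "y' \<in> W" "x = emb i x'" "y = emb i y'" by blast
      then have "x \<oplus>\<^bsub>A\<^esub> y = emb i (x' \<oplus>\<^bsub>space_at M i\<^esub> y')" using emb_add[OF i subsetD[OF W *(1)] subsetD[OF W *(2)]] by (simp only: *)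
      then show "x \<oplus>\<^bsub>A\<^esub> y \<in> emb i ` W" using E(5) * by blast
    next
      fix c x assume c: "c \<in> carrier F" "x \<in> emb i ` W"
      then obtain x' where *: "x' \<in> W" "x = emb i x'" by blast
      then have "c \<odot>\<^bsub>A\<^esub> x = emb i (c \<odot>\<^bsub>space_at M i\<^esub> x')" using emb_smult[OF i c(1) subsetD[OF W *(1)]] by (simp only: *)
      then show "c \<odot>\<^bsub>A\<^esub> x \<in> emb i ` W" using E(4) c * by blast
    qed
  next
    assume sub: "A.subspace (emb i ` W)"
    have smult: "c \<odot>\<^bsub>space_at M i\<^esub> x \<in> W" if "c \<in> carrier F" "x \<in> W" for c x
      using A.subspace_smult[OF sub that(1) imageI[OF that(2)]] mem[of "c \<odot>\<^bsub>space_at M i\<^esub> x"]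
      by (simp only: emb_smult[OF i that(1) subsetD[OF W that(2)]])
    show "submodule W F (space_at M i)"
    proof (rule Mi.submoduleI)
      show "W \<subseteq> car i" by fact
      show "\<zero>\<^bsub>space_at M i\<^esub> \<in> W" using A.subspace_zero[OF sub] emb_zero[of i] mem by metis
      show "x \<oplus>\<^bsub>space_at M i\<^esub> y \<in> W" if "x \<in> W" "y \<in> W" for x y
        using A.subspace_add[OF sub imageI[OF that(1)] imageI[OF that(2)]] mem[of "x \<oplus>\<^bsub>space_at M i\<^esub> y"]
        by (simp only: emb_add[OF i subsetD[OF W that(1)] subsetD[OF W that(2)]])
      show "\<ominus>\<^bsub>space_at M i\<^esub> x \<in> W" if "x \<in> W" for x
      proof -
        have "\<ominus>\<^bsub>F\<^esub> \<one>\<^bsub>F\<^esub> \<in> carrier F" by simp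
        from smult[OF this that] show ?thesis using that W by (simp add: Mi.smult_l_minus subset_iff)
      qed
    qed (rule smult)
  qed
qed

lemma space_facts:
  assumes "i \<in> verts Q"
  shows "A.subspace (space i)" "finite (space i)" "card (space i) = card (car i)"
proof -
  interpret Mi: module F "space_at M i" by (rule M_module[OF assms])
  have "submodule (car i) F (space_at M i)" by (rule Mi.submoduleI) auto
  then show "A.subspace (space i)" using submodule_iff_emb[OF assms, of "car i"] by (simp add: space_def)
  show "finite (space i)" using M_finite[OF assms] by (simp add: space_def)
  show "card (space i) = card (car i)" unfolding space_def by (rule card_image[OF inj_emb[OF assms]])
qed

lemma emb_lin_iff: "emb i x \<in> space i \<longleftrightarrow> x \<in> car i" if "i \<in> verts Q"
  using emb_inject[OF that] by (auto simp: space_def)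

lemma lin_of_linear_maps:
  assumes i: "i \<in> verts Q" and j: "j \<in> verts Q" and f: "f \<in> linear_maps F (space_at M i) (space_at M j)"
  shows "(\<lambda>y\<in>space i. emb j (f (y i))) \<in> A.lin (space i) (space j)"
proof (rule A.linI)
  note l = linear_mapsD[OF f]
  interpret Mi: module F "space_at M i" by (rule M_module[OF i])
  let ?g = "\<lambda>y\<in>space i. emb j (f (y i))"
  have g: "?g (emb i x) = emb j (f x)" if "x \<in> car i" for x using that i by (simp add: space_def)
  fix x assume "x \<in> space i"
  then obtain x' where x: "x' \<in> car i" "x = emb i x'" by (auto simp: space_def)
  show "?g x \<in> space j" unfolding x(2) g[OF x(1)] using emb_lin_iff[OF j] l(1)[OF x(1)] by simp
  show "?g (c \<odot>\<^bsub>A\<^esub> x) = c \<odot>\<^bsub>A\<^esub> ?g x" if c: "c \<in> carrier F" for c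
  proof -
    have "c \<odot>\<^bsub>A\<^esub> x = emb i (c \<odot>\<^bsub>space_at M i\<^esub> x')" using emb_smult[OF i c x(1)] x(2) by simp
    then have "?g (c \<odot>\<^bsub>A\<^esub> x) = emb j (f (c \<odot>\<^bsub>space_at M i\<^esub> x'))" using g c x(1) by simp
    also have "\<dots> = c \<odot>\<^bsub>A\<^esub> ?g x" unfolding x(2) g[OF x(1)] l(3)[OF c x(1)] by (rule emb_smult[OF j c l(1)[OF x(1)]])
    finally show ?thesis .
  qed
  fix y assume "y \<in> space i"
  then obtain y' where y: "y' \<in> car i" "y = emb i y'" by (auto simp: space_def)
  have "x \<oplus>\<^bsub>A\<^esub> y = emb i (x' \<oplus>\<^bsub>space_at M i\<^esub> y')" using emb_add[OF i x(1) y(1)] x(2) y(2) by simp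
  then have "?g (x \<oplus>\<^bsub>A\<^esub> y) = emb j (f (x' \<oplus>\<^bsub>space_at M i\<^esub> y'))" using g x(1) y(1) by simp
  also have "\<dots> = ?g x \<oplus>\<^bsub>A\<^esub> ?g y"
    unfolding x(2) y(2) g[OF x(1)] g[OF y(1)] l(2)[OF x(1) y(1)] by (rule emb_add[OF j l(1)[OF x(1)] l(1)[OF y(1)]])
  finally show "?g (x \<oplus>\<^bsub>A\<^esub> y) = ?g x \<oplus>\<^bsub>A\<^esub> ?g y" .
qed simp

lemma linear_maps_of_lin:
  assumes i: "i \<in> verts Q" and j: "j \<in> verts Q" and f: "f \<in> A.lin (space i) (space j)"
  shows "(\<lambda>x. f (emb i x) j) \<in> linear_maps F (space_at M i) (space_at M j)"
proof (rule linear_mapsI)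
  have in_space: "emb i x \<in> space i" if "x \<in> car i" for x using emb_lin_iff[OF i] that by simp
  fix x assume x: "x \<in> car i"
  have "f (emb i x) \<in> space j" by (rule A.lin_closed[OF f in_space[OF x]])
  then show "f (emb i x) j \<in> car j" using j by (auto simp: space_def)
  show "f (emb i (c \<odot>\<^bsub>space_at M i\<^esub> x)) j = c \<odot>\<^bsub>space_at M j\<^esub> f (emb i x) j" if c: "c \<in> carrier F" for c
    unfolding emb_smult[OF i c x] A.lin_smult[OF f c in_space[OF x]] using j by (simp add: product_module_simps)
  show "f (emb i (x \<oplus>\<^bsub>space_at M i\<^esub> y)) j = f (emb i x) j \<oplus>\<^bsub>space_at M j\<^esub> f (emb i y) j"
    if y: "y \<in> car i" for y
    unfolding emb_add[OF i x y] A.lin_add[OF f in_space[OF x] in_space[OF y]] using j by (simp add: product_module_simps)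
qed

sublocale R: rigid_rep F A Q space arrow
proof (intro rigid_rep.intro rigid_rep_axioms.intro)
  show "finite_field_module F A" by (rule A.finite_field_module_axioms)
  show "fin_digraph Q" by (rule Q)
  show "A.subspace (space i) \<and> finite (space i)" if "i \<in> verts Q" for i using space_facts[OF that] by blast
  show "arrow \<alpha> \<in> A.lin (space (tail Q \<alpha>)) (space (head Q \<alpha>))" if "\<alpha> \<in> arcs Q" for \<alpha>
    unfolding arrow_def by (rule lin_of_linear_maps[OF _ _ M_map[OF that]]) (simp_all add: that)
next
  fix \<psi> assume \<psi>: "\<And>\<alpha>. \<alpha> \<in> arcs Q \<Longrightarrow> \<psi> \<alpha> \<in> A.lin (space (tail Q \<alpha>)) (space (head Q \<alpha>))"
  define \<psi>' where "\<psi>' \<alpha> x = \<psi> \<alpha> (emb (tail Q \<alpha>) x) (head Q \<alpha>)" for \<alpha> x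
  have "\<psi>' \<alpha> \<in> linear_maps F (space_at M (tail Q \<alpha>)) (space_at M (head Q \<alpha>))" if "\<alpha> \<in> arcs Q" for \<alpha>
    unfolding \<psi>'_def by (rule linear_maps_of_lin[OF _ _ \<psi>[OF that]]) (simp_all add: that)
  from rigid_surjective[OF wf M_rigid this] obtain \<phi> where
    \<phi>: "\<And>i. i \<in> verts Q \<Longrightarrow> \<phi> i \<in> linear_maps F (space_at M i) (space_at M i)"
      "\<And>\<alpha> x. \<alpha> \<in> arcs Q \<Longrightarrow> x \<in> car (tail Q \<alpha>) \<Longrightarrow>
        \<psi>' \<alpha> x \<oplus>\<^bsub>space_at M (head Q \<alpha>)\<^esub> map_at M \<alpha> (\<phi> (tail Q \<alpha>) x) = \<phi> (head Q \<alpha>) (map_at M \<alpha> x)"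
    by blast
  define \<theta> where "\<theta> i = (\<lambda>y\<in>space i. emb i (\<phi> i (y i)))" for i
  have "\<theta> i \<in> A.lin (space i) (space i)" if "i \<in> verts Q" for i
    unfolding \<theta>_def by (rule lin_of_linear_maps[OF that that \<phi>(1)[OF that]])
  moreover have "\<psi> \<alpha> y = \<theta> (head Q \<alpha>) (arrow \<alpha> y) \<ominus>\<^bsub>A\<^esub> arrow \<alpha> (\<theta> (tail Q \<alpha>) y)"
    if a: "\<alpha> \<in> arcs Q" and y: "y \<in> space (tail Q \<alpha>)" for \<alpha> y
  proof -
    let ?s = "tail Q \<alpha>" and ?t = "head Q \<alpha>"
    have st: "?s \<in> verts Q" "?t \<in> verts Q" using a by simp_all
    obtain x where x: "x \<in> car ?s" "y = emb ?s x" using y by (auto simp: space_def)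
    have \<theta>: "\<theta> i (emb i z) = emb i (\<phi> i z)" if "i \<in> verts Q" "z \<in> car i" for i z
      using that by (simp add: \<theta>_def space_def)
    have \<phi>x: "\<phi> ?s x \<in> car ?s" "map_at M \<alpha> x \<in> car ?t" "map_at M \<alpha> (\<phi> ?s x) \<in> car ?t"
      using linear_mapsD(1)[OF \<phi>(1)[OF st(1)] x(1)] linear_mapsD(1)[OF M_map[OF a]] x(1) by blast+
    have "\<psi> \<alpha> y \<in> space ?t" by (rule A.lin_closed[OF \<psi>[OF a] y])
    then obtain w where w: "w \<in> car ?t" "\<psi> \<alpha> y = emb ?t w" by (auto simp: space_def)
    have "\<psi>' \<alpha> x = w" using w(2) x(2) st by (simp add: \<psi>'_def)
    then have "emb ?t (\<phi> ?t (map_at M \<alpha> x)) = \<psi> \<alpha> y \<oplus>\<^bsub>A\<^esub> emb ?t (map_at M \<alpha> (\<phi> ?s x))"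
      using \<phi>(2)[OF a x(1)] emb_add[OF st(2) w(1) \<phi>x(3)] w(2) by simp
    moreover have "\<theta> ?t (arrow \<alpha> y) = emb ?t (\<phi> ?t (map_at M \<alpha> x))"
      using x \<theta>[OF st(2) \<phi>x(2)] arrow_emb[OF a x(1)] by simp
    moreover have "arrow \<alpha> (\<theta> ?s y) = emb ?t (map_at M \<alpha> (\<phi> ?s x))"
      using x \<theta>[OF st(1) x(1)] arrow_emb[OF a \<phi>x(1)] by simp
    ultimately have "\<theta> ?t (arrow \<alpha> y) = \<psi> \<alpha> y \<oplus>\<^bsub>A\<^esub> arrow \<alpha> (\<theta> ?s y)" by metis
    moreover have "\<psi> \<alpha> y \<in> carrier A" "arrow \<alpha> (\<theta> ?s y) \<in> carrier A"
      using emb_closed[OF st(2) w(1)] w(2) emb_closed[OF st(2) \<phi>x(3)] \<open>arrow \<alpha> (\<theta> ?s y) = emb ?t (map_at M \<alpha> (\<phi> ?s x))\<close>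
      by (simp_all only:)
    ultimately show ?thesis by (simp only: A.M.minus_eq A.M.a_assoc A.M.r_neg A.M.r_zero A.M.a_inv_closed)
  qed
  ultimately show "\<exists>\<phi>. (\<forall>i\<in>verts Q. \<phi> i \<in> A.lin (space i) (space i)) \<and>
      (\<forall>\<alpha>\<in>arcs Q. \<forall>x\<in>space (tail Q \<alpha>).
        \<psi> \<alpha> x = \<phi> (head Q \<alpha>) (arrow \<alpha> x) \<ominus>\<^bsub>A\<^esub> arrow \<alpha> (\<phi> (tail Q \<alpha>) x))" by blast
qed

lemma has_rank_iff_dim:
  assumes i: "i \<in> verts Q" and W: "submodule W F (space_at M i)"
  shows "has_rank F (space_at M i\<lparr>carrier := W\<rparr>) k \<longleftrightarrow> A.dim (emb i ` W) = k"
proof -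
  interpret Mi: module F "space_at M i" by (rule M_module[OF i])
  have sub: "W \<subseteq> car i" by (rule Mi.submoduleE(1)[OF W])
  then have fin: "finite W" using M_finite[OF i] finite_subset by blast
  have mod: "finite_field_module F (space_at M i\<lparr>carrier := W\<rparr>)"
    using submodule.submodule_is_module[OF W M_module[OF i]]
    by (simp add: finite_field_module_def finite_field_module_axioms_def F_field F_finite)
  have "card W = card (emb i ` W)" by (rule card_image[OF inj_emb[OF i], symmetric])
  also have "\<dots> = card (carrier F) ^ A.dim (emb i ` W)"
    by (rule A.card_eq_dim) (use submodule_iff_emb[OF i sub] W fin in auto)
  finally show ?thesis using has_rank_iff_card[OF mod] fin A.q_power_inject by simp
qed

text \<open>The embeddings of the spaces into the ambient module carry subrepresentations to stable families;
  evaluation at the vertex is inverse to this.\<close>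

lemma card_quiver_Grassmannian:
  "card (quiver_Grassmannian Q F e M) = card (R.quiver_grass (restrict e (verts Q)))"
proof -
  let ?G = "quiver_Grassmannian Q F e M" and ?G' = "R.quiver_grass (restrict e (verts Q))"
  let ?f = "\<lambda>U. \<lambda>i\<in>verts Q. emb i ` U i" and ?g = "\<lambda>B. \<lambda>i\<in>verts Q. (\<lambda>y. y i) ` B i"
  have G: "U \<in> ?G \<longleftrightarrow> U \<in> extensional (verts Q) \<and>
      (\<forall>i\<in>verts Q. submodule (U i) F (space_at M i) \<and> A.dim (emb i ` U i) = e i) \<and>
      (\<forall>\<alpha>\<in>arcs Q. map_at M \<alpha> ` U (tail Q \<alpha>) \<subseteq> U (head Q \<alpha>))" for U
    unfolding quiver_Grassmannian_def using has_rank_iff_dim by (auto simp: PiE_iff)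
  have G': "B \<in> ?G' \<longleftrightarrow> B \<in> extensional (verts Q) \<and>
      (\<forall>i\<in>verts Q. A.subspace (B i) \<and> B i \<subseteq> space i \<and> A.dim (B i) = e i) \<and>
      (\<forall>\<alpha>\<in>arcs Q. arrow \<alpha> ` B (tail Q \<alpha>) \<subseteq> B (head Q \<alpha>))" for B
    unfolding R.quiver_grass_def R.stable_def A.grass_def by (auto simp: PiE_iff)
  have sub: "U i \<subseteq> car i" if "U \<in> ?G" "i \<in> verts Q" for U i
    using that module.submoduleE(1)[OF M_module] unfolding G by blast
  have gf: "(\<lambda>y. y i) ` emb i ` W = W" if "i \<in> verts Q" for i W
    using that by (simp add: image_image)
  have fg: "emb i ` (\<lambda>y. y i) ` W = W" if "i \<in> verts Q" "W \<subseteq> space i" for i W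
  proof -
    have "emb i (y i) = y" if y: "y \<in> W" for y
    proof -
      obtain x where "y = emb i x" using y \<open>W \<subseteq> space i\<close> by (auto simp: space_def)
      then show ?thesis using \<open>i \<in> verts Q\<close> by simp
    qed
    then show ?thesis by (simp add: image_image)
  qed
  have "bij_betw ?f ?G ?G'"
  proof (rule bij_betwI[where g = ?g])
    show "?f \<in> ?G \<rightarrow> ?G'"
    proof
      fix U assume U: "U \<in> ?G"
      have "arrow \<alpha> ` emb (tail Q \<alpha>) ` U (tail Q \<alpha>) \<subseteq> emb (head Q \<alpha>) ` U (head Q \<alpha>)" if a: "\<alpha> \<in> arcs Q" for \<alpha>
      proof -
        have "arrow \<alpha> ` emb (tail Q \<alpha>) ` U (tail Q \<alpha>) = emb (head Q \<alpha>) ` map_at M \<alpha> ` U (tail Q \<alpha>)"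
          using sub[OF U tail_in[OF a]] arrow_emb[OF a] by (force simp: image_image)
        also have "\<dots> \<subseteq> emb (head Q \<alpha>) ` U (head Q \<alpha>)" using U a unfolding G by blast
        finally show ?thesis .
      qed
      moreover have "A.subspace (emb i ` U i) \<and> emb i ` U i \<subseteq> space i \<and> A.dim (emb i ` U i) = e i"
        if "i \<in> verts Q" for i
        using U that submodule_iff_emb[OF that sub[OF U that]] sub[OF U that] unfolding G space_def by blast
      ultimately show "?f U \<in> ?G'" unfolding G' by simp
    qed
    show "?g \<in> ?G' \<rightarrow> ?G"
    proof
      fix B assume B: "B \<in> ?G'"
      have B_in: "B i \<subseteq> space i" if "i \<in> verts Q" for i using B that unfolding G' by blast
      have s: "(\<lambda>y. y i) ` B i \<subseteq> car i" if "i \<in> verts Q" for i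
        using B_in[OF that] that by (auto simp: space_def)
      have "submodule ((\<lambda>y. y i) ` B i) F (space_at M i) \<and> A.dim (emb i ` (\<lambda>y. y i) ` B i) = e i"
        if "i \<in> verts Q" for i
        unfolding submodule_iff_emb[OF that s[OF that]] fg[OF that B_in[OF that]] using B that unfolding G' by blast
      moreover have "map_at M \<alpha> ` (\<lambda>y. y (tail Q \<alpha>)) ` B (tail Q \<alpha>) \<subseteq> (\<lambda>y. y (head Q \<alpha>)) ` B (head Q \<alpha>)"
        if a: "\<alpha> \<in> arcs Q" for \<alpha>
      proof (intro image_subsetI, elim imageE)
        fix x y assume y: "y \<in> B (tail Q \<alpha>)" "x = y (tail Q \<alpha>)"
        have ys: "y \<in> space (tail Q \<alpha>)" using B_in[OF tail_in[OF a]] y(1) by blast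
        have "arrow \<alpha> y \<in> B (head Q \<alpha>)" using B y(1) a unfolding G' by blast
        moreover have "arrow \<alpha> y (head Q \<alpha>) = map_at M \<alpha> x" using ys a y(2) by (simp add: arrow_def)
        ultimately show "map_at M \<alpha> x \<in> (\<lambda>y. y (head Q \<alpha>)) ` B (head Q \<alpha>)"
          by (intro image_eqI[of _ _ "arrow \<alpha> y"]) simp_all
      qed
      ultimately show "?g B \<in> ?G" unfolding G by simp
    qed
    show "?g (?f U) = U" if "U \<in> ?G" for U
      by (rule extensionalityI[of _ "verts Q"]) (use that gf in \<open>auto simp: G\<close>)
    show "?f (?g B) = B" if "B \<in> ?G'" for B
      by (rule extensionalityI[of _ "verts Q"]) (use that fg in \<open>auto simp: G'\<close>)
  qed
  then show ?thesis by (rule bij_betw_same_card)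
qed

end

section \<open>Points over finite fields\<close>

text \<open>The residue field modulo \<open>p\<close>, carried over from the integers to the natural numbers.\<close>

lemma ex_prime_field:
  assumes "prime p" shows "\<exists>F :: nat ring. field F \<and> card (carrier F) = p"
proof -
  interpret residues_prime p "residue_ring (int p)" by (rule residues_prime.intro) (use assms in auto)
  have inj: "inj_on nat (carrier (residue_ring (int p)))" by (auto simp: inj_on_def res_carrier_eq)
  have "field (image_ring nat (residue_ring (int p)))"
    using inj_imp_image_ring_is_field[OF inj] .
  moreover have "card (carrier (image_ring nat (residue_ring (int p)))) = p"
    unfolding image_ring_carrier card_image[OF inj] by (simp add: res_carrier_eq)
  ultimately show ?thesis by blast
qed

theorem corollary2:
  fixes Q :: "('v, 'a) pre_digraph"
    and K :: "'k ring"
    and M :: "('v, 'a, 'k, 'm) rep"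
    and M\<^sub>Z :: "('v, 'a, int, 'n) rep"
    and e :: "'v \<Rightarrow> nat"
  assumes "fin_digraph Q"
    and "algebraically_closed K"
    and "finite_free_representation Q K M"
    and "rigid Q K M"
    and "quiver_Grassmannian Q K e M \<noteq> {}"
    and "rigid_Z_form Q K M M\<^sub>Z"
  shows "\<exists>P :: int poly. \<forall>q :: nat. primepow q \<longrightarrow>
    (\<forall>F :: nat ring. field F \<and> card (carrier F) = q \<longrightarrow>
      int (card (scheme_points Q e M\<^sub>Z F)) = poly P (int q))"
proof -
  have free: "finite_free_representation Q \<Z> M\<^sub>Z"
    and rig: "\<And>F :: nat ring. field F \<Longrightarrow> rigid Q F (base_change Q M\<^sub>Z F)"
    using assms(6) by (auto simp: rigid_Z_form_def)
  have "\<exists>n. has_rank \<Z> (space_at M\<^sub>Z i) n" if "i \<in> verts Q" for i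
    using free that by (simp add: finite_free_representation_def)
  then obtain d where d: "\<And>i. i \<in> verts Q \<Longrightarrow> has_rank \<Z> (space_at M\<^sub>Z i) (d i)" by metis
  have card_base: "card (carrier (space_at (base_change Q M\<^sub>Z F) i)) = card (carrier F) ^ d i"
    if F: "field F" and i: "i \<in> verts Q" for F :: "nat ring" and i
  proof -
    obtain b where "is_basis \<Z> (space_at M\<^sub>Z i) (d i) b" using d[OF i] by (auto simp: has_rank_def)
    moreover have "module \<Z> (space_at M\<^sub>Z i)"
      using free i by (simp add: finite_free_representation_def representation_def)
    moreover have "cring F" using F by (simp add: field_def domain_def)
    ultimately have "free_base_change (space_at M\<^sub>Z i) F (d i) b" by (simp add: free_base_change_def)
    then show ?thesis using free_base_change.card_tensor by (simp add: base_change_def)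
  qed
  have inst: "finite_rigid Q F (base_change Q M\<^sub>Z F)"
    if F: "field F" and fin: "finite (carrier F)" for F :: "nat ring"
  proof (rule finite_rigid.intro)
    fix i assume i: "i \<in> verts Q"
    \<comment> \<open>An infinite set has \<open>card\<close> zero, so a non-zero number of elements proves finiteness.\<close>
    have "carrier F \<noteq> {}" using F by (metis cring.axioms(1) domain.axioms(1) empty_iff field.axioms(1) ring.ring_simprules(2))
    then have "card (carrier (space_at (base_change Q M\<^sub>Z F) i)) \<noteq> 0"
      using card_base[OF F i] fin by simp
    then show "finite (carrier (space_at (base_change Q M\<^sub>Z F) i))" by (meson card.infinite)
  qed (use assms(1) F fin rig in auto)
  have rep: "rigid_rep F (finite_rigid.A Q (base_change Q M\<^sub>Z F)) Q (finite_rigid.space Q (base_change Q M\<^sub>Z F))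
       (finite_rigid.arrow Q (base_change Q M\<^sub>Z F)) \<and>
      rigid_rep.dims F Q (finite_rigid.space Q (base_change Q M\<^sub>Z F)) = restrict d (verts Q)"
    if F: "field F" and fin: "finite (carrier F)" for F :: "nat ring"
  proof -
    interpret finite_rigid Q F "base_change Q M\<^sub>Z F" by (rule inst[OF that])
    have "A.dim (space i) = d i" if "i \<in> verts Q" for i
      by (rule A.dimI) (simp add: space_facts(3)[OF that] card_base[OF F that])
    then have "R.dims space = restrict d (verts Q)" unfolding R.dims_def by (intro restrict_ext)
    then show ?thesis using R.rigid_rep_axioms by blast
  qed
  \<comment> \<open>The prime fields alone give infinitely many values of \<open>q\<close>.\<close>
  have "{p :: nat. prime p} \<subseteq> {card (carrier F) | (F :: nat ring)
      (A :: (nat, 'v \<Rightarrow> ('n \<times> nat \<Rightarrow>\<^sub>0 int) set) module) M m.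
      rigid_rep F A Q M m \<and> rigid_rep.dims F Q M = restrict d (verts Q)}"
  proof
    fix p :: nat assume "p \<in> {p. prime p}"
    then obtain F :: "nat ring" where F: "field F" "card (carrier F) = p" and p: "p > 0"
      using ex_prime_field prime_gt_0_nat by blast
    then have "finite (carrier F)" by (metis card.infinite less_irrefl)
    with rep[OF F(1)] F(2) show "p \<in> {card (carrier F) | (F :: nat ring)
      (A :: (nat, 'v \<Rightarrow> ('n \<times> nat \<Rightarrow>\<^sub>0 int) set) module) M m.
      rigid_rep F A Q M m \<and> rigid_rep.dims F Q M = restrict d (verts Q)}" by blast
  qed
  then have "infinite {card (carrier F) | (F :: nat ring)
      (A :: (nat, 'v \<Rightarrow> ('n \<times> nat \<Rightarrow>\<^sub>0 int) set) module) M m.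
      rigid_rep F A Q M m \<and> rigid_rep.dims F Q M = restrict d (verts Q)}"
    using primes_infinite infinite_super by blast
  from quiver_grass_polynomial[OF this, of "restrict e (verts Q)"]
  obtain P where P: "\<And>(F :: nat ring) (A :: (nat, 'v \<Rightarrow> ('n \<times> nat \<Rightarrow>\<^sub>0 int) set) module) M m.
      rigid_rep F A Q M m \<Longrightarrow> rigid_rep.dims F Q M = restrict d (verts Q) \<Longrightarrow>
      int (card (rigid_rep.quiver_grass F A Q M m (restrict e (verts Q)))) = poly P (int (card (carrier F)))"
    by auto
  have "int (card (scheme_points Q e M\<^sub>Z F)) = poly P (int q)"
    if "primepow q" and F: "field F" "card (carrier F) = q" for q and F :: "nat ring"
  proof -
    have "finite (carrier F)" using that primepow_gt_Suc_0[of q] by (metis card.infinite not_less_zero)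
    then have fin: "finite (carrier F)" .
    show ?thesis
      unfolding scheme_points_def finite_rigid.card_quiver_Grassmannian[OF inst[OF F(1) fin]]
      using P rep[OF F(1) fin] F(2) by blast
  qed
  then show ?thesis by blast
qed

end
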